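(* Let $m>0$, let $j\ge0$ be a half-integer, and let $(A,B)$ and $(C,D)$ be admissible pairs for $j$. Let $\psi^{AB}$ and $\psi^{CD}$ be the normalized free fields of types $(A,B)$ and $(C,D)$ for a massive particle of mass $m$ and spin $j$. Then $$\psi^{AB}(x)=\Pi^{AB,CD}(-i\partial)\,\psi^{CD}(x),$$ where $\Pi^{AB,CD}(-i\partial)$ denotes the matrix differential operator obtained by substituting $-i\partial_\mu$ for $p_\mu$ in a polynomial $P(\mathbf p,p^0)$ with $(2A+1)(2B+1)\times(2C+1)(2D+1)$ matrix coefficients having the following properties (such a polynomial exists): $P(\mathbf p,\sqrt{\mathbf p^2+m^2})=\Pi^{AB,CD}(\mathbf p,\sqrt{\mathbf p^2+m^2})$ for all $\mathbf p\in\mathbb{R}^3$, where $\Pi^{AB,CD}$ is the twisted spin sum; $P(-\mathbf p,-p^0)=(-1)^{2A+2C}P(\mathbf p,p^0)$ for all 4-vectors $p$; and the degree $d$ of every monomial in $P$ satisfies $\max\{|A-C|,|B-D|\}\le d/2\le\min\{A+C,B+D\}$.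
   Context: Kinematics. Spacetime metric of signature $(+,+,+,-)$, with the minus sign for the time component $x^0$: $p\cdot x=\mathbf p\cdot\mathbf x-p^0x^0$, and $p_i=p^i$, $p_0=-p^0$. The mass shell is $p^0=\sqrt{\mathbf p^2+m^2}$, with rest momentum $k=(\mathbf p=\mathbf 0,\,p^0=m)$. The covering $\lambda:SL(2,\mathbb{C})\to SO^+(1,3)$ is given by $X(\lambda(\Lambda)p)=\Lambda X(p)\Lambda^\dagger$, where $X(p)=p^0I-\mathbf p\cdot\boldsymbol\sigma$ ($\boldsymbol\sigma$ the Pauli matrices). $L(p)$ is the standard boost: the positive definite Hermitian element of $SL(2,\mathbb{C})$ with $\lambda(L(p))k=p$. Substituting $-i\partial_\mu$ for $p_\mu$ means $p^i\to -i\,\partial/\partial x^i$ and $p^0\to i\,\partial/\partial x^0$. Representations. $D^{(s)}$ is the spin-$s$ irreducible representation of $SU(2)$ of dimension $2s+1$, unitary in its standard basis, extended holomorphically to $SL(2,\mathbb{C})$. $D^{AB}(\Lambda)=D^{(A)}(\Lambda)\otimes D^{(B)}((\Lambda^\dagger)^{-1})$ is the $(A,B)$ irreducible representation of $SL(2,\mathbb{C})$; its restriction to $SU(2)$ is unitary. A pair $(A,B)$ of non-negative half-integers is admissible for $j$ if $|A-B|\le j\le A+B$ and $A+B-j\in\mathbb{Z}$. Coefficient functions. For each admissible $(A,B)$, $u^{AB}(\mathbf p)$ and $v^{AB}(\mathbf p)$ are $(2A+1)(2B+1)\times(2j+1)$ matrices with $u^{AB}(\mathbf p)=(m/p^0)^{1/2}D^{AB}(L(p))u^{AB}(\mathbf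 0)$ and $v^{AB}(\mathbf p)=(m/p^0)^{1/2}D^{AB}(L(p))v^{AB}(\mathbf 0)$, where for all $W\in SU(2)$: $u^{AB}(\mathbf 0)D^{(j)}(W)=D^{AB}(W)u^{AB}(\mathbf 0)$ and $v^{AB}(\mathbf 0)\overline{D^{(j)}(W)}=D^{AB}(W)v^{AB}(\mathbf 0)$. They are normalized by $u^{AB}(\mathbf 0)^\dagger u^{AB}(\mathbf 0)=I=v^{AB}(\mathbf 0)^\dagger v^{AB}(\mathbf 0)$, and phases are chosen so that $u^{AB}(\mathbf 0)u^{CD}(\mathbf 0)^\dagger=v^{AB}(\mathbf 0)v^{CD}(\mathbf 0)^\dagger$ for all admissible $(A,B),(C,D)$. Fields. The normalized free field is the vector of components $$\psi^{AB}_{ab}(x)=(2\pi)^{-3/2}\sum_\sigma\int d^3p\,\big[e^{ip\cdot x}u^{AB}_{ab}(\mathbf p,\sigma)a(\mathbf p,\sigma)+e^{-ip\cdot x}(-1)^{2B}v^{AB}_{ab}(\mathbf p,\sigma)a^{c\dagger}(\mathbf p,\sigma)\big],$$ where $p^0=\sqrt{\mathbf p^2+m^2}$ and $a$, $a^{c\dagger}$ are the particle annihilation and antiparticle creation operators (the same for all fields). Twisted spin sum. For $p$ on the mass shell, $\Pi^{AB,CD}(p)=D^{AB}(L(p))u^{AB}(\mathbf 0)u^{CD}(\mathbf 0)^\dagger D^{CD}(L(p))^{-1}$ $\big(=D^{AB}(L(p))v^{AB}(\mathbf 0)v^{CD}(\mathbf 0)^\dagger D^{CD}(L(p))^{-1}\big)$.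 *)

theory Defs
  imports
    "HOL-Analysis.Analysis"
    "HOL-Computational_Algebra.Polynomial"
    "Jordan_Normal_Form.Gauss_Jordan_Elimination"
    "Jordan_Normal_Form.Schur_Decomposition"
begin

section \<open>Kinematics\<close>

text \<open>A 4-vector is a pair (spatial part, time component); the pairing is the Minkowski one
  of signature (+,+,+,-).\<close>

type_synonym fourvec = "(real^3) \<times> real"

definition mdot :: "fourvec \<Rightarrow> fourvec \<Rightarrow> real" where
  "mdot p x = inner (fst p) (fst x) - snd p * snd x"

definition energy :: "real \<Rightarrow> real^3 \<Rightarrow> real" where
  "energy m p = sqrt ((norm p)\<^sup>2 + m\<^sup>2)"

definition on_shell :: "real \<Rightarrow> real^3 \<Rightarrow> fourvec" where
  "on_shell m p = (p, energy m p)"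

definition pauli :: "3 \<Rightarrow> complex mat" where
  "pauli i =
     (if i = 1 then mat_of_rows_list 2 [[0, 1], [1, 0]]
      else if i = 2 then mat_of_rows_list 2 [[0, - \<i>], [\<i>, 0]]
      else mat_of_rows_list 2 [[1, 0], [0, - 1]])"

definition Xmat :: "fourvec \<Rightarrow> complex mat" where
  "Xmat p = complex_of_real (snd p) \<cdot>\<^sub>m 1\<^sub>m 2
     - (complex_of_real (vec_nth (fst p) 1) \<cdot>\<^sub>m pauli 1
        + complex_of_real (vec_nth (fst p) 2) \<cdot>\<^sub>m pauli 2
        + complex_of_real (vec_nth (fst p) 3) \<cdot>\<^sub>m pauli 3)"

definition SL2C :: "complex mat set" where
  "SL2C = {M \<in> carrier_mat 2 2. Determinant.det M = 1}"

definition SU2 :: "complex mat set" where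
  "SU2 = {W \<in> SL2C. mat_adjoint W * W = 1\<^sub>m 2}"

definition lorentz :: "complex mat \<Rightarrow> fourvec \<Rightarrow> fourvec" where
  "lorentz M p = (THE q. Xmat q = M * Xmat p * mat_adjoint M)"

definition pos_def_hermitian :: "nat \<Rightarrow> complex mat \<Rightarrow> bool" where
  "pos_def_hermitian n M \<longleftrightarrow> M \<in> carrier_mat n n \<and> mat_adjoint M = M \<and>
     (\<forall>w \<in> carrier_vec n. w \<noteq> 0\<^sub>v n \<longrightarrow> 0 < Re ((M *\<^sub>v w) \<bullet>c w))"

definition boost :: "real \<Rightarrow> fourvec \<Rightarrow> complex mat" where
  "boost m p = (THE M. M \<in> SL2C \<and> pos_def_hermitian 2 M \<and> lorentz M (0, m) = p)"


section \<open>Representations\<close>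

text \<open>Spins are real numbers \<open>s\<close> with \<open>2 * s\<close> a natural number.\<close>

definition half_int :: "real \<Rightarrow> bool" where
  "half_int s \<longleftrightarrow> 2 * s \<in> \<nat>"

definition twice :: "real \<Rightarrow> nat" where
  "twice s = nat \<lfloor>2 * s\<rfloor>"

definition admissible :: "real \<Rightarrow> real \<Rightarrow> real \<Rightarrow> bool" where
  "admissible j A B \<longleftrightarrow> half_int A \<and> half_int B \<and>
     \<bar>A - B\<bar> \<le> j \<and> j \<le> A + B \<and> A + B - j \<in> \<int>"

text \<open>The spin-\<open>s\<close> representation is realised on the symmetric power of order \<open>n = 2 * s\<close> of
  \<open>\<complex>\<^sup>2\<close>, i.e. on binary forms of degree \<open>n\<close>. Its standard orthonormal basis is
  \<open>e\<^sub>k = sqrt (n choose k) x\<^bsup>n-k\<^esup> y\<^bsup>k\<^esup>\<close> for \<open>k = 0, ..., n\<close>, where \<open>e\<^sub>k\<close> is the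
  state with third spin component \<open>s - k\<close>. The matrix \<open>M\<close> acts by
  \<open>x \<mapsto> M\<^sub>0\<^sub>0 x + M\<^sub>1\<^sub>0 y\<close> and \<open>y \<mapsto> M\<^sub>0\<^sub>1 x + M\<^sub>1\<^sub>1 y\<close>; below, forms are dehomogenised by
  putting \<open>x = 1\<close>. For \<open>s = 1/2\<close> this is \<open>M\<close> itself.\<close>

definition spin_rep :: "real \<Rightarrow> complex mat \<Rightarrow> complex mat" where
  "spin_rep s M = (let n = twice s in
     mat (n + 1) (n + 1) (\<lambda>(l, k).
       complex_of_real (sqrt (real (n choose k) / real (n choose l))) *
       Polynomial.coeff ([: M $$ (0, 0), M $$ (1, 0) :] ^ (n - k) *
                         [: M $$ (0, 1), M $$ (1, 1) :] ^ k) l))"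

text \<open>The tensor basis vector \<open>(a, b)\<close> has the single index \<open>a * n + b\<close>, where \<open>n\<close> is the
  dimension of the second factor.\<close>

definition kron :: "complex mat \<Rightarrow> complex mat \<Rightarrow> complex mat" where
  "kron M N = mat (dim_row M * dim_row N) (dim_col M * dim_col N)
     (\<lambda>(i, k). M $$ (i div dim_row N, k div dim_col N) *
               N $$ (i mod dim_row N, k mod dim_col N))"

definition inv_mat :: "complex mat \<Rightarrow> complex mat" where
  "inv_mat M = the (mat_inverse M)"

definition AB_rep :: "real \<Rightarrow> real \<Rightarrow> complex mat \<Rightarrow> complex mat" where
  "AB_rep A B M = kron (spin_rep A M) (spin_rep B (inv_mat (mat_adjoint M)))"

definition AB_dim :: "real \<Rightarrow> real \<Rightarrow> nat" where
  "AB_dim A B = (twice A + 1) * (twice B + 1)"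


section \<open>Coefficient functions and the twisted spin sum\<close>

text \<open>\<open>u A B\<close> and \<open>v A B\<close> are the coefficient matrices at zero momentum.\<close>

definition coefficient_system ::
    "real \<Rightarrow> (real \<Rightarrow> real \<Rightarrow> complex mat) \<Rightarrow> (real \<Rightarrow> real \<Rightarrow> complex mat) \<Rightarrow> bool" where
  "coefficient_system j u v \<longleftrightarrow>
     (\<forall>A B. admissible j A B \<longrightarrow>
        u A B \<in> carrier_mat (AB_dim A B) (twice j + 1) \<and>
        v A B \<in> carrier_mat (AB_dim A B) (twice j + 1) \<and>
        (\<forall>W \<in> SU2. u A B * spin_rep j W = AB_rep A B W * u A B) \<and>
        (\<forall>W \<in> SU2. v A B * map_mat cnj (spin_rep j W) = AB_rep A B W * v A B) \<and>
        mat_adjoint (u A B) * u A B = 1\<^sub>m (twice j + 1) \<and>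
        mat_adjoint (v A B) * v A B = 1\<^sub>m (twice j + 1)) \<and>
     (\<forall>A B C D. admissible j A B \<longrightarrow> admissible j C D \<longrightarrow>
        u A B * mat_adjoint (u C D) = v A B * mat_adjoint (v C D))"

definition coeff_fun ::
    "real \<Rightarrow> real \<Rightarrow> real \<Rightarrow> (real \<Rightarrow> real \<Rightarrow> complex mat) \<Rightarrow> real^3 \<Rightarrow> complex mat" where
  "coeff_fun m A B u p =
     complex_of_real (sqrt (m / energy m p)) \<cdot>\<^sub>m (AB_rep A B (boost m (on_shell m p)) * u A B)"

definition twisted_spin_sum ::
    "real \<Rightarrow> (real \<Rightarrow> real \<Rightarrow> complex mat) \<Rightarrow> real \<Rightarrow> real \<Rightarrow> real \<Rightarrow> real \<Rightarrow> fourvec \<Rightarrow> complex mat" where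
  "twisted_spin_sum m u A B C D p =
     AB_rep A B (boost m p) * u A B * mat_adjoint (u C D) * inv_mat (AB_rep C D (boost m p))"


section \<open>Matrix polynomials and matrix differential operators\<close>

text \<open>The multi-index \<open>(a\<^sub>1, a\<^sub>2, a\<^sub>3, a\<^sub>0)\<close> holds the exponents of \<open>p\<^sup>1, p\<^sup>2, p\<^sup>3, p\<^sup>0\<close>. A matrix
  polynomial is its family of coefficient matrices.\<close>

type_synonym multi_index = "nat \<times> nat \<times> nat \<times> nat"
type_synonym mat_poly = "multi_index \<Rightarrow> complex mat"

definition support :: "nat \<Rightarrow> nat \<Rightarrow> mat_poly \<Rightarrow> multi_index set" where
  "support nr nc P = {\<alpha>. P \<alpha> \<noteq> 0\<^sub>m nr nc}"

definition is_mat_poly :: "nat \<Rightarrow> nat \<Rightarrow> mat_poly \<Rightarrow> bool" where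
  "is_mat_poly nr nc P \<longleftrightarrow> (\<forall>\<alpha>. P \<alpha> \<in> carrier_mat nr nc) \<and> finite (support nr nc P)"

fun monomial_degree :: "multi_index \<Rightarrow> nat" where
  "monomial_degree (a1, a2, a3, a0) = a1 + a2 + a3 + a0"

fun monomial_eval :: "multi_index \<Rightarrow> fourvec \<Rightarrow> real" where
  "monomial_eval (a1, a2, a3, a0) (p, p0) =
     vec_nth p 1 ^ a1 * vec_nth p 2 ^ a2 * vec_nth p 3 ^ a3 * p0 ^ a0"

definition poly_eval :: "nat \<Rightarrow> nat \<Rightarrow> mat_poly \<Rightarrow> fourvec \<Rightarrow> complex mat" where
  "poly_eval nr nc P p = mat nr nc (\<lambda>(i, k).
     \<Sum>\<alpha>\<in>support nr nc P. complex_of_real (monomial_eval \<alpha> p) * P \<alpha> $$ (i, k))"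

definition is_twisted_poly ::
    "real \<Rightarrow> (real \<Rightarrow> real \<Rightarrow> complex mat) \<Rightarrow> real \<Rightarrow> real \<Rightarrow> real \<Rightarrow> real \<Rightarrow> mat_poly \<Rightarrow> bool" where
  "is_twisted_poly m u A B C D P \<longleftrightarrow> (let nr = AB_dim A B; nc = AB_dim C D in
     is_mat_poly nr nc P \<and>
     (\<forall>p. poly_eval nr nc P (on_shell m p) = twisted_spin_sum m u A B C D (on_shell m p)) \<and>
     (\<forall>p. poly_eval nr nc P (- p) = (- 1) ^ (twice A + twice C) \<cdot>\<^sub>m poly_eval nr nc P p) \<and>
     (\<forall>\<alpha> \<in> support nr nc P.
        max \<bar>A - C\<bar> \<bar>B - D\<bar> \<le> real (monomial_degree \<alpha>) / 2 \<and>
        real (monomial_degree \<alpha>) / 2 \<le> min (A + C) (B + D)))"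

definition partial :: "fourvec \<Rightarrow> (fourvec \<Rightarrow> complex) \<Rightarrow> fourvec \<Rightarrow> complex" where
  "partial e f x = vector_derivative (\<lambda>t. f (x + t *\<^sub>R e)) (at 0)"

definition momentum_op :: "3 \<Rightarrow> (fourvec \<Rightarrow> complex) \<Rightarrow> fourvec \<Rightarrow> complex" where
  "momentum_op i f = (\<lambda>x. - \<i> * partial (axis i 1, 0) f x)"

text \<open>The sign differs from the spatial case because \<open>p\<^sub>0 = - p\<^sup>0\<close>.\<close>

definition energy_op :: "(fourvec \<Rightarrow> complex) \<Rightarrow> fourvec \<Rightarrow> complex" where
  "energy_op f = (\<lambda>x. \<i> * partial (0, 1) f x)"

fun monomial_op :: "multi_index \<Rightarrow> (fourvec \<Rightarrow> complex) \<Rightarrow> fourvec \<Rightarrow> complex" where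
  "monomial_op (a1, a2, a3, a0) f =
     (momentum_op 1 ^^ a1) ((momentum_op 2 ^^ a2) ((momentum_op 3 ^^ a3) ((energy_op ^^ a0) f)))"

definition diff_op ::
    "nat \<Rightarrow> nat \<Rightarrow> mat_poly \<Rightarrow> (nat \<Rightarrow> fourvec \<Rightarrow> complex) \<Rightarrow> nat \<Rightarrow> fourvec \<Rightarrow> complex" where
  "diff_op nr nc P f i x =
     (\<Sum>k<nc. \<Sum>\<alpha>\<in>support nr nc P. P \<alpha> $$ (i, k) * monomial_op \<alpha> (f k) x)"


section \<open>Fock space and the free field\<close>

text \<open>A one-particle configuration is (species, spin index, momentum); spin index \<open>\<sigma>\<close> in
  \<open>{0..2 * j}\<close> stands for third spin component \<open>j - \<sigma>\<close> as above. The species labels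
  distinguish particle and antiparticle. A state assigns to every list of \<open>n\<close> configurations the
  value of its \<open>n\<close>-particle wave function.\<close>

type_synonym 'k config = "'k \<times> nat \<times> (real^3)"
type_synonym 'k state = "'k config list \<Rightarrow> complex"

primrec config_integral :: "real \<Rightarrow> nat \<Rightarrow> ('k::finite config list \<Rightarrow> complex) \<Rightarrow> complex" where
  "config_integral j 0 F = F []"
| "config_integral j (Suc n) F = (\<Sum>s\<in>UNIV. \<Sum>\<sigma>\<le>twice j.
     LINT p|lborel. config_integral j n (\<lambda>qs. F ((s, \<sigma>, p) # qs)))"

definition fock_inner :: "real \<Rightarrow> 'k::finite state \<Rightarrow> 'k state \<Rightarrow> complex" where
  "fock_inner j \<Phi> \<Psi> = (\<Sum>n. config_integral j n (\<lambda>qs. cnj (\<Phi> qs) * \<Psi> qs))"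

text \<open>The (dense) domain of states with finitely many particles and continuous, rapidly
  decreasing wave functions, symmetric for integer spin and antisymmetric for half-odd-integer
  spin. Each \<open>annihilate s \<sigma> p\<close> below is a genuine operator on it, and matrix elements of the
  field between its states are smooth functions on spacetime.\<close>

definition fock_domain :: "real \<Rightarrow> 'k state set" where
  "fock_domain j = {\<Phi>.
     (\<exists>N. \<forall>qs. length qs > N \<longrightarrow> \<Phi> qs = 0) \<and>
     (\<forall>qs. \<forall>q\<in>set qs. fst (snd q) > twice j \<longrightarrow> \<Phi> qs = 0) \<and>
     (\<forall>qs q q' qs'. \<Phi> (qs @ q # q' # qs') = (- 1) ^ twice j * \<Phi> (qs @ q' # q # qs')) \<and>
     (\<forall>ls. continuous_on UNIV (\<lambda>k::nat \<Rightarrow> real^3.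
        \<Phi> (map (\<lambda>i. (fst (ls ! i), snd (ls ! i), k i)) [0..<length ls]))) \<and>
     (\<forall>n N. \<exists>K. \<forall>qs. length qs = n \<longrightarrow>
        (\<Prod>q\<leftarrow>qs. (1 + norm (snd (snd q))) ^ N) * norm (\<Phi> qs) \<le> K)}"

definition annihilate :: "'k \<Rightarrow> nat \<Rightarrow> real^3 \<Rightarrow> 'k state \<Rightarrow> 'k state" where
  "annihilate s \<sigma> p \<Phi> = (\<lambda>qs. complex_of_real (sqrt (real (length qs + 1))) * \<Phi> ((s, \<sigma>, p) # qs))"

text \<open>Creation operators at sharp momentum exist only as sesquilinear forms, the formal adjoints
  of annihilation operators; accordingly the field at a point is the sesquilinear form
  \<open>\<langle>\<Phi>, \<psi>(x) \<Psi>\<rangle>\<close>.\<close>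

definition annihilation_form ::
    "real \<Rightarrow> 'k::finite \<Rightarrow> nat \<Rightarrow> real^3 \<Rightarrow> 'k state \<Rightarrow> 'k state \<Rightarrow> complex" where
  "annihilation_form j s \<sigma> p \<Phi> \<Psi> = fock_inner j \<Phi> (annihilate s \<sigma> p \<Psi>)"

definition creation_form ::
    "real \<Rightarrow> 'k::finite \<Rightarrow> nat \<Rightarrow> real^3 \<Rightarrow> 'k state \<Rightarrow> 'k state \<Rightarrow> complex" where
  "creation_form j s \<sigma> p \<Phi> \<Psi> = fock_inner j (annihilate s \<sigma> p \<Phi>) \<Psi>"

text \<open>Component \<open>i\<close> of the field of type \<open>(A, B)\<close> for the particle species \<open>s\<close> with
  antiparticle species \<open>s'\<close>; a self-conjugate particle has \<open>s' = s\<close>.\<close>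

definition free_field ::
    "real \<Rightarrow> real \<Rightarrow> (real \<Rightarrow> real \<Rightarrow> complex mat) \<Rightarrow> (real \<Rightarrow> real \<Rightarrow> complex mat) \<Rightarrow>
     'k::finite \<Rightarrow> 'k \<Rightarrow> 'k state \<Rightarrow> 'k state \<Rightarrow> real \<Rightarrow> real \<Rightarrow> nat \<Rightarrow> fourvec \<Rightarrow> complex" where
  "free_field m j u v s s' \<Phi> \<Psi> A B i x =
     complex_of_real ((2 * pi) powr (- 3 / 2)) *
     (\<Sum>\<sigma>\<le>twice j. LINT p|lborel.
        exp (\<i> * complex_of_real (mdot (on_shell m p) x)) *
          coeff_fun m A B u p $$ (i, \<sigma>) * annihilation_form j s \<sigma> p \<Phi> \<Psi>
        + exp (- \<i> * complex_of_real (mdot (on_shell m p) x)) * (- 1) ^ twice B *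
          coeff_fun m A B v p $$ (i, \<sigma>) * creation_form j s' \<sigma> p \<Phi> \<Psi>)"

end

theory Submission
  imports Defs "HOL-Probability.Sinc_Integral" "HOL-Probability.Characteristic_Functions"
begin

text \<open>The matrix \<open>Q = u\<^sup>A\<^sup>B(0) u\<^sup>C\<^sup>D(0)\<^sup>\<dagger>\<close> intertwines the restrictions of \<open>D\<^sup>A \<otimes> D\<^sup>B\<close> and
  \<open>D\<^sup>C \<otimes> D\<^sup>D\<close> to \<open>SU(2)\<close>, hence (the unitary trick) it intertwines these holomorphic
  representations also at the boosts \<open>L = L(p)\<close> and \<open>L\<^sup>-\<^sup>1\<close>. Moving \<open>L\<close> through \<open>Q\<close> turns the twisted
  spin sum into either
  \<open>(D\<^sup>A(L\<^sup>2) \<otimes> 1) Q (D\<^sup>C(L\<^sup>-\<^sup>2) \<otimes> 1)\<close> or \<open>(1 \<otimes> D\<^sup>B(L\<^sup>-\<^sup>2)) Q (1 \<otimes> D\<^sup>D(L\<^sup>2))\<close>. On the mass shell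
  \<open>L\<^sup>2 = X(p) / m\<close> and \<open>L\<^sup>-\<^sup>2 = X(-\<^bold>p, p\<^sup>0) / m\<close> are linear in \<open>p\<close>, so these are homogeneous
  polynomials of degree \<open>2 A + 2 C\<close> and \<open>2 B + 2 D\<close>; the one of smaller degree satisfies all the
  degree bounds, and homogeneity gives the parity.

  For the field identity, matrix elements of the annihilation and creation operators between states
  of the domain decrease rapidly in the momentum, so one may differentiate under the integral; on
  \<open>exp (\<plusminus> i p \<cdot> x)\<close> the operator \<open>P(-i \<partial>)\<close> acts as \<open>P(\<plusminus> p)\<close>, and
  \<open>\<Pi>(p) u\<^sup>C\<^sup>D(p) = u\<^sup>A\<^sup>B(p)\<close> because \<open>u\<^sup>C\<^sup>D(0)\<^sup>\<dagger> u\<^sup>C\<^sup>D(0) = 1\<close>. The signs agree as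
  \<open>2 A + 2 B + 2 C + 2 D\<close> is even.\<close>

section \<open>Matrices\<close>

text \<open>The obstacle is that \<open>AB_rep\<close> is not holomorphic in its argument, since its
  second factor contains the inverse adjoint, and that the coefficient matrices are known to
  intertwine only over \<open>SU2\<close>. There the inverse adjoint changes nothing, so the
  relation is one between holomorphic functions and can be continued. This is done along one curve
  at a time: for a unit vector n the matrices cosh + sinh (n sigma) have entries that are
  polynomials in z and 1/z, the unit circle lies in \<open>SU2\<close>, every boost occurs at some
  nonzero z, and a polynomial with infinitely many zeros vanishes. At a Hermitian boost the two
  representations differ by an inversion in the second factor; correcting it produces exactly the
  squares of boosts, which are linear in p while the boosts themselves are not.

  For the creation part of the field the polynomial is evaluated on the sheet of negative energy.
  The twisted spin sum says nothing there, and the parity condition is the link to the mass shell.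
  This is why the identity can be claimed for every polynomial with the stated properties.\<close>

definition mat22 :: "'a \<Rightarrow> 'a \<Rightarrow> 'a \<Rightarrow> 'a \<Rightarrow> 'a mat" where
  "mat22 a b c d = mat 2 2 (\<lambda>(i, k). if i = 0 then if k = 0 then a else b
                                      else if k = 0 then c else d)"

lemma mat22_carrier [simp]: "mat22 a b c d \<in> carrier_mat 2 2"
  by (simp add: mat22_def)

lemma mat22_dim [simp]: "dim_row (mat22 a b c d) = 2" "dim_col (mat22 a b c d) = 2"
  by (simp_all add: mat22_def)

lemma mat22_index [simp]:
  "mat22 a b c d $$ (0, 0) = a" "mat22 a b c d $$ (0, Suc 0) = b"
  "mat22 a b c d $$ (Suc 0, 0) = c" "mat22 a b c d $$ (Suc 0, Suc 0) = d"
  by (simp_all add: mat22_def)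

lemma mat_eq_22_iff:
  assumes "M \<in> carrier_mat 2 2" "N \<in> carrier_mat 2 2"
  shows "M = N \<longleftrightarrow> M $$ (0, 0) = N $$ (0, 0) \<and> M $$ (0, 1) = N $$ (0, 1) \<and>
     M $$ (1, 0) = N $$ (1, 0) \<and> M $$ (1, 1) = N $$ (1, 1)"
proof
  assume *: "M $$ (0, 0) = N $$ (0, 0) \<and> M $$ (0, 1) = N $$ (0, 1) \<and>
     M $$ (1, 0) = N $$ (1, 0) \<and> M $$ (1, 1) = N $$ (1, 1)"
  show "M = N"
  proof (rule eq_matI)
    fix i k assume "i < dim_row N" "k < dim_col N"
    then have "i = 0 \<or> i = 1" "k = 0 \<or> k = 1" using assms by auto
    then show "M $$ (i, k) = N $$ (i, k)" using * by auto
  qed (use assms in auto)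
qed auto

lemma mat22_eta: "M \<in> carrier_mat 2 2 \<Longrightarrow>
    mat22 (M $$ (0, 0)) (M $$ (0, 1)) (M $$ (1, 0)) (M $$ (1, 1)) = M"
  by (subst mat_eq_22_iff) auto

lemma mat22_cases:
  assumes "M \<in> carrier_mat 2 2"
  obtains a b c d where "M = mat22 a b c d"
  using mat22_eta[OF assms] by metis

lemma mat22_eq_iff [simp]: "mat22 a b c d = mat22 a' b' c' d' \<longleftrightarrow> a = a' \<and> b = b' \<and> c = c' \<and> d = d'"
  by (subst mat_eq_22_iff) auto

lemma mat22_mult: "mat22 a b c d * mat22 a' b' c' d' =
    (mat22 (a * a' + b * c') (a * b' + b * d') (c * a' + d * c') (c * b' + d * d') :: 'a :: comm_ring_1 mat)"
  by (subst mat_eq_22_iff) (auto simp: scalar_prod_def numeral_2_eq_2)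

lemma mat22_smult: "k \<cdot>\<^sub>m mat22 a b c d = mat22 (k * a) (k * b) (k * c) (k * d :: 'a :: comm_ring_1)"
  by (subst mat_eq_22_iff) auto

lemma mat22_add: "mat22 a b c d + mat22 a' b' c' d' =
    mat22 (a + a') (b + b') (c + c') (d + d' :: 'a :: comm_ring_1)"
  by (subst mat_eq_22_iff) auto

lemma mat22_minus: "mat22 a b c d - mat22 a' b' c' d' =
    mat22 (a - a') (b - b') (c - c') (d - d' :: 'a :: comm_ring_1)"
  by (subst mat_eq_22_iff) auto

lemma one_mat_22: "1\<^sub>m 2 = mat22 1 0 0 (1 :: 'a :: comm_ring_1)"
  by (subst mat_eq_22_iff) auto

lemma mat_of_rows_list_22: "mat_of_rows_list 2 [[a, b], [c, d]] = mat22 a b c d"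
  by (subst mat_eq_22_iff) (auto simp: mat_of_rows_list_def)

lemma det_mat22: "Determinant.det (mat22 a b c d) = a * d - b * (c :: 'a :: comm_ring_1)"
proof -
  define M where "M = mat22 a b c d"
  have M: "M \<in> carrier_mat 2 2" by (simp add: M_def)
  have "mat_delete M i 0 \<in> carrier_mat 1 1" for i
    using mat_delete_carrier[OF M, of i 0] by simp
  then have minor: "Determinant.det (mat_delete M i 0) = mat_delete M i 0 $$ (0, 0)" for i
    by (rule det_single)
  have entries: "mat_delete M 0 0 $$ (0, 0) = d" "mat_delete M 1 0 $$ (0, 0) = b"
    by (simp_all add: mat_delete_def M_def)
  have "Determinant.det M = (\<Sum>i<2. M $$ (i, 0) * cofactor M i 0)"
    by (rule laplace_expansion_column[OF M]) simp
  also have "\<dots> = M $$ (0, 0) * cofactor M 0 0 + M $$ (1, 0) * cofactor M 1 0"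
    unfolding numeral_2_eq_2 sum.lessThan_Suc by simp
  also have "\<dots> = a * d - b * c"
    unfolding cofactor_def minor entries by (simp add: M_def)
  finally show ?thesis unfolding M_def .
qed

section \<open>Adjoints and inverses\<close>

lemma mat_adjoint_carrier [simp]:
  "A \<in> carrier_mat r c \<Longrightarrow> mat_adjoint A \<in> carrier_mat c r"
  by (auto simp: mat_adjoint_def)

lemma mat_adjoint_dim [simp]: "dim_row (mat_adjoint A) = dim_col A" "dim_col (mat_adjoint A) = dim_row A"
  by (auto simp: mat_adjoint_def)

lemma mat_adjoint_index [simp]: "i < dim_col A \<Longrightarrow> k < dim_row A \<Longrightarrow>
    mat_adjoint A $$ (i, k) = conjugate (A $$ (k, i))"
  by (simp add: mat_adjoint_def mat_of_rows_def)

lemma mat_adjoint_22: "mat_adjoint (mat22 a b c d) = mat22 (cnj a) (cnj c) (cnj b) (cnj d)"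
  by (subst mat_eq_22_iff) auto

lemma mat_adjoint_mult:
  fixes A B :: "complex mat"
  assumes "A \<in> carrier_mat r n" "B \<in> carrier_mat n c"
  shows "mat_adjoint (A * B) = mat_adjoint B * mat_adjoint A"
  using assms by (intro eq_matI) (auto simp: scalar_prod_def mult.commute)

lemma mat_adjoint_adjoint [simp]: "mat_adjoint (mat_adjoint A) = (A :: complex mat)"
  by (intro eq_matI) auto

text \<open>\<open>inv_mat\<close> unwraps the option returned by \<open>mat_inverse\<close>. A
  right inverse of a square matrix is also a left inverse, so \<open>A\<close> is a unit and
  \<open>None\<close> is excluded; uniqueness of inverses does the rest.\<close>

lemma inv_mat_eqI:
  assumes A: "A \<in> carrier_mat n n" and B: "B \<in> carrier_mat n n" and AB: "A * B = 1\<^sub>m n"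
  shows "inv_mat A = B"
proof (cases "mat_inverse A")
  case None
  have "B * A = 1\<^sub>m n" by (rule mat_mult_left_right_inverse[OF A B AB])
  then have "A \<in> Units (ring_mat TYPE(complex) n ())"
    unfolding Units_def ring_mat_simps using A B AB by blast
  with mat_inverse(1)[OF A None, of "()"] show ?thesis by (rule notE)
next
  case (Some C)
  have C: "C * A = 1\<^sub>m n" "C \<in> carrier_mat n n"
    using mat_inverse(2)[OF A Some] by blast+
  have "C = C * (A * B)" unfolding AB by (rule right_mult_one_mat[OF C(2), symmetric])
  also have "\<dots> = (C * A) * B" by (rule assoc_mult_mat[OF C(2) A B, symmetric])
  also have "\<dots> = B" unfolding C(1) by (rule left_mult_one_mat[OF B])
  finally show ?thesis using Some by (simp add: inv_mat_def)
qed

section \<open>Kronecker products\<close>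

lemma kron_dim [simp]: "dim_row (kron M N) = dim_row M * dim_row N"
  "dim_col (kron M N) = dim_col M * dim_col N"
  by (auto simp: kron_def)

lemma kron_carrier [simp]: "M \<in> carrier_mat a b \<Longrightarrow> N \<in> carrier_mat c d \<Longrightarrow>
    kron M N \<in> carrier_mat (a * c) (b * d)"
  by (auto simp: kron_def)

text \<open>The range below \<open>a * b\<close> is cut into \<open>a\<close> consecutive blocks of
  length \<open>b\<close>. This is the index encoding of the tensor basis, and it makes the sum in a
  product of Kronecker products factor.\<close>

lemma sum_div_mod:
  "(\<Sum>k<a * b. f (k div b) (k mod b)) = (\<Sum>i<a. \<Sum>k<(b::nat). f i k :: 'a :: comm_monoid_add)"
proof -
  have "(\<Sum>k = m * b..<m * b + b. f (k div b) (k mod b)) = (\<Sum>k<b. f m k)" for m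
  proof (rule sum.reindex_bij_witness[where i = "\<lambda>k. m * b + k" and j = "\<lambda>k. k - m * b"])
    fix k assume "k \<in> {m * b..<m * b + b}"
    then obtain r where k: "k = m * b + r" "r < b" by (auto simp: le_iff_add)
    then show "m * b + (k - m * b) = k" "k - m * b \<in> {..<b}"
      "f m (k - m * b) = f (k div b) (k mod b)" by auto
  qed auto
  then show ?thesis
    unfolding sum.nat_group[of "\<lambda>k. f (k div b) (k mod b)" b a, symmetric] by simp
qed

lemma kron_index: "i < dim_row M * dim_row N \<Longrightarrow> k < dim_col M * dim_col N \<Longrightarrow>
    kron M N $$ (i, k) =
    M $$ (i div dim_row N, k div dim_col N) * N $$ (i mod dim_row N, k mod dim_col N)"
  by (simp add: kron_def)

lemma div_mod_less:
  assumes "(i::nat) < a * b" shows "i div b < a" "i mod b < b"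
proof -
  show "i div b < a" using assms by (simp add: less_mult_imp_div_less)
  have "b \<noteq> 0" using assms by (cases b) auto
  then show "i mod b < b" by simp
qed

lemma kron_mult:
  assumes "M \<in> carrier_mat a b" "M' \<in> carrier_mat b c" "N \<in> carrier_mat d e" "N' \<in> carrier_mat e f"
  shows "kron M N * kron M' N' = kron (M * M') (N * N')"
proof (rule eq_matI)
  fix i k assume "i < dim_row (kron (M * M') (N * N'))" "k < dim_col (kron (M * M') (N * N'))"
  then have i: "i < a * d" and k: "k < c * f" using assms by auto
  note ik = div_mod_less[OF i] div_mod_less[OF k]
  have "(kron M N * kron M' N') $$ (i, k) = (\<Sum>r<b * e. kron M N $$ (i, r) * kron M' N' $$ (r, k))"
    using assms i k by (simp add: scalar_prod_def atLeast0LessThan)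
  also have "\<dots> = (\<Sum>r<b * e. (M $$ (i div d, r div e) * N $$ (i mod d, r mod e)) *
      (M' $$ (r div e, k div f) * N' $$ (r mod e, k mod f)))"
    using assms i k by (intro sum.cong) (auto simp: kron_index)
  also have "\<dots> = (\<Sum>r<b. \<Sum>t<e. (M $$ (i div d, r) * N $$ (i mod d, t)) *
      (M' $$ (r, k div f) * N' $$ (t, k mod f)))"
    by (rule sum_div_mod)
  also have "\<dots> = (\<Sum>r<b. M $$ (i div d, r) * M' $$ (r, k div f)) *
      (\<Sum>t<e. N $$ (i mod d, t) * N' $$ (t, k mod f))"
    by (simp add: sum_product mult_ac)
  also have "\<dots> = kron (M * M') (N * N') $$ (i, k)"
    using assms i k ik by (simp add: kron_index scalar_prod_def atLeast0LessThan)
  finally show "(kron M N * kron M' N') $$ (i, k) = kron (M * M') (N * N') $$ (i, k)" .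
qed (use assms in auto)

lemma kron_one: "kron (1\<^sub>m a) (1\<^sub>m b) = 1\<^sub>m (a * b)"
proof (rule eq_matI)
  fix i k assume "i < dim_row (1\<^sub>m (a * b))" "k < dim_col (1\<^sub>m (a * b))"
  then have i: "i < a * b" and k: "k < a * b" by auto
  have "i = k \<longleftrightarrow> i div b = k div b \<and> i mod b = k mod b" by (metis div_mult_mod_eq)
  then show "kron (1\<^sub>m a) (1\<^sub>m b) $$ (i, k) = 1\<^sub>m (a * b) $$ (i, k)"
    using i k div_mod_less[OF i] div_mod_less[OF k] by (auto simp: kron_index)
qed auto

lemma kron_adjoint: "mat_adjoint (kron M N) = kron (mat_adjoint M) (mat_adjoint N)"
proof (rule eq_matI)
  fix i k assume "i < dim_row (kron (mat_adjoint M) (mat_adjoint N))"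
    "k < dim_col (kron (mat_adjoint M) (mat_adjoint N))"
  then have i: "i < dim_col M * dim_col N" and k: "k < dim_row M * dim_row N" by auto
  then show "mat_adjoint (kron M N) $$ (i, k) = kron (mat_adjoint M) (mat_adjoint N) $$ (i, k)"
    using div_mod_less[OF i] div_mod_less[OF k] by (simp add: kron_index)
qed auto

section \<open>The spin representations\<close>

text \<open>The substitution x -> p, y -> q in a binary form of degree \<open>n\<close> given in
  dehomogenised form. The degree is a separate argument because \<open>f\<close> may have smaller
  degree than the form it represents.\<close>

definition form_subst :: "nat \<Rightarrow> 'a :: comm_ring_1 poly \<Rightarrow> 'a poly \<Rightarrow> 'a poly \<Rightarrow> 'a poly" where
  "form_subst n f p q = (\<Sum>l\<le>n. Polynomial.smult (Polynomial.coeff f l) (p ^ (n - l) * q ^ l))"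

text \<open>Substitution respects multiplication by a linear form a x + b y. The degree bound kills
  the term \<open>l = Suc n\<close> of the first sum; the second sum is an index shift.\<close>

lemma form_subst_linear_mult:
  assumes "Polynomial.degree f \<le> n"
  shows "form_subst (Suc n) ([:a, b:] * f) p q = (Polynomial.smult a p + Polynomial.smult b q) * form_subst n f p q"
proof -
  have "form_subst (Suc n) ([:a, b:] * f) p q =
      (\<Sum>l\<le>Suc n. Polynomial.smult (a * Polynomial.coeff f l) (p ^ (Suc n - l) * q ^ l)) +
      (\<Sum>l\<le>Suc n. Polynomial.smult (Polynomial.coeff (pCons 0 (Polynomial.smult b f)) l) (p ^ (Suc n - l) * q ^ l))"
    by (simp add: form_subst_def sum.distrib[symmetric] smult_add_left del: sum.atMost_Suc)
  also have "(\<Sum>l\<le>Suc n. Polynomial.smult (a * Polynomial.coeff f l) (p ^ (Suc n - l) * q ^ l)) =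
      Polynomial.smult a p * form_subst n f p q"
    using assms by (auto simp: form_subst_def coeff_eq_0 sum_distrib_left Suc_diff_le mult_ac intro!: sum.cong)
  also have "(\<Sum>l\<le>Suc n. Polynomial.smult (Polynomial.coeff (pCons 0 (Polynomial.smult b f)) l) (p ^ (Suc n - l) * q ^ l)) =
      Polynomial.smult b q * form_subst n f p q"
    by (simp add: form_subst_def sum.atMost_Suc_shift sum_distrib_left mult_ac del: sum.atMost_Suc)
  finally show ?thesis by (simp add: distrib_right)
qed

lemma degree_linear_powers_le: "Polynomial.degree ([:a, b:] ^ r * [:c, d:] ^ t) \<le> r + t"
proof -
  have *: "Polynomial.degree ([:a, b:] ^ r) \<le> r" for a b :: 'a and r
    using degree_power_le[of "[:a, b:]" r] by (rule order_trans) (simp add: degree_pCons_le)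
  show ?thesis
    by (rule order_trans[OF degree_mult_le]) (intro add_mono *)
qed

lemma form_subst_linear_powers:
  "form_subst (r + t) ([:a, b:] ^ r * [:c, d:] ^ t) p q =
     (Polynomial.smult a p + Polynomial.smult b q) ^ r * (Polynomial.smult c p + Polynomial.smult d q) ^ t"
proof (induction r)
  case 0
  show ?case
  proof (induction t)
    case 0
    then show ?case by (simp add: form_subst_def)
  next
    case (Suc t)
    then show ?case
      using form_subst_linear_mult[OF degree_linear_powers_le[of 0 0 0 c d t], of c d p q] by simp
  qed
next
  case (Suc r)
  then show ?case
    using form_subst_linear_mult[OF degree_linear_powers_le[of a b r c d t], of a b p q]
    by (simp only: add_Suc power_Suc mult.assoc)
qed

text \<open>The matrix of the spin representation in the monomial basis, before the square roots of
  binomials that make the basis orthonormal.\<close>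

definition form_coeff :: "nat \<Rightarrow> 'a :: comm_ring_1 mat \<Rightarrow> nat \<Rightarrow> nat \<Rightarrow> 'a" where
  "form_coeff n M l k = Polynomial.coeff ([: M $$ (0, 0), M $$ (1, 0) :] ^ (n - k) *
                         [: M $$ (0, 1), M $$ (1, 1) :] ^ k) l"

lemma spin_rep_carrier [simp]: "spin_rep s M \<in> carrier_mat (Suc (twice s)) (Suc (twice s))"
  by (simp add: spin_rep_def Let_def)

lemma spin_rep_dim [simp]: "dim_row (spin_rep s M) = Suc (twice s)" "dim_col (spin_rep s M) = Suc (twice s)"
  by (simp_all add: spin_rep_def Let_def)

lemma spin_rep_index:
  assumes "l \<le> twice s" "k \<le> twice s"
  shows "spin_rep s M $$ (l, k) =
    complex_of_real (sqrt (real (twice s choose k) / real (twice s choose l))) * form_coeff (twice s) M l k"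
  using assms by (simp add: spin_rep_def Let_def form_coeff_def)

text \<open>Composition of linear substitutions: column \<open>k\<close> of \<open>N\<close>
  represents a product of linear forms, and substituting the columns of \<open>M\<close> for the
  variables turns it into column \<open>k\<close> of \<open>M * N\<close>.\<close>

lemma form_coeff_mult:
  assumes M: "M \<in> carrier_mat 2 2" and N: "N \<in> carrier_mat 2 2" and k: "k \<le> n"
  shows "form_coeff n (M * N) l k = (\<Sum>i\<le>n. form_coeff n M l i * form_coeff n N i k)"
proof -
  obtain a b c d where Me: "M = mat22 a b c d" using M by (rule mat22_cases)
  obtain a' b' c' d' where Ne: "N = mat22 a' b' c' d'" using N by (rule mat22_cases)
  have "form_subst n ([:a', c':] ^ (n - k) * [:b', d':] ^ k) [:a, c:] [:b, d:] =
     (Polynomial.smult a' [:a, c:] + Polynomial.smult c' [:b, d:]) ^ (n - k) * (Polynomial.smult b' [:a, c:] + Polynomial.smult d' [:b, d:]) ^ k"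
    using form_subst_linear_powers[of "n - k" k a' c' b' d' "[:a, c:]" "[:b, d:]"] k by simp
  then have "form_coeff n (M * N) l k =
      Polynomial.coeff (form_subst n ([:a', c':] ^ (n - k) * [:b', d':] ^ k) [:a, c:] [:b, d:]) l"
    by (simp add: form_coeff_def Me Ne mat22_mult mult_ac)
  also have "\<dots> = (\<Sum>i\<le>n. form_coeff n M l i * form_coeff n N i k)"
    by (simp add: form_subst_def form_coeff_def coeff_sum Me Ne mult_ac)
  finally show ?thesis .
qed

text \<open>The square roots conjugate the monomial matrices by a diagonal matrix, so those of the
  intermediate index cancel.\<close>

lemma spin_rep_mult:
  assumes M: "M \<in> carrier_mat 2 2" and N: "N \<in> carrier_mat 2 2"
  shows "spin_rep s (M * N) = spin_rep s M * spin_rep s N"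
proof (rule eq_matI)
  fix l k assume "l < dim_row (spin_rep s M * spin_rep s N)" "k < dim_col (spin_rep s M * spin_rep s N)"
  then have l: "l \<le> twice s" and k: "k \<le> twice s" by auto
  let ?n = "twice s" and ?b = "\<lambda>k. real (twice s choose k)"
  have "(spin_rep s M * spin_rep s N) $$ (l, k) =
      (\<Sum>i\<le>?n. spin_rep s M $$ (l, i) * spin_rep s N $$ (i, k))"
    using l k by (simp add: scalar_prod_def atLeast0LessThan lessThan_Suc_atMost)
  also have "\<dots> = (\<Sum>i\<le>?n. complex_of_real (sqrt (?b k / ?b l)) *
      (form_coeff ?n M l i * form_coeff ?n N i k))"
  proof (rule sum.cong)
    fix i assume "i \<in> {..?n}"
    then have "?b i > 0" by simp
    then have "sqrt (?b i / ?b l) * sqrt (?b k / ?b i) = sqrt (?b k / ?b l)"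
      by (simp add: real_sqrt_mult[symmetric])
    then have "complex_of_real (sqrt (?b i / ?b l)) * complex_of_real (sqrt (?b k / ?b i)) =
        complex_of_real (sqrt (?b k / ?b l))"
      by (metis of_real_mult)
    then show "spin_rep s M $$ (l, i) * spin_rep s N $$ (i, k) =
       complex_of_real (sqrt (?b k / ?b l)) * (form_coeff ?n M l i * form_coeff ?n N i k)"
      using \<open>i \<in> _\<close> l k by (simp add: spin_rep_index mult_ac)
  qed simp
  also have "\<dots> = spin_rep s (M * N) $$ (l, k)"
    using l k M N by (simp add: spin_rep_index form_coeff_mult sum_distrib_left)
  finally show "spin_rep s (M * N) $$ (l, k) = (spin_rep s M * spin_rep s N) $$ (l, k)" by simp
qed auto

lemma spin_rep_one [simp]: "spin_rep s (1\<^sub>m 2) = 1\<^sub>m (Suc (twice s))"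
proof (rule eq_matI)
  fix l k assume "l < dim_row (1\<^sub>m (Suc (twice s)))" "k < dim_col (1\<^sub>m (Suc (twice s)))"
  then have l: "l \<le> twice s" and k: "k \<le> twice s" by auto
  have linear: "[:0, 1:] ^ k = Polynomial.monom (1::complex) k" "[:1::complex, 0:] = 1"
    by (simp_all add: monom_altdef one_pCons)
  have "form_coeff (twice s) (1\<^sub>m 2) l k =
      Polynomial.coeff ([:1::complex, 0:] ^ (twice s - k) * [:0, 1:] ^ k) l"
    by (simp add: form_coeff_def)
  then have "form_coeff (twice s) (1\<^sub>m 2) l k = (if k = l then 1 else 0 :: complex)"
    unfolding linear by simp
  then show "spin_rep s (1\<^sub>m 2) $$ (l, k) = 1\<^sub>m (Suc (twice s)) $$ (l, k)"
    using l k by (cases "l = k") (simp_all add: spin_rep_index)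
qed auto

text \<open>Both sides are coefficients of \<open>((M\<^sub>0\<^sub>0 + t M\<^sub>0\<^sub>1) + (M\<^sub>1\<^sub>0 + t M\<^sub>1\<^sub>1) y)\<^sup>n\<close> at
  \<open>t\<^sup>k y\<^sup>l\<close>.\<close>

lemma form_coeff_transpose:
  fixes a b c d :: complex
  assumes k: "k \<le> n" and l: "l \<le> n"
  shows "of_nat (n choose k) * form_coeff n (mat22 a b c d) l k =
    of_nat (n choose l) * form_coeff n (mat22 a c b d) k l"
proof -
  define f where "f = (\<Sum>k\<le>n. Polynomial.monom (of_nat (n choose k) * form_coeff n (mat22 a b c d) l k) k)"
  define g where "g = Polynomial.smult (of_nat (n choose l)) ([:a, b:] ^ (n - l) * [:c, d:] ^ l)"
  have "poly f t = poly g t" for t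
  proof -
    have "poly f t = Polynomial.coeff (\<Sum>k\<le>n. Polynomial.smult (of_nat (n choose k) * t ^ k) ([:a, c:] ^ (n - k) * [:b, d:] ^ k)) l"
      by (simp add: f_def poly_sum poly_monom form_coeff_def coeff_sum mult_ac)
    also have "(\<Sum>k\<le>n. Polynomial.smult (of_nat (n choose k) * t ^ k) ([:a, c:] ^ (n - k) * [:b, d:] ^ k)) =
       (Polynomial.smult t [:b, d:] + [:a, c:]) ^ n"
    proof -
      have "of_nat i * Polynomial.smult t X ^ k * Y = Polynomial.smult (of_nat i * t ^ k) (Y * X ^ k)"
        for i k :: nat and X Y
        by (simp add: smult_power of_nat_poly mult_ac)
      then show ?thesis unfolding binomial_ring by (simp del: smult_pCons)
    qed
    also have "Polynomial.coeff ((Polynomial.smult t [:b, d:] + [:a, c:]) ^ n) l = poly g t"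
      using coeff_linear_poly_power[OF l, of "a + t * b" "c + t * d"]
      by (simp add: g_def poly_power mult_ac add_ac)
    finally show ?thesis .
  qed
  then have "f = g" by (simp add: poly_eq_poly_eq_iff[symmetric] fun_eq_iff)
  then have "Polynomial.coeff f k = Polynomial.coeff g k" by simp
  moreover have "Polynomial.coeff f k = of_nat (n choose k) * form_coeff n (mat22 a b c d) l k"
    using k by (simp add: f_def coeff_sum)
  ultimately show ?thesis by (simp add: g_def form_coeff_def)
qed

lemma coeff_mult_cnj:
  "Polynomial.coeff ([:cnj a, cnj b:] ^ r * [:cnj c, cnj d:] ^ t) l =
   cnj (Polynomial.coeff ([:a, b:] ^ r * [:c, d:] ^ t) l)"
proof -
  have *: "Polynomial.coeff ([:cnj a, cnj b:] ^ r) i = cnj (Polynomial.coeff ([:a, b:] ^ r) i)" for a b r i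
  proof (induction r arbitrary: i)
    case 0
    show ?case by (cases i) simp_all
  next
    case (Suc r)
    then show ?case by (cases i) (simp_all add: mult_pCons_left)
  qed
  show ?thesis by (simp add: coeff_mult *)
qed

text \<open>This is the purpose of the binomial normalisation: transposing the monomial matrix
  multiplies its entries by a ratio of binomials, and the square roots split this ratio evenly
  between the two indices. It makes the representation unitary on \<open>SU2\<close>.\<close>

lemma spin_rep_adjoint:
  assumes M: "M \<in> carrier_mat 2 2"
  shows "spin_rep s (mat_adjoint M) = mat_adjoint (spin_rep s M)"
proof (rule eq_matI)
  fix l k assume "l < dim_row (mat_adjoint (spin_rep s M))" "k < dim_col (mat_adjoint (spin_rep s M))"
  then have l: "l \<le> twice s" and k: "k \<le> twice s" by auto
  obtain a b c d where Me: "M = mat22 a b c d" using M by (rule mat22_cases)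
  let ?n = "twice s"
  let ?k = "real (?n choose k)" and ?l = "real (?n choose l)"
  have pos: "?k > 0" "?l > 0" using k l by auto
  have cnj: "form_coeff ?n (mat22 (cnj a) (cnj c) (cnj b) (cnj d)) l k = cnj (form_coeff ?n (mat22 a c b d) l k)"
    by (simp add: form_coeff_def coeff_mult_cnj)
  have "of_nat (?n choose k) * form_coeff ?n (mat22 a c b d) l k =
      of_nat (?n choose l) * form_coeff ?n (mat22 a b c d) k l"
    by (rule form_coeff_transpose[OF k l])
  then have 1: "form_coeff ?n (mat22 a c b d) l k =
      complex_of_real (?l / ?k) * form_coeff ?n (mat22 a b c d) k l"
    using pos by (simp add: field_simps)
  have "sqrt (?k / ?l) * (?l / ?k) = sqrt (?l / ?k)"
    using pos by (simp add: real_sqrt_divide field_simps)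
  then have 2: "complex_of_real (sqrt (?k / ?l)) * complex_of_real (?l / ?k) = complex_of_real (sqrt (?l / ?k))"
    by (metis of_real_mult)
  have "complex_of_real (sqrt (?k / ?l)) * cnj (form_coeff ?n (mat22 a c b d) l k) =
     complex_of_real (sqrt (?l / ?k)) * cnj (form_coeff ?n (mat22 a b c d) k l)"
    unfolding 1 2[symmetric] by (simp add: mult_ac)
  then show "spin_rep s (mat_adjoint M) $$ (l, k) = mat_adjoint (spin_rep s M) $$ (l, k)"
    using l k by (simp add: Me mat_adjoint_22 spin_rep_index cnj)
qed auto

section \<open>Families of functions closed under matrix operations\<close>

text \<open>Entries of spin representations, Kronecker products and matrix products arise from the
  entries of the arguments by constants, sums and products. The closure argument is made once and
  used for Laurent polynomials in z, homogeneous polynomials in p and functions of moderate growth;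
  the grading carries information only for the homogeneous polynomials.\<close>

locale graded_functions =
  fixes H :: "nat \<Rightarrow> ('a \<Rightarrow> complex) set"
  assumes const: "(\<lambda>_. c) \<in> H 0"
    and zero: "(\<lambda>_. 0) \<in> H d"
    and add: "f \<in> H d \<Longrightarrow> g \<in> H d \<Longrightarrow> (\<lambda>x. f x + g x) \<in> H d"
    and mult: "f \<in> H d \<Longrightarrow> g \<in> H e \<Longrightarrow> (\<lambda>x. f x * g x) \<in> H (d + e)"
begin

lemma cmult: "f \<in> H d \<Longrightarrow> (\<lambda>x. c * f x) \<in> H d"
  using mult[OF const[of c], of f d] by simp

lemma sum: "(\<And>i. i \<in> I \<Longrightarrow> f i \<in> H d) \<Longrightarrow> (\<lambda>x. \<Sum>i\<in>I. f i x) \<in> H d"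
  by (induction I rule: infinite_finite_induct) (auto intro: zero add)

definition poly_family :: "nat \<Rightarrow> ('a \<Rightarrow> complex poly) \<Rightarrow> bool" where
  "poly_family d q \<longleftrightarrow> (\<forall>l. (\<lambda>x. Polynomial.coeff (q x) l) \<in> H d)"

lemma poly_family_mult: "poly_family d q \<Longrightarrow> poly_family e r \<Longrightarrow> poly_family (d + e) (\<lambda>x. q x * r x)"
  unfolding poly_family_def coeff_mult by (intro allI sum mult) auto

lemma poly_family_linear_power:
  assumes "f \<in> H d" "g \<in> H d"
  shows "poly_family (n * d) (\<lambda>x. [:f x, g x:] ^ n)"
proof (induction n)
  case 0
  show ?case
  proof (unfold poly_family_def, intro allI)
    fix l show "(\<lambda>x. Polynomial.coeff ([:f x, g x:] ^ 0) l) \<in> H (0 * d)"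
      by (cases l) (simp_all add: const)
  qed
next
  case (Suc n)
  have "poly_family d (\<lambda>x. [:f x, g x:])"
    unfolding poly_family_def
  proof
    fix l
    consider "l = 0" | "l = 1" | r where "l = Suc (Suc r)" by (metis One_nat_def not0_implies_Suc)
    then show "(\<lambda>x. Polynomial.coeff [:f x, g x:] l) \<in> H d" by cases (simp_all add: zero assms)
  qed
  from poly_family_mult[OF this Suc] show ?case by simp
qed

definition mat_family :: "nat \<Rightarrow> nat \<Rightarrow> nat \<Rightarrow> ('a \<Rightarrow> complex mat) \<Rightarrow> bool" where
  "mat_family nr nc d M \<longleftrightarrow> (\<forall>x. M x \<in> carrier_mat nr nc) \<and>
     (\<forall>i<nr. \<forall>k<nc. (\<lambda>x. M x $$ (i, k)) \<in> H d)"

lemma mat_family_carrier: "mat_family nr nc d M \<Longrightarrow> M x \<in> carrier_mat nr nc"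
  by (simp add: mat_family_def)

lemma mat_family_const: "M \<in> carrier_mat nr nc \<Longrightarrow> mat_family nr nc 0 (\<lambda>_. M)"
  by (simp add: mat_family_def const)

lemma mat_family_22:
  assumes "a \<in> H e" "b \<in> H e" "c \<in> H e" "d \<in> H e"
  shows "mat_family 2 2 e (\<lambda>x. mat22 (a x) (b x) (c x) (d x))"
proof (unfold mat_family_def, intro conjI allI impI)
  fix i k :: nat assume "i < 2" "k < 2"
  then have "i = 0 \<or> i = Suc 0" "k = 0 \<or> k = Suc 0" by auto
  then show "(\<lambda>x. mat22 (a x) (b x) (c x) (d x) $$ (i, k)) \<in> H e"
    using assms by auto
qed simp

lemma mat_family_mult:
  assumes M: "mat_family nr n d M" and N: "mat_family n nc e N"
  shows "mat_family nr nc (d + e) (\<lambda>x. M x * N x)"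
proof (unfold mat_family_def, intro conjI allI impI)
  have dims: "M x \<in> carrier_mat nr n" "N x \<in> carrier_mat n nc" for x
    using M N by (auto simp: mat_family_def)
  show "M x * N x \<in> carrier_mat nr nc" for x
    by (rule mult_carrier_mat[OF dims])
  fix i k assume ik: "i < nr" "k < nc"
  have "(\<lambda>x. (M x * N x) $$ (i, k)) = (\<lambda>x. \<Sum>r<n. M x $$ (i, r) * N x $$ (r, k))"
  proof
    fix x show "(M x * N x) $$ (i, k) = (\<Sum>r<n. M x $$ (i, r) * N x $$ (r, k))"
      using dims[of x] ik by (auto simp: scalar_prod_def atLeast0LessThan)
  qed
  also have "\<dots> \<in> H (d + e)"
    using M N ik by (intro sum mult) (auto simp: mat_family_def)
  finally show "(\<lambda>x. (M x * N x) $$ (i, k)) \<in> H (d + e)" .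
qed

lemma mat_family_kron:
  assumes M: "mat_family a b d M" and N: "mat_family a' b' e N"
  shows "mat_family (a * a') (b * b') (d + e) (\<lambda>x. kron (M x) (N x))"
proof (unfold mat_family_def, intro conjI allI impI)
  have dims: "M x \<in> carrier_mat a b" "N x \<in> carrier_mat a' b'" for x
    using M N by (auto simp: mat_family_def)
  show "kron (M x) (N x) \<in> carrier_mat (a * a') (b * b')" for x
    by (rule kron_carrier[OF dims])
  fix i k assume i: "i < a * a'" and k: "k < b * b'"
  have "(\<lambda>x. kron (M x) (N x) $$ (i, k)) =
      (\<lambda>x. M x $$ (i div a', k div b') * N x $$ (i mod a', k mod b'))"
  proof
    fix x show "kron (M x) (N x) $$ (i, k) = M x $$ (i div a', k div b') * N x $$ (i mod a', k mod b')"
      using dims[of x] i k by (auto simp: kron_index)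
  qed
  also have "\<dots> \<in> H (d + e)"
    using M N div_mod_less[OF i] div_mod_less[OF k] by (intro mult) (auto simp: mat_family_def)
  finally show "(\<lambda>x. kron (M x) (N x) $$ (i, k)) \<in> H (d + e)" .
qed

text \<open>Each entry is, up to a constant, a coefficient of a product of \<open>twice s\<close>
  linear polynomials whose coefficients have degree \<open>d\<close>.\<close>

lemma mat_family_spin_rep:
  assumes M: "mat_family 2 2 d M"
  shows "mat_family (Suc (twice s)) (Suc (twice s)) (twice s * d) (\<lambda>x. spin_rep s (M x))"
proof (unfold mat_family_def, intro conjI allI impI)
  let ?n = "twice s"
  fix l k assume "l < Suc ?n" "k < Suc ?n"
  then have l: "l \<le> ?n" and k: "k \<le> ?n" by auto
  have "poly_family ((?n - k) * d + k * d)
    (\<lambda>x. [:M x $$ (0, 0), M x $$ (1, 0):] ^ (?n - k) * [:M x $$ (0, 1), M x $$ (1, 1):] ^ k)"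
    using M by (intro poly_family_mult poly_family_linear_power) (auto simp: mat_family_def)
  then have "(\<lambda>x. form_coeff ?n (M x) l k) \<in> H (?n * d)"
    using k by (simp add: poly_family_def form_coeff_def add_mult_distrib[symmetric])
  from cmult[OF this, of "complex_of_real (sqrt (real (?n choose k) / real (?n choose l)))"]
  show "(\<lambda>x. spin_rep s (M x) $$ (l, k)) \<in> H (?n * d)"
    by (simp add: spin_rep_index[OF l k])
qed simp

end

section \<open>Extending intertwiners\<close>

text \<open>Laurent polynomials as functions, tested by clearing denominators. The value at 0 is
  left free, since \<open>inverse 0 = 0\<close> carries no meaning here.\<close>

definition laurent :: "(complex \<Rightarrow> complex) set" where
  "laurent = {f. \<exists>N q. \<forall>z. z \<noteq> 0 \<longrightarrow> z ^ N * f z = poly q z}"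

lemma laurentI: "(\<And>z. z \<noteq> 0 \<Longrightarrow> z ^ N * f z = poly q z) \<Longrightarrow> f \<in> laurent"
  unfolding laurent_def by blast

interpretation laurent: graded_functions "\<lambda>_. laurent"
proof
  show "(\<lambda>_. c) \<in> laurent" for c
    by (rule laurentI[of 0 _ "[:c:]"]) simp
  then show "(\<lambda>_. 0) \<in> laurent" .
  fix f g assume "f \<in> laurent" "g \<in> laurent"
  then obtain N q N' q' where *: "z \<noteq> 0 \<Longrightarrow> z ^ N * f z = poly q z"
    "z \<noteq> 0 \<Longrightarrow> z ^ N' * g z = poly q' z" for z
    unfolding laurent_def by blast
  show "(\<lambda>z. f z * g z) \<in> laurent"
  proof (rule laurentI[of "N + N'" _ "q * q'"])
    fix z :: complex assume "z \<noteq> 0"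
    from *[OF this, symmetric] show "z ^ (N + N') * (f z * g z) = poly (q * q') z"
      by (simp add: power_add mult_ac)
  qed
  show "(\<lambda>z. f z + g z) \<in> laurent"
  proof (rule laurentI[of "N + N'" _ "Polynomial.monom 1 N' * q + Polynomial.monom 1 N * q'"])
    fix z :: complex assume "z \<noteq> 0"
    from *[OF this, symmetric]
    show "z ^ (N + N') * (f z + g z) = poly (Polynomial.monom 1 N' * q + Polynomial.monom 1 N * q') z"
      by (simp add: poly_monom power_add algebra_simps)
  qed
qed

lemma infinite_unit_circle: "infinite {z::complex. norm z = 1}"
proof
  assume "finite {z::complex. norm z = 1}"
  moreover have "{0..1} \<subseteq> Re ` {z. norm z = 1}"
  proof
    fix x :: real assume "x \<in> {0..1}"
    then have "norm (Complex x (sqrt (1 - x\<^sup>2))) = 1"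
      by (simp add: cmod_def abs_square_le_1)
    then show "x \<in> Re ` {z. norm z = 1}" by (intro image_eqI[of _ _ "Complex x (sqrt (1 - x\<^sup>2))"]) auto
  qed
  ultimately have "finite {0..1::real}" by (meson finite_imageI finite_subset)
  then show False by (simp add: infinite_Icc)
qed

text \<open>After clearing denominators a polynomial vanishes on the infinite unit circle, hence is
  zero; this replaces the identity theorem for holomorphic functions.\<close>

lemma laurent_eq_0:
  assumes "f \<in> laurent" and "\<And>z. norm z = 1 \<Longrightarrow> f z = 0" and "z \<noteq> 0"
  shows "f z = 0"
proof -
  obtain N q where *: "z \<noteq> 0 \<Longrightarrow> z ^ N * f z = poly q z" for z
    using assms(1) unfolding laurent_def by blast
  have "{z. norm z = 1} \<subseteq> {z. poly q z = 0}"
    using * assms(2) by (metis (mono_tags, lifting) mem_Collect_eq mult_zero_right norm_zero subsetI zero_neq_one)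
  then have "infinite {z. poly q z = 0}"
    using infinite_unit_circle finite_subset by blast
  then have "q = 0" using poly_roots_finite by blast
  then show ?thesis using *[OF assms(3)] assms(3) by simp
qed

text \<open>The matrix \<open>cosh \<tau> + sinh \<tau> (n \<cdot> \<sigma>)\<close> with \<open>z = exp \<tau>\<close>: unitary for \<open>norm z = 1\<close>, a boost for
  real \<open>z > 0\<close>.\<close>

definition axis_mat :: "real \<Rightarrow> real \<Rightarrow> real \<Rightarrow> complex \<Rightarrow> complex mat" where
  "axis_mat n1 n2 n3 z = (let c = (z + inverse z) / 2; s = (z - inverse z) / 2 in
     mat22 (c + s * of_real n3) (s * Complex n1 (- n2)) (s * Complex n1 n2) (c - s * of_real n3))"

lemma laurent_id: "(\<lambda>z. z) \<in> laurent"
  by (rule laurentI[of 0 _ "[:0, 1:]"]) simp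

lemma laurent_inverse: "inverse \<in> laurent"
  by (rule laurentI[of 1 _ "1"]) simp

lemma laurent_axis_mat: "laurent.mat_family 2 2 1 (axis_mat n1 n2 n3)"
proof -
  have c: "(\<lambda>z. (z + inverse z) / 2) \<in> laurent"
    using laurent.cmult[OF laurent.add[OF laurent_id laurent_inverse], of "1 / 2"] by simp
  have s: "(\<lambda>z. (z - inverse z) / 2) \<in> laurent"
    using laurent.cmult[OF laurent.add[OF laurent_id laurent.cmult[OF laurent_inverse, of "-1"]], of "1 / 2"]
    by simp
  have k: "(\<lambda>z. (z - inverse z) / 2 * k) \<in> laurent" for k
    using laurent.cmult[OF s, of k] by (simp add: mult.commute)
  have "(\<lambda>z. (z + inverse z) / 2 - (z - inverse z) / 2 * of_real n3) \<in> laurent"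
    using laurent.add[OF c k[of "- of_real n3"]] by simp
  with laurent.add[OF c k] k show ?thesis
    unfolding axis_mat_def Let_def by (intro laurent.mat_family_22)
qed

lemma axis_mat_SU2:
  assumes n: "n1\<^sup>2 + n2\<^sup>2 + n3\<^sup>2 = 1" and z: "norm z = 1"
  shows "axis_mat n1 n2 n3 z \<in> SU2"
proof -
  define c where "c = (z + inverse z) / 2"
  define s where "s = (z - inverse z) / 2"
  \<comment> \<open>On the unit circle \<open>c\<close> is a cosine and \<open>s\<close> is i times
    a sine, so conjugation fixes \<open>c\<close> and negates \<open>s\<close>.\<close>
  have inv: "inverse z = cnj z"
    using complex_norm_square[of z] z by (intro inverse_unique) simp
  have cnj: "cnj c = c" "cnj s = - s"
    by (simp_all add: c_def s_def inv complex_eq_iff)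
  have "z \<noteq> 0" using z by auto
  then have cs: "c\<^sup>2 - s\<^sup>2 = 1"
    by (simp add: c_def s_def power2_eq_square field_simps)
  have nn: "(of_real n3)\<^sup>2 + Complex n1 n2 * Complex n1 (- n2) = 1"
  proof -
    have "Complex n1 n2 * Complex n1 (- n2) = of_real (n1\<^sup>2 + n2\<^sup>2)"
      by (simp add: complex_eq_iff power2_eq_square)
    then show ?thesis using n by (simp add: of_real_power[symmetric] of_real_add[symmetric] add_ac del: of_real_power of_real_add)
  qed
  define w where "w = Complex n1 n2"
  define w' where "w' = Complex n1 (- n2)"
  define t where "t = complex_of_real n3"
  have ww: "cnj w = w'" "cnj w' = w" "cnj t = t" by (auto simp: w_def w'_def t_def complex_eq_iff)
  have nn': "t\<^sup>2 + w * w' = 1" using nn by (simp add: w_def w'_def t_def)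
  have e: "axis_mat n1 n2 n3 z = mat22 (c + s * t) (s * w') (s * w) (c - s * t)"
    by (simp add: axis_mat_def Let_def c_def s_def w_def w'_def t_def)
  have unitary: "(c - s * t) * (c + s * t) - s * w * (s * w') = 1"
  proof -
    have "(c - s * t) * (c + s * t) - s * w * (s * w') = c\<^sup>2 - s\<^sup>2 * (t\<^sup>2 + w * w')"
      by (simp add: algebra_simps power2_eq_square)
    then show ?thesis using nn' cs by simp
  qed
  then show ?thesis
    unfolding SU2_def SL2C_def e
    by (auto simp: det_mat22 mat_adjoint_22 mat22_mult one_mat_22 cnj ww unitary[simplified algebra_simps] algebra_simps)
qed

lemma inv_mat_adjoint_SU2: "W \<in> SU2 \<Longrightarrow> inv_mat (mat_adjoint W) = W"
  by (rule inv_mat_eqI[of _ 2]) (auto simp: SU2_def SL2C_def)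

lemma AB_rep_SU2: "W \<in> SU2 \<Longrightarrow> AB_rep A B W = kron (spin_rep A W) (spin_rep B W)"
  by (simp add: AB_rep_def inv_mat_adjoint_SU2)

lemma AB_rep_carrier [simp]: "AB_rep A B M \<in> carrier_mat (AB_dim A B) (AB_dim A B)"
  unfolding AB_rep_def AB_dim_def Suc_eq_plus1[symmetric]
  by (intro kron_carrier spin_rep_carrier)

text \<open>Both tensor factors take the same argument \<open>M z\<close>, so the entries of either
  side are Laurent polynomials in \<open>z\<close>. On the unit circle \<open>M z\<close> lies in
  \<open>SU2\<close> and the claim is the hypothesis \<open>int\<close>; the difference of the two
  sides therefore vanishes for every nonzero \<open>z\<close>.\<close>

lemma intertwiner_axis_mat:
  assumes Q: "Q \<in> carrier_mat (AB_dim A B) (AB_dim C D)"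
    and int: "\<And>W. W \<in> SU2 \<Longrightarrow> AB_rep A B W * Q = Q * AB_rep C D W"
    and n: "n1\<^sup>2 + n2\<^sup>2 + n3\<^sup>2 = 1" and z: "z \<noteq> 0"
  defines "M \<equiv> axis_mat n1 n2 n3"
  shows "kron (spin_rep A (M z)) (spin_rep B (M z)) * Q =
         Q * kron (spin_rep C (M z)) (spin_rep D (M z))"
proof -
  define K where "K A B z = kron (spin_rep A (M z)) (spin_rep B (M z))" for A B z
  have M: "laurent.mat_family 2 2 1 M" unfolding M_def by (rule laurent_axis_mat)
  have K: "laurent.mat_family (AB_dim A B) (AB_dim A B) 0 (K A B)" for A B
    using laurent.mat_family_kron[OF laurent.mat_family_spin_rep[OF M] laurent.mat_family_spin_rep[OF M], of A B]
    by (simp add: laurent.mat_family_def K_def AB_dim_def)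
  have "laurent.mat_family (AB_dim A B) (AB_dim C D) 0 (\<lambda>z. K A B z * Q)"
    using laurent.mat_family_mult[OF K laurent.mat_family_const[OF Q]] by simp
  moreover have "laurent.mat_family (AB_dim A B) (AB_dim C D) 0 (\<lambda>z. Q * K C D z)"
    using laurent.mat_family_mult[OF laurent.mat_family_const[OF Q] K] by simp
  ultimately have lr: "K A B z * Q \<in> carrier_mat (AB_dim A B) (AB_dim C D)"
      "Q * K C D z \<in> carrier_mat (AB_dim A B) (AB_dim C D)"
      "i < AB_dim A B \<Longrightarrow> k < AB_dim C D \<Longrightarrow> (\<lambda>z. (K A B z * Q) $$ (i, k)) \<in> laurent"
      "i < AB_dim A B \<Longrightarrow> k < AB_dim C D \<Longrightarrow> (\<lambda>z. (Q * K C D z) $$ (i, k)) \<in> laurent" for z i k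
    by (simp_all add: laurent.mat_family_def)
  have circle: "K A B z * Q = Q * K C D z" if "norm z = 1" for z
    using int[OF axis_mat_SU2[OF n that]] by (simp add: K_def M_def AB_rep_SU2[OF axis_mat_SU2[OF n that]])
  have "K A B z * Q = Q * K C D z"
  proof (rule eq_matI)
    fix i k assume "i < dim_row (Q * K C D z)" "k < dim_col (Q * K C D z)"
    then have ik: "i < AB_dim A B" "k < AB_dim C D" using lr(2)[of z] by auto
    have "(\<lambda>z. (K A B z * Q) $$ (i, k) + (-1) * (Q * K C D z) $$ (i, k)) \<in> laurent"
      by (intro laurent.add laurent.cmult lr(3)[OF ik] lr(4)[OF ik])
    from laurent_eq_0[OF this _ z] circle
    show "(K A B z * Q) $$ (i, k) = (Q * K C D z) $$ (i, k)" by simp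
  qed (use carrier_matD[OF lr(1)[of z]] carrier_matD[OF lr(2)[of z]] in simp_all)
  then show ?thesis by (simp add: K_def)
qed

section \<open>The standard boost\<close>

lemma Xmat_mat22: "Xmat p = mat22 (of_real (snd p - vec_nth (fst p) 3))
    (- Complex (vec_nth (fst p) 1) (- vec_nth (fst p) 2))
    (- Complex (vec_nth (fst p) 1) (vec_nth (fst p) 2))
    (of_real (snd p + vec_nth (fst p) 3))"
  by (simp add: Xmat_def pauli_def mat_of_rows_list_22 one_mat_22 mat22_smult mat22_add mat22_minus
    complex_eq_iff)

lemma Xmat_carrier [simp]: "Xmat p \<in> carrier_mat 2 2"
  by (simp add: Xmat_mat22)

lemma inj_Xmat: "Xmat p = Xmat q \<Longrightarrow> p = q"
proof -
  assume "Xmat p = Xmat q"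
  then have "snd p - vec_nth (fst p) 3 = snd q - vec_nth (fst q) 3"
    "snd p + vec_nth (fst p) 3 = snd q + vec_nth (fst q) 3"
    "vec_nth (fst p) 1 = vec_nth (fst q) 1" "vec_nth (fst p) 2 = vec_nth (fst q) 2"
    by (auto simp: Xmat_mat22 complex_eq_iff)
  then have "snd p = snd q" "vec_nth (fst p) i = vec_nth (fst q) i" for i
    using exhaust_3[of i] by auto
  then show "p = q" by (simp add: prod_eq_iff Finite_Cartesian_Product.vec_eq_iff)
qed

lemma hermitian_eq_Xmat:
  assumes "H \<in> carrier_mat 2 2" "mat_adjoint H = H"
  obtains q where "Xmat q = H"
proof -
  obtain a b c d where H: "H = mat22 a b c d" using assms(1) by (rule mat22_cases)
  with assms(2) have *: "cnj a = a" "cnj d = d" "cnj b = c" by (auto simp: mat_adjoint_22)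
  \<comment> \<open>The witness solves p0 - p3 = a, p0 + p3 = d and -(p1 + i p2) = c.\<close>
  have "Xmat (vector [- Re c, - Im c, (Re d - Re a) / 2], (Re d + Re a) / 2) = H"
    using * by (auto simp: Xmat_mat22 H complex_eq_iff field_simps)
  then show ?thesis by (rule that)
qed

text \<open>The description in \<open>lorentz\<close> is justified by two facts: the conjugate of a
  Hermitian matrix by \<open>M\<close> is Hermitian, hence some \<open>Xmat r\<close>, and
  \<open>Xmat\<close> is injective.\<close>

lemma lorentz_eq_iff:
  assumes M: "M \<in> carrier_mat 2 2"
  shows "lorentz M p = q \<longleftrightarrow> Xmat q = M * Xmat p * mat_adjoint M"
proof -
  have "mat_adjoint (Xmat p) = Xmat p"
    by (simp add: Xmat_mat22 mat_adjoint_22 complex_eq_iff)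
  then have "mat_adjoint (M * Xmat p * mat_adjoint M) = M * Xmat p * mat_adjoint M"
    using mat_adjoint_mult[of "M * Xmat p" 2 2 "mat_adjoint M" 2] mat_adjoint_mult[OF M Xmat_carrier, of p]
      assoc_mult_mat[OF M Xmat_carrier, of "mat_adjoint M" 2 p] M by simp
  then obtain r where r: "Xmat r = M * Xmat p * mat_adjoint M"
    using M by (elim hermitian_eq_Xmat[rotated]) auto
  have "lorentz M p = r"
    unfolding lorentz_def by (rule the_equality) (auto simp: r[symmetric] dest: inj_Xmat)
  then show ?thesis using r inj_Xmat by metis
qed

lemma norm_sq_3: "(norm (p :: real^3))\<^sup>2 = (vec_nth p 1)\<^sup>2 + (vec_nth p 2)\<^sup>2 + (vec_nth p 3)\<^sup>2"
  unfolding power2_norm_eq_inner inner_vec_def by (simp add: sum_3 power2_eq_square)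

lemma energy_sq: "(energy m p)\<^sup>2 = (vec_nth p 1)\<^sup>2 + (vec_nth p 2)\<^sup>2 + (vec_nth p 3)\<^sup>2 + m\<^sup>2"
  by (simp add: energy_def norm_sq_3)

lemma energy_ge: "\<bar>m\<bar> \<le> energy m p" "norm p \<le> energy m p"
  by (auto simp: energy_def real_le_rsqrt intro!: real_le_rsqrt)

lemma energy_minus [simp]: "energy m (- p) = energy m p"
  by (simp add: energy_def)

section \<open>Explicit form and uniqueness of the standard boost\<close>

definition boost_norm :: "real \<Rightarrow> real^3 \<Rightarrow> real" where
  "boost_norm m p = sqrt (2 * m * (energy m p + m))"

text \<open>On the mass shell X = X(p) has trace 2 E and determinant m^2, so Cayley-Hamilton gives
  X^2 = 2 E X - m^2 and (X + m)^2 = 2 (E + m) X. Dividing X + m by the square root of 2 m (E + m)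
  yields a square root of X / m, and this scalar also makes the determinant 1.\<close>

definition boost_mat :: "real \<Rightarrow> real^3 \<Rightarrow> complex mat" where
  "boost_mat m p = complex_of_real (1 / boost_norm m p) \<cdot>\<^sub>m
     (Xmat (on_shell m p) + complex_of_real m \<cdot>\<^sub>m 1\<^sub>m 2)"

lemma boost_mat_carrier [simp]: "boost_mat m p \<in> carrier_mat 2 2"
  by (simp add: boost_mat_def)

lemma boost_norm_pos: "m > 0 \<Longrightarrow> boost_norm m p > 0"
  using energy_ge(1)[of m p] by (auto simp: boost_norm_def)

lemma boost_norm_sq: "m > 0 \<Longrightarrow> (boost_norm m p)\<^sup>2 = 2 * m * (energy m p + m)"
  using energy_ge(1)[of m p] by (auto simp: boost_norm_def)

lemma boost_mat_22:
  fixes m p defines "N \<equiv> boost_norm m p"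
  shows "boost_mat m p = mat22 (of_real ((energy m p + m - vec_nth p 3) / N))
    (- Complex (vec_nth p 1 / N) (- vec_nth p 2 / N))
    (- Complex (vec_nth p 1 / N) (vec_nth p 2 / N))
    (of_real ((energy m p + m + vec_nth p 3) / N))"
  by (simp add: boost_mat_def N_def Xmat_mat22 one_mat_22 mat22_smult mat22_add on_shell_def
    complex_eq_iff add_divide_distrib diff_divide_distrib algebra_simps)

lemma boost_mat_sq:
  assumes m: "m > 0"
  shows "boost_mat m p * boost_mat m p = complex_of_real (1 / m) \<cdot>\<^sub>m Xmat (on_shell m p)"
proof -
  define N where "N = boost_norm m p"
  define E where "E = energy m p"
  have N: "N > 0" "N * N = 2 * m * (E + m)"
    using boost_norm_pos[OF m, of p] boost_norm_sq[OF m, of p] by (simp_all add: N_def E_def power2_eq_square)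
  have E: "E * E = vec_nth p 1 * vec_nth p 1 + vec_nth p 2 * vec_nth p 2 + vec_nth p 3 * vec_nth p 3 + m * m"
    using energy_sq[of m p] by (simp add: E_def power2_eq_square)
  have "E + m > 0" using energy_ge(1)[of m p] m by (simp add: E_def)
  then show ?thesis using E m
    unfolding boost_mat_22 N_def[symmetric] E_def[symmetric]
    by (simp add: Xmat_mat22 mat22_mult mat22_smult on_shell_def complex_eq_iff E_def[symmetric],
      simp add: N divide_simps, simp add: algebra_simps)
qed

lemma boost_mat_det:
  assumes m: "m > 0"
  shows "Determinant.det (boost_mat m p) = 1"
proof -
  define N where "N = boost_norm m p"
  define E where "E = energy m p"
  have N: "N > 0" "N * N = 2 * m * (E + m)"
    using boost_norm_pos[OF m, of p] boost_norm_sq[OF m, of p] by (simp_all add: N_def E_def power2_eq_square)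
  have E: "E * E = vec_nth p 1 * vec_nth p 1 + vec_nth p 2 * vec_nth p 2 + vec_nth p 3 * vec_nth p 3 + m * m"
    using energy_sq[of m p] by (simp add: E_def power2_eq_square)
  have "E + m > 0" using energy_ge(1)[of m p] m by (simp add: E_def)
  then show ?thesis using E m
    unfolding boost_mat_22 N_def[symmetric] E_def[symmetric]
    by (simp add: det_mat22 complex_eq_iff,
      simp add: N divide_simps, simp add: algebra_simps)
qed

lemma boost_mat_adjoint [simp]: "mat_adjoint (boost_mat m p) = boost_mat m p"
  by (simp add: boost_mat_22 mat_adjoint_22 complex_eq_iff)

text \<open>Reversing the momentum replaces the matrix by its adjugate, which for determinant 1 is
  the inverse.\<close>

lemma boost_mat_inverse:
  assumes m: "m > 0"
  shows "boost_mat m p * boost_mat m (- p) = 1\<^sub>m 2"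
proof -
  have N: "boost_norm m (- p) = boost_norm m p" by (simp add: boost_norm_def)
  have "boost_mat m p = mat22 a b c d \<Longrightarrow> boost_mat m (- p) = mat22 d (- b) (- c) a" for a b c d
    by (auto simp: boost_mat_22 N complex_eq_iff)
  moreover obtain a b c d where L: "boost_mat m p = mat22 a b c d"
    by (rule mat22_cases[OF boost_mat_carrier])
  ultimately have "boost_mat m p * boost_mat m (- p) = mat22 a b c d * mat22 d (- b) (- c) a" by simp
  also have "\<dots> = mat22 (a * d - b * c) 0 0 (a * d - b * c)" by (simp add: mat22_mult)
  also have "a * d - b * c = 1" using boost_mat_det[OF m, of p] by (simp add: L det_mat22)
  finally show ?thesis by (simp add: one_mat_22)
qed

text \<open>Completing the square: \<open>M\<^sub>0\<^sub>0\<close> times the quadratic form is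
  \<open>\<bar>M\<^sub>0\<^sub>0 w\<^sub>0 + M\<^sub>0\<^sub>1 w\<^sub>1\<bar>\<^sup>2 + det M \<bar>w\<^sub>1\<bar>\<^sup>2\<close>.\<close>

lemma pos_def_22:
  assumes a: "a > 0" and det: "a * d - (cmod b)\<^sup>2 > 0"
  shows "pos_def_hermitian 2 (mat22 (complex_of_real a) b (cnj b) (complex_of_real d))"
  unfolding pos_def_hermitian_def
proof (intro conjI ballI impI)
  show "mat_adjoint (mat22 (of_real a) b (cnj b) (of_real d)) = mat22 (complex_of_real a) b (cnj b) (of_real d)"
    by (simp add: mat_adjoint_22)
  fix w :: "complex Matrix.vec" assume w: "w \<in> carrier_vec 2" "w \<noteq> 0\<^sub>v 2"
  define w0 where "w0 = vec_index w 0"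
  define w1 where "w1 = vec_index w 1"
  define q where "q = (mat22 (of_real a) b (cnj b) (of_real d) *\<^sub>v w) \<bullet>c w"
  have q: "q = (of_real a * w0 + b * w1) * cnj w0 + (cnj b * w0 + of_real d * w1) * cnj w1"
    using w(1) by (simp add: q_def w0_def w1_def scalar_prod_def numeral_2_eq_2)
  have "a * Re q = (cmod (of_real a * w0 + b * w1))\<^sup>2 + (a * d - (cmod b)\<^sup>2) * (cmod w1)\<^sup>2"
    unfolding q cmod_power2 by (simp add: power2_eq_square algebra_simps)
  also have "\<dots> > 0"
  proof (cases "w1 = 0")
    case True
    have "w0 \<noteq> 0"
    proof
      assume "w0 = 0"
      with True have "w = 0\<^sub>v 2"
        using w(1) by (intro eq_vecI) (auto simp: w0_def w1_def less_2_cases_iff)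
      with w(2) show False ..
    qed
    then show ?thesis using True a by (simp add: norm_mult)
  next
    case False
    then show ?thesis using det by (simp add: add_nonneg_pos)
  qed
  finally show "0 < Re ((mat22 (of_real a) b (cnj b) (of_real d) *\<^sub>v w) \<bullet>c w)"
    using a by (simp add: q_def zero_less_mult_iff)
qed simp

lemma boost_mat_pos_def:
  assumes m: "m > 0"
  shows "pos_def_hermitian 2 (boost_mat m p)"
proof -
  define N where "N = boost_norm m p"
  define a where "a = (energy m p + m - vec_nth p 3) / N"
  define d where "d = (energy m p + m + vec_nth p 3) / N"
  define b where "b = - Complex (vec_nth p 1 / N) (- vec_nth p 2 / N)"
  have L: "boost_mat m p = mat22 (of_real a) b (cnj b) (of_real d)"
    by (simp add: boost_mat_22 a_def b_def d_def N_def complex_eq_iff)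
  have "complex_of_real (a * d - (cmod b)\<^sup>2) = 1"
    using boost_mat_det[OF m, of p] by (simp add: L det_mat22 complex_norm_square[symmetric])
  then have "a * d - (cmod b)\<^sup>2 = 1" using of_real_eq_1_iff by blast
  moreover have "vec_nth p 3 \<le> energy m p"
    using component_le_norm_cart[of p 3] energy_ge(2)[of p m] by linarith
  then have "a > 0"
    using m boost_norm_pos[OF m, of p] by (simp add: a_def N_def)
  ultimately show ?thesis unfolding L by (intro pos_def_22) auto
qed

text \<open>By Cayley-Hamilton a matrix of determinant 1 satisfies \<open>M\<^sup>2 = (tr M) M - 1\<close>, so a square root
  with positive trace is unique.\<close>

lemma pos_def_sqrt_unique:
  assumes M: "M \<in> SL2C" "pos_def_hermitian 2 M" and N: "N \<in> SL2C" "pos_def_hermitian 2 N"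
    and MN: "M * M = N * N"
  shows "M = N"
proof -
  have *: "\<exists>t>0. \<exists>a b c d. K = mat22 a b c d \<and> a + d = complex_of_real t \<and> a * d - b * c = 1"
    if K: "K \<in> SL2C" "pos_def_hermitian 2 K" for K
  proof -
    have "K \<in> carrier_mat 2 2" using K by (simp add: SL2C_def)
    then obtain a b c d where e: "K = mat22 a b c d" by (rule mat22_cases)
    have pos: "0 < Re ((K *\<^sub>v w) \<bullet>c w)" if "w \<in> carrier_vec 2" "w \<noteq> 0\<^sub>v 2" for w
      using K(2) that by (simp add: pos_def_hermitian_def)
    have ne: "unit_vec 2 i \<noteq> (0\<^sub>v 2 :: complex Matrix.vec)" if "i < 2" for i
      using that by (metis index_unit_vec(2) index_zero_vec(1) zero_neq_one)
    \<comment> \<open>The unit vectors as test vectors show that both diagonal entries, hence the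
      trace, are positive.\<close>
    from pos[OF _ ne[of 0]] pos[OF _ ne[of 1]] have "Re a > 0" "Re d > 0"
      by (simp_all add: e scalar_prod_def numeral_2_eq_2)
    moreover have "mat_adjoint K = K" using K(2) by (simp add: pos_def_hermitian_def)
    then have "cnj a = a" "cnj d = d" by (simp_all add: e mat_adjoint_22)
    then have "a + d = complex_of_real (Re a + Re d)" by (simp add: complex_eq_iff)
    moreover have "a * d - b * c = 1" using K(1) by (simp add: SL2C_def e det_mat22)
    ultimately show ?thesis using e by (metis add_pos_pos)
  qed
  obtain t a b c d where M': "t > 0" "M = mat22 a b c d" "a + d = complex_of_real t" "a * d - b * c = 1"
    using *[OF M] by blast
  obtain t' a' b' c' d' where N': "t' > 0" "N = mat22 a' b' c' d'" "a' + d' = complex_of_real t'" "a' * d' - b' * c' = 1"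
    using *[OF N] by blast
  have sq: "a * a + b * c = complex_of_real t * a - 1" "a * b + b * d = complex_of_real t * b"
    "c * a + d * c = complex_of_real t * c" "c * b + d * d = complex_of_real t * d - 1"
    using M'(4) by (simp_all add: M'(3)[symmetric] algebra_simps)
  have sq': "a' * a' + b' * c' = complex_of_real t' * a' - 1" "a' * b' + b' * d' = complex_of_real t' * b'"
    "c' * a' + d' * c' = complex_of_real t' * c'" "c' * b' + d' * d' = complex_of_real t' * d' - 1"
    using N'(4) by (simp_all add: N'(3)[symmetric] algebra_simps)
  \<comment> \<open>The terms -1 of the two Cayley-Hamilton identities cancel, so equal squares give
    t M = t' N. Taking traces yields t^2 = t'^2, and positivity gives t = t'.\<close>
  have eq: "complex_of_real t * a = of_real t' * a'" "complex_of_real t * b = of_real t' * b'"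
    "complex_of_real t * c = of_real t' * c'" "complex_of_real t * d = of_real t' * d'"
    using MN unfolding M'(2) N'(2) mat22_mult mat22_eq_iff sq sq' by simp_all
  have "complex_of_real (t * t) = complex_of_real t * (a + d)" by (simp add: M'(3))
  also have "\<dots> = of_real t' * (a' + d')" by (simp add: distrib_left eq)
  also have "\<dots> = complex_of_real (t' * t')" by (simp add: N'(3))
  finally have "t * t = t' * t'" using of_real_eq_iff by blast
  then have "t = t'" using M'(1) N'(1) by (metis abs_of_pos real_sqrt_abs2)
  then show ?thesis using eq M'(1) by (simp add: M'(2) N'(2))
qed

text \<open>For Hermitian \<open>M\<close> the image of the rest momentum corresponds to m M^2, so
  mapping it to p means that M^2 equals the square of \<open>boost_mat\<close>; uniqueness is then
  that of the square root.\<close>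

lemma boost_on_shell:
  assumes m: "m > 0"
  shows "boost m (on_shell m p) = boost_mat m p"
  unfolding boost_def
proof (rule the_equality)
  have X0: "Xmat (0, m) = complex_of_real m \<cdot>\<^sub>m 1\<^sub>m 2"
    by (simp add: Xmat_mat22 one_mat_22 mat22_smult complex_eq_iff)
  have iff: "lorentz M (0, m) = on_shell m p \<longleftrightarrow> M * M = boost_mat m p * boost_mat m p"
    if M: "M \<in> carrier_mat 2 2" "mat_adjoint M = M" for M
  proof -
    obtain a b c d where e: "M = mat22 a b c d" using M(1) by (rule mat22_cases)
    obtain a' b' c' d' where e': "Xmat (on_shell m p) = mat22 a' b' c' d'"
      using Xmat_carrier by (rule mat22_cases)
    have "M * Xmat (0, m) * mat_adjoint M = complex_of_real m \<cdot>\<^sub>m (M * M)"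
      unfolding X0 M(2) by (simp add: e one_mat_22 mat22_mult mat22_smult algebra_simps)
    then show ?thesis
      unfolding lorentz_eq_iff[OF M(1)] boost_mat_sq[OF m]
      using m by (auto simp: e e' mat22_mult mat22_smult field_simps)
  qed
  show L: "boost_mat m p \<in> SL2C \<and> pos_def_hermitian 2 (boost_mat m p) \<and>
      lorentz (boost_mat m p) (0, m) = on_shell m p"
    using boost_mat_det[OF m] boost_mat_pos_def[OF m] by (simp add: SL2C_def iff)
  fix M assume M: "M \<in> SL2C \<and> pos_def_hermitian 2 M \<and> lorentz M (0, m) = on_shell m p"
  then have "M * M = boost_mat m p * boost_mat m p"
    using iff[of M] by (simp add: pos_def_hermitian_def)
  then show "M = boost_mat m p" using M L pos_def_sqrt_unique by blast
qed

text \<open>The axis is n = -p / |p|, with the sign of the spatial part of \<open>Xmat\<close>, and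
  z = exp (tau), where tau is half the rapidity of p. For p = 0 the axis is arbitrary and z =
  1.\<close>

lemma boost_mat_eq_axis_mat:
  assumes m: "m > 0"
  obtains n1 n2 n3 z where "n1\<^sup>2 + n2\<^sup>2 + n3\<^sup>2 = 1" "z \<noteq> 0" "boost_mat m p = axis_mat n1 n2 n3 z"
proof (cases "p = 0")
  case True
  have E: "energy m 0 = m" using m by (simp add: energy_def)
  have "boost_norm m 0 = 2 * m"
    unfolding boost_norm_def E using m by (intro real_sqrt_unique) (simp_all add: power2_eq_square)
  with E have "boost_mat m p = axis_mat 0 0 1 1"
    using m True by (simp add: boost_mat_22 axis_mat_def complex_eq_iff)
  then show ?thesis by (intro that[of 0 0 1 1]) auto
next
  case False
  define N where "N = boost_norm m p"
  \<comment> \<open>\<open>c\<close> and \<open>s\<close> are cosh (tau) and sinh (tau), so z = c +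
    s and 1/z = c - s.\<close>
  define c where "c = (energy m p + m) / N"
  define s where "s = norm p / N"
  have N: "N > 0" "N\<^sup>2 = 2 * m * (energy m p + m)"
    using boost_norm_pos[OF m] boost_norm_sq[OF m] by (simp_all add: N_def)
  have p: "norm p > 0" "(norm p)\<^sup>2 = (vec_nth p 1)\<^sup>2 + (vec_nth p 2)\<^sup>2 + (vec_nth p 3)\<^sup>2"
    using False by (simp_all add: norm_sq_3)
  have "(c + s) * (c - s) = c\<^sup>2 - s\<^sup>2"
    by (simp add: power2_eq_square algebra_simps)
  also have "\<dots> = ((energy m p + m)\<^sup>2 - (norm p)\<^sup>2) / N\<^sup>2"
    by (simp add: c_def s_def power_divide diff_divide_distrib)
  also have "(energy m p + m)\<^sup>2 - (norm p)\<^sup>2 = N\<^sup>2"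
    using energy_sq[of m p] p(2) N(2) by (simp add: power2_eq_square algebra_simps)
  finally have cs: "(c + s) * (c - s) = 1" using N(1) by simp
  have "c + s \<noteq> 0" using cs by auto
  have inv: "inverse (complex_of_real (c + s)) = complex_of_real (c - s)"
    using cs by (metis inverse_unique of_real_inverse)
  have "(vec_nth p 1 / norm p)\<^sup>2 + (vec_nth p 2 / norm p)\<^sup>2 + (vec_nth p 3 / norm p)\<^sup>2 = 1"
    unfolding power_divide add_divide_distrib[symmetric] p(2)[symmetric] using p(1) by simp
  then have unit: "(- vec_nth p 1 / norm p)\<^sup>2 + (- vec_nth p 2 / norm p)\<^sup>2 + (- vec_nth p 3 / norm p)\<^sup>2 = 1"
    by simp
  have "boost_mat m p = axis_mat (- vec_nth p 1 / norm p) (- vec_nth p 2 / norm p)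
      (- vec_nth p 3 / norm p) (complex_of_real (c + s))"
    using N(1) p(1) unfolding axis_mat_def Let_def inv boost_mat_22 N_def[symmetric]
    by (simp add: complex_eq_iff c_def s_def) (simp add: field_simps)
  then show ?thesis using unit \<open>c + s \<noteq> 0\<close> that by (metis of_real_eq_0_iff)
qed

section \<open>The twisted spin sum\<close>

lemma twice: "half_int s \<Longrightarrow> real (twice s) = 2 * s"
  unfolding half_int_def twice_def by (elim Nats_cases) simp

text \<open>The adjoint of the intertwining relation for \<open>u C D\<close> at the adjoint of
  \<open>W\<close>, again an element of \<open>SU2\<close>, lets \<open>spin_rep j W\<close> pass
  through \<open>mat_adjoint (u C D)\<close>; combined with the relation for \<open>u A B\<close>
  this moves \<open>W\<close> through the whole product.\<close>

lemma coefficient_intertwiner: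
  assumes cs: "coefficient_system j u v" and AB: "admissible j A B" and CD: "admissible j C D"
    and W: "W \<in> SU2"
  shows "AB_rep A B W * (u A B * mat_adjoint (u C D)) = (u A B * mat_adjoint (u C D)) * AB_rep C D W"
proof -
  let ?J = "twice j + 1"
  have u: "u A B \<in> carrier_mat (AB_dim A B) ?J" "u C D \<in> carrier_mat (AB_dim C D) ?J"
    and int: "\<And>W. W \<in> SU2 \<Longrightarrow> u A B * spin_rep j W = AB_rep A B W * u A B"
      "\<And>W. W \<in> SU2 \<Longrightarrow> u C D * spin_rep j W = AB_rep C D W * u C D"
    using cs AB CD unfolding coefficient_system_def by blast+
  have Wc: "W \<in> carrier_mat 2 2" using W by (simp add: SU2_def SL2C_def)
  have W': "mat_adjoint W \<in> SU2"
  proof -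
    have "W * mat_adjoint W = 1\<^sub>m 2"
      by (rule mat_mult_left_right_inverse[of _ 2]) (use W Wc in \<open>auto simp: SU2_def\<close>)
    moreover obtain a b c d where "W = mat22 a b c d" using Wc by (rule mat22_cases)
    moreover from this have "Determinant.det (mat_adjoint W) = cnj (Determinant.det W)"
      by (simp add: mat_adjoint_22 det_mat22)
    ultimately show ?thesis using W Wc by (simp add: SU2_def SL2C_def)
  qed
  have J: "spin_rep j W \<in> carrier_mat ?J ?J" "spin_rep j (mat_adjoint W) \<in> carrier_mat ?J ?J" by simp_all
  have "mat_adjoint (u C D * spin_rep j (mat_adjoint W)) = mat_adjoint (AB_rep C D (mat_adjoint W) * u C D)"
    using int(2)[OF W'] by simp
  moreover have "mat_adjoint (AB_rep C D (mat_adjoint W)) = AB_rep C D W"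
    by (simp add: AB_rep_SU2[OF W] AB_rep_SU2[OF W'] kron_adjoint spin_rep_adjoint[OF Wc])
  moreover have "mat_adjoint (spin_rep j (mat_adjoint W)) = spin_rep j W"
    by (simp add: spin_rep_adjoint[OF Wc])
  ultimately have adj: "spin_rep j W * mat_adjoint (u C D) = mat_adjoint (u C D) * AB_rep C D W"
    using mat_adjoint_mult[OF u(2) J(2)] mat_adjoint_mult[OF AB_rep_carrier u(2), of "mat_adjoint W"] by simp
  have u': "mat_adjoint (u C D) \<in> carrier_mat ?J (AB_dim C D)" using u by simp
  have "AB_rep A B W * (u A B * mat_adjoint (u C D)) = (AB_rep A B W * u A B) * mat_adjoint (u C D)"
    by (rule assoc_mult_mat[OF AB_rep_carrier u(1) u', symmetric])
  also have "\<dots> = u A B * (spin_rep j W * mat_adjoint (u C D))"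
    unfolding int(1)[OF W, symmetric] by (rule assoc_mult_mat[OF u(1) J(1) u'])
  also have "\<dots> = (u A B * mat_adjoint (u C D)) * AB_rep C D W"
    unfolding adj by (rule assoc_mult_mat[OF u(1) u' AB_rep_carrier, symmetric])
  finally show ?thesis .
qed

lemma inv_boost_mat: "m > 0 \<Longrightarrow> inv_mat (boost_mat m p) = boost_mat m (- p)"
  by (intro inv_mat_eqI[of _ 2] boost_mat_inverse) auto

text \<open>A boost is Hermitian, so the inverse adjoint in the second factor is just its inverse,
  the boost with reversed momentum.\<close>

lemma AB_rep_boost:
  "m > 0 \<Longrightarrow> AB_rep A B (boost_mat m p) = kron (spin_rep A (boost_mat m p)) (spin_rep B (boost_mat m (- p)))"
  by (simp add: AB_rep_def inv_boost_mat)

lemma kron_spin_rep_carrier [simp]: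
  "kron (spin_rep A M) (spin_rep B N) \<in> carrier_mat (AB_dim A B) (AB_dim A B)"
  unfolding AB_dim_def Suc_eq_plus1[symmetric] by (intro kron_carrier spin_rep_carrier)

lemma kron_spin_rep_mult:
  assumes "M \<in> carrier_mat 2 2" "M' \<in> carrier_mat 2 2" "N \<in> carrier_mat 2 2" "N' \<in> carrier_mat 2 2"
  shows "kron (spin_rep A M) (spin_rep B N) * kron (spin_rep A M') (spin_rep B N') =
    kron (spin_rep A (M * M')) (spin_rep B (N * N'))"
  using kron_mult[OF spin_rep_carrier spin_rep_carrier spin_rep_carrier spin_rep_carrier]
  by (simp add: spin_rep_mult assms)

lemma AB_rep_boost_inverse:
  assumes m: "m > 0"
  shows "AB_rep A B (boost_mat m p) * AB_rep A B (boost_mat m (- p)) = 1\<^sub>m (AB_dim A B)"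
  using boost_mat_inverse[OF m, of p] boost_mat_inverse[OF m, of "- p"]
  by (simp add: AB_rep_boost[OF m] kron_spin_rep_mult kron_one AB_dim_def)

lemma inv_AB_rep_boost:
  "m > 0 \<Longrightarrow> inv_mat (AB_rep A B (boost_mat m p)) = AB_rep A B (boost_mat m (- p))"
  by (intro inv_mat_eqI[of _ "AB_dim A B"] AB_rep_boost_inverse) auto

lemma intertwiner_boost:
  assumes m: "m > 0" and Q: "Q \<in> carrier_mat (AB_dim A B) (AB_dim C D)"
    and int: "\<And>W. W \<in> SU2 \<Longrightarrow> AB_rep A B W * Q = Q * AB_rep C D W"
  shows "kron (spin_rep A (boost_mat m p)) (spin_rep B (boost_mat m p)) * Q =
         Q * kron (spin_rep C (boost_mat m p)) (spin_rep D (boost_mat m p))"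
proof -
  obtain n1 n2 n3 z where n: "n1\<^sup>2 + n2\<^sup>2 + n3\<^sup>2 = 1" and z: "z \<noteq> 0"
    and L: "boost_mat m p = axis_mat n1 n2 n3 z"
    using m by (rule boost_mat_eq_axis_mat)
  show ?thesis unfolding L by (rule intertwiner_axis_mat[OF Q int n z])
qed

text \<open>The left factor is split so that its part \<open>K'\<close> can cross the intertwiner
  \<open>Q\<close> and merge with the right factor \<open>R\<close>.\<close>

lemma twist_rearrange:
  fixes K :: "complex mat"
  assumes c: "K \<in> carrier_mat a a" "K' \<in> carrier_mat a a" "Q \<in> carrier_mat a b" "R \<in> carrier_mat b b" "R' \<in> carrier_mat b b"
    and int: "K' * Q = Q * R'"
  shows "(K * K') * Q * R = K * Q * (R' * R)"
proof -
  have "(K * K') * Q * R = K * (K' * Q) * R"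
    by (simp add: assoc_mult_mat[OF c(1,2,3)])
  also have "\<dots> = (K * Q) * R' * R"
    unfolding int by (simp add: assoc_mult_mat[OF c(1) c(3) c(5)])
  also have "\<dots> = K * Q * (R' * R)"
    by (rule assoc_mult_mat) (use c in auto)
  finally show ?thesis .
qed

text \<open>Moving \<open>D\<^sup>A(L\<^sup>-\<^sup>1) \<otimes> D\<^sup>B(L\<^sup>-\<^sup>1)\<close>, or its inverse, through the intertwiner leaves only squares
  of boosts in one pair of tensor factors, and \<open>L(p)\<^sup>2 = X(p) / m\<close>.\<close>

lemma twisted_spin_sum_eq:
  assumes m: "m > 0" and cs: "coefficient_system j u v"
    and AB: "admissible j A B" and CD: "admissible j C D"
  defines "Q \<equiv> u A B * mat_adjoint (u C D)"
    and "L2 \<equiv> \<lambda>p. boost_mat m p * boost_mat m p"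
  shows "twisted_spin_sum m u A B C D (on_shell m p) =
      kron (spin_rep A (L2 p)) (1\<^sub>m (Suc (twice B))) * Q * kron (spin_rep C (L2 (- p))) (1\<^sub>m (Suc (twice D)))" (is "?T = ?F")
    and "twisted_spin_sum m u A B C D (on_shell m p) =
      kron (1\<^sub>m (Suc (twice A))) (spin_rep B (L2 (- p))) * Q * kron (1\<^sub>m (Suc (twice C))) (spin_rep D (L2 p))" (is "?T = ?G")
proof -
  let ?L = "boost_mat m p" and ?L' = "boost_mat m (- p)"
  have u: "u A B \<in> carrier_mat (AB_dim A B) (twice j + 1)" "u C D \<in> carrier_mat (AB_dim C D) (twice j + 1)"
    using cs AB CD unfolding coefficient_system_def by blast+
  then have Q: "Q \<in> carrier_mat (AB_dim A B) (AB_dim C D)" unfolding Q_def by simp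
  have int: "kron (spin_rep A (boost_mat m q)) (spin_rep B (boost_mat m q)) * Q =
         Q * kron (spin_rep C (boost_mat m q)) (spin_rep D (boost_mat m q))" for q
    using intertwiner_boost[OF m Q] coefficient_intertwiner[OF cs AB CD] unfolding Q_def by blast
  have one: "?L * ?L' = 1\<^sub>m 2" "?L' * ?L = 1\<^sub>m 2"
    using boost_mat_inverse[OF m, of p] boost_mat_inverse[OF m, of "- p"] by simp_all
  have cancel: "(?L * ?L) * ?L' = ?L" "(?L' * ?L') * ?L = ?L'"
    using one assoc_mult_mat[of ?L 2 2 ?L 2 ?L' 2] assoc_mult_mat[of ?L' 2 2 ?L' 2 ?L 2]
    by (simp_all add: right_mult_one_mat[OF boost_mat_carrier])
  have "?T = AB_rep A B ?L * Q * AB_rep C D ?L'"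
    using assoc_mult_mat[OF AB_rep_carrier u(1), of "mat_adjoint (u C D)" "AB_dim C D" ?L] u
    by (simp add: twisted_spin_sum_def boost_on_shell[OF m] inv_AB_rep_boost[OF m] Q_def)
  then have T: "?T = kron (spin_rep A ?L) (spin_rep B ?L') * Q * kron (spin_rep C ?L') (spin_rep D ?L)"
    by (simp add: AB_rep_boost[OF m])
  \<comment> \<open>With L' the inverse of L, the left factor is the product of L^2 in the first
    slot and L' in both slots. The second piece is of the form that crosses \<open>Q\<close>, and on
    the right it turns the second slot into 1.\<close>
  have "kron (spin_rep A ?L) (spin_rep B ?L') =
      kron (spin_rep A (?L * ?L)) (spin_rep B (1\<^sub>m 2)) * kron (spin_rep A ?L') (spin_rep B ?L')"
    by (subst kron_spin_rep_mult) (simp_all add: cancel mult_carrier_mat[of _ 2 2] left_mult_one_mat[OF boost_mat_carrier])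
  moreover have "kron (spin_rep C ?L') (spin_rep D ?L') * kron (spin_rep C ?L') (spin_rep D ?L) =
      kron (spin_rep C (?L' * ?L')) (spin_rep D (1\<^sub>m 2))"
    by (subst kron_spin_rep_mult) (simp_all add: one mult_carrier_mat[of _ 2 2] left_mult_one_mat[OF boost_mat_carrier])
  ultimately show "?T = ?F"
    using twist_rearrange[OF kron_spin_rep_carrier kron_spin_rep_carrier Q kron_spin_rep_carrier
        kron_spin_rep_carrier int[of "- p"], of "?L * ?L" "1\<^sub>m 2" ?L' ?L]
    unfolding T L2_def by simp
  \<comment> \<open>The mirror image: L in both slots is split off, which leaves the square of L' in
    the second slot.\<close>
  have "kron (spin_rep A ?L) (spin_rep B ?L') =
      kron (spin_rep A (1\<^sub>m 2)) (spin_rep B (?L' * ?L')) * kron (spin_rep A ?L) (spin_rep B ?L)"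
    by (subst kron_spin_rep_mult) (simp_all add: cancel mult_carrier_mat[of _ 2 2] left_mult_one_mat[OF boost_mat_carrier])
  moreover have "kron (spin_rep C ?L) (spin_rep D ?L) * kron (spin_rep C ?L') (spin_rep D ?L) =
      kron (spin_rep C (1\<^sub>m 2)) (spin_rep D (?L * ?L))"
    by (subst kron_spin_rep_mult) (simp_all add: one mult_carrier_mat[of _ 2 2] left_mult_one_mat[OF boost_mat_carrier])
  ultimately show "?T = ?G"
    using twist_rearrange[OF kron_spin_rep_carrier kron_spin_rep_carrier Q kron_spin_rep_carrier
        kron_spin_rep_carrier int[of p], of "1\<^sub>m 2" "?L' * ?L'" ?L' ?L]
    unfolding T L2_def by simp
qed

section \<open>Homogeneous polynomials\<close>

definition hom_poly :: "nat \<Rightarrow> (fourvec \<Rightarrow> complex) set" where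
  "hom_poly d = {f. \<exists>c. \<forall>p. f p = (\<Sum>\<alpha> | monomial_degree \<alpha> = d. c \<alpha> * of_real (monomial_eval \<alpha> p))}"

lemma finite_monomial_degree [simp]: "finite {\<alpha>. monomial_degree \<alpha> = d}"
  by (rule finite_subset[of _ "{..d} \<times> {..d} \<times> {..d} \<times> {..d}"]) auto

fun multi_index_add :: "multi_index \<Rightarrow> multi_index \<Rightarrow> multi_index" where
  "multi_index_add (a1, a2, a3, a0) (b1, b2, b3, b0) = (a1 + b1, a2 + b2, a3 + b3, a0 + b0)"

lemma monomial_degree_add: "monomial_degree (multi_index_add \<alpha> \<beta>) = monomial_degree \<alpha> + monomial_degree \<beta>"
  by (cases \<alpha>; cases \<beta>) simp

lemma monomial_eval_add: "monomial_eval (multi_index_add \<alpha> \<beta>) p = monomial_eval \<alpha> p * monomial_eval \<beta> p"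
  by (cases \<alpha>; cases \<beta>; cases p) (simp add: power_add)

lemma monomial_eval_minus: "monomial_eval \<alpha> (- p) = (- 1) ^ monomial_degree \<alpha> * monomial_eval \<alpha> p"
proof -
  obtain a1 a2 a3 a0 where "\<alpha> = (a1, a2, a3, a0)" by (cases \<alpha>)
  moreover obtain q e where "p = (q, e)" by (cases p)
  ultimately show ?thesis
    by (simp add: power_add power_minus[of "vec_nth q _"] power_minus[of e])
qed

lemma hom_poly_monomial: "(\<lambda>p. of_real (monomial_eval \<alpha> p)) \<in> hom_poly (monomial_degree \<alpha>)"
proof -
  have "of_real (monomial_eval \<alpha> p) = (\<Sum>\<beta> | monomial_degree \<beta> = monomial_degree \<alpha>.
      (if \<beta> = \<alpha> then 1 else 0) * complex_of_real (monomial_eval \<beta> p))" for p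
    by (simp add: if_distrib[of "\<lambda>x. x * _"] sum.delta cong: if_cong)
  then show ?thesis unfolding hom_poly_def by (intro CollectI exI allI)
qed

interpretation hom_poly: graded_functions hom_poly
proof
  show "(\<lambda>_. c) \<in> hom_poly 0" for c
  proof -
    have "{\<alpha>. monomial_degree \<alpha> = 0} = {(0, 0, 0, 0)}" by auto
    then have "\<forall>p. c = (\<Sum>\<alpha> | monomial_degree \<alpha> = 0. c * of_real (monomial_eval \<alpha> p))" by auto
    then show ?thesis unfolding hom_poly_def by (intro CollectI exI[of _ "\<lambda>_. c"])
  qed
  show "(\<lambda>_. 0) \<in> hom_poly d" for d
    unfolding hom_poly_def by (intro CollectI exI[of _ "\<lambda>_. 0"]) simp
  show "(\<lambda>p. f p + g p) \<in> hom_poly d" if "f \<in> hom_poly d" "g \<in> hom_poly d" for f g d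
  proof -
    obtain b c where "\<And>p. f p = (\<Sum>\<alpha> | monomial_degree \<alpha> = d. b \<alpha> * of_real (monomial_eval \<alpha> p))"
      "\<And>p. g p = (\<Sum>\<alpha> | monomial_degree \<alpha> = d. c \<alpha> * of_real (monomial_eval \<alpha> p))"
      using \<open>f \<in> _\<close> \<open>g \<in> _\<close> unfolding hom_poly_def by blast
    then have "\<forall>p. f p + g p = (\<Sum>\<alpha> | monomial_degree \<alpha> = d. (b \<alpha> + c \<alpha>) * of_real (monomial_eval \<alpha> p))"
      by (simp add: distrib_right sum.distrib)
    then show ?thesis unfolding hom_poly_def by (intro CollectI exI[of _ "\<lambda>\<alpha>. b \<alpha> + c \<alpha>"])
  qed
  show "(\<lambda>p. f p * g p) \<in> hom_poly (d + e)" if "f \<in> hom_poly d" "g \<in> hom_poly e" for f g d e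
  proof -
    obtain b c where f: "\<And>p. f p = (\<Sum>\<alpha> | monomial_degree \<alpha> = d. b \<alpha> * of_real (monomial_eval \<alpha> p))"
      and g: "\<And>p. g p = (\<Sum>\<alpha> | monomial_degree \<alpha> = e. c \<alpha> * of_real (monomial_eval \<alpha> p))"
      using \<open>f \<in> _\<close> \<open>g \<in> _\<close> unfolding hom_poly_def by blast
    let ?S = "{\<alpha>. monomial_degree \<alpha> = d} \<times> {\<beta>. monomial_degree \<beta> = e}"
    let ?add = "\<lambda>(\<alpha>, \<beta>). multi_index_add \<alpha> \<beta>"
    \<comment> \<open>The convolution of the coefficients: all pairs of multi-indices with sum
      \<open>\<gamma>\<close> contribute to the monomial \<open>\<gamma>\<close>.\<close>
    define h where "h \<gamma> = (\<Sum>x\<in>{x \<in> ?S. ?add x = \<gamma>}. b (fst x) * c (snd x))" for \<gamma>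
    have "f p * g p = (\<Sum>\<gamma> | monomial_degree \<gamma> = d + e. h \<gamma> * of_real (monomial_eval \<gamma> p))" for p
    proof -
      have "f p * g p = (\<Sum>x\<in>?S. b (fst x) * c (snd x) * of_real (monomial_eval (?add x) p))"
        unfolding f g sum_product sum.cartesian_product
        by (intro sum.cong refl) (simp add: monomial_eval_add case_prod_beta mult_ac)
      also have "\<dots> = (\<Sum>\<gamma> | monomial_degree \<gamma> = d + e. \<Sum>x\<in>{x \<in> ?S. ?add x = \<gamma>}.
          b (fst x) * c (snd x) * of_real (monomial_eval (?add x) p))"
        by (rule sum.group[symmetric]) (auto simp: monomial_degree_add)
      also have "\<dots> = (\<Sum>\<gamma> | monomial_degree \<gamma> = d + e. h \<gamma> * of_real (monomial_eval \<gamma> p))"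
        unfolding h_def sum_distrib_right by (intro sum.cong refl) auto
      finally show ?thesis .
    qed
    then show ?thesis unfolding hom_poly_def by (intro CollectI exI[of _ h] allI)
  qed
qed

lemma hom_poly_coordinates:
  "(\<lambda>p. of_real (vec_nth (fst p) i)) \<in> hom_poly 1" "(\<lambda>p. of_real (snd p)) \<in> hom_poly 1"
proof -
  have e: "of_real (vec_nth (fst p) 1) = complex_of_real (monomial_eval (1, 0, 0, 0) p)"
    "of_real (vec_nth (fst p) 2) = complex_of_real (monomial_eval (0, 1, 0, 0) p)"
    "of_real (vec_nth (fst p) 3) = complex_of_real (monomial_eval (0, 0, 1, 0) p)"
    "of_real (snd p) = complex_of_real (monomial_eval (0, 0, 0, 1) p)" for p
    by (cases p; simp)+
  have "(\<lambda>p. of_real (vec_nth (fst p) 1)) \<in> hom_poly 1" "(\<lambda>p. of_real (vec_nth (fst p) 2)) \<in> hom_poly 1"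
    "(\<lambda>p. of_real (vec_nth (fst p) 3)) \<in> hom_poly 1" "(\<lambda>p. of_real (snd p)) \<in> hom_poly 1"
    unfolding e
    using hom_poly_monomial[of "(1, 0, 0, 0)"] hom_poly_monomial[of "(0, 1, 0, 0)"]
      hom_poly_monomial[of "(0, 0, 1, 0)"] hom_poly_monomial[of "(0, 0, 0, 1)"] by simp_all
  then show "(\<lambda>p. of_real (vec_nth (fst p) i)) \<in> hom_poly 1" "(\<lambda>p. of_real (snd p)) \<in> hom_poly 1"
    using exhaust_3[of i] by auto
qed

text \<open>The reflected version represents m times the square of the inverse boost. Energy is an
  independent variable here, so both matrices are homogeneous of degree 1 also off the mass
  shell.\<close>

lemma hom_poly_Xmat: "hom_poly.mat_family 2 2 1 Xmat"
  and hom_poly_Xmat_parity: "hom_poly.mat_family 2 2 1 (\<lambda>p. Xmat (- fst p, snd p))"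
proof -
  note c = hom_poly_coordinates
  have lin: "(\<lambda>p. a * of_real (vec_nth (fst p) 1) + (b * of_real (vec_nth (fst p) 2) +
      (k * of_real (vec_nth (fst p) 3) + l * of_real (snd p)))) \<in> hom_poly 1" for a b k l
    by (intro hom_poly.add hom_poly.cmult c)
  have "hom_poly.mat_family 2 2 1 (\<lambda>p. Xmat (\<epsilon> *\<^sub>R fst p, snd p))" for \<epsilon>
    unfolding Xmat_mat22
  proof (rule hom_poly.mat_family_22, goal_cases)
    case 1 then show ?case using lin[of 0 0 "- of_real \<epsilon>" 1] by simp
  next
    case 2 then show ?case using lin[of "- of_real \<epsilon>" "\<i> * of_real \<epsilon>" 0 0]
      by (simp add: Complex_eq algebra_simps)
  next
    case 3 then show ?case using lin[of "- of_real \<epsilon>" "- \<i> * of_real \<epsilon>" 0 0]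
      by (simp add: Complex_eq algebra_simps)
  next
    case 4 then show ?case using lin[of 0 0 "of_real \<epsilon>" 1] by (simp add: add.commute)
  qed
  from this[of 1] this[of "- 1"]
  show "hom_poly.mat_family 2 2 1 Xmat" "hom_poly.mat_family 2 2 1 (\<lambda>p. Xmat (- fst p, snd p))"
    by simp_all
qed

lemma hom_poly_smult_mat:
  assumes "hom_poly.mat_family nr nc d M"
  shows "hom_poly.mat_family nr nc d (\<lambda>p. k \<cdot>\<^sub>m M p)"
  unfolding hom_poly.mat_family_def
proof (intro conjI allI impI)
  fix i l assume il: "i < nr" "l < nc"
  have "(k \<cdot>\<^sub>m M p) $$ (i, l) = k * M p $$ (i, l)" for p
  proof -
    show ?thesis using hom_poly.mat_family_carrier[OF assms, of p] il by simp
  qed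
  then show "(\<lambda>p. (k \<cdot>\<^sub>m M p) $$ (i, l)) \<in> hom_poly d"
    using assms il hom_poly.cmult by (simp add: hom_poly.mat_family_def)
qed (use hom_poly.mat_family_carrier[OF assms] in simp)

lemma poly_eval_eq_sum:
  assumes P: "\<And>\<alpha>. P \<alpha> \<in> carrier_mat nr nc" and T: "finite T" "support nr nc P \<subseteq> T"
    and ik: "i < nr" "k < nc"
  shows "poly_eval nr nc P p $$ (i, k) = (\<Sum>\<alpha>\<in>T. of_real (monomial_eval \<alpha> p) * P \<alpha> $$ (i, k))"
proof -
  have "(\<Sum>\<alpha>\<in>support nr nc P. of_real (monomial_eval \<alpha> p) * P \<alpha> $$ (i, k)) =
      (\<Sum>\<alpha>\<in>T. of_real (monomial_eval \<alpha> p) * P \<alpha> $$ (i, k))"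
    using T ik by (intro sum.mono_neutral_left) (auto simp: support_def)
  then show ?thesis using ik by (simp add: poly_eval_def)
qed

lemma hom_poly_mat_poly:
  assumes F: "hom_poly.mat_family nr nc d F"
  obtains P where "is_mat_poly nr nc P" "\<And>p. poly_eval nr nc P p = F p"
    "\<And>p. poly_eval nr nc P (- p) = (- 1) ^ d \<cdot>\<^sub>m poly_eval nr nc P p"
    "\<And>\<alpha>. \<alpha> \<in> support nr nc P \<Longrightarrow> monomial_degree \<alpha> = d"
proof -
  have "\<exists>c. \<forall>p. F p $$ (i, k) = (\<Sum>\<alpha> | monomial_degree \<alpha> = d. c \<alpha> * of_real (monomial_eval \<alpha> p))"
    if "i < nr" "k < nc" for i k
  proof -
    have "(\<lambda>p. F p $$ (i, k)) \<in> hom_poly d" using F that by (simp add: hom_poly.mat_family_def)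
    then show ?thesis by (simp add: hom_poly_def)
  qed
  then have "\<exists>c. \<forall>i k. i < nr \<longrightarrow> k < nc \<longrightarrow>
      (\<forall>p. F p $$ (i, k) = (\<Sum>\<alpha> | monomial_degree \<alpha> = d. c i k \<alpha> * of_real (monomial_eval \<alpha> p)))"
    by (intro choice allI) blast
  then obtain c where c: "\<And>i k p. i < nr \<Longrightarrow> k < nc \<Longrightarrow>
      F p $$ (i, k) = (\<Sum>\<alpha> | monomial_degree \<alpha> = d. c i k \<alpha> * of_real (monomial_eval \<alpha> p))"
    by blast
  \<comment> \<open>Zero coefficients outside degree \<open>d\<close> make the support finite and
    confine it to that degree.\<close>
  define P where "P \<alpha> = (if monomial_degree \<alpha> = d then mat nr nc (\<lambda>(i, k). c i k \<alpha>) else 0\<^sub>m nr nc)" for \<alpha>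
  have P: "P \<alpha> \<in> carrier_mat nr nc" for \<alpha> by (simp add: P_def)
  have sub: "support nr nc P \<subseteq> {\<alpha>. monomial_degree \<alpha> = d}" by (auto simp: support_def P_def)
  have ev: "poly_eval nr nc P p $$ (i, k) =
      (\<Sum>\<alpha> | monomial_degree \<alpha> = d. of_real (monomial_eval \<alpha> p) * P \<alpha> $$ (i, k))"
    if "i < nr" "k < nc" for p i k
    by (rule poly_eval_eq_sum[OF P finite_monomial_degree sub that])
  have dim: "poly_eval nr nc P p \<in> carrier_mat nr nc" for p by (simp add: poly_eval_def)
  show ?thesis
  proof (rule that)
    show "is_mat_poly nr nc P"
      unfolding is_mat_poly_def using P finite_subset[OF sub] by simp
    show "poly_eval nr nc P p = F p" for p
    proof (rule eq_matI)
      show "dim_row (poly_eval nr nc P p) = dim_row (F p)" "dim_col (poly_eval nr nc P p) = dim_col (F p)"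
        using hom_poly.mat_family_carrier[OF F, of p] dim[of p] by auto
      fix i k assume "i < dim_row (F p)" "k < dim_col (F p)"
      then have ik: "i < nr" "k < nc" using hom_poly.mat_family_carrier[OF F, of p] by auto
      show "poly_eval nr nc P p $$ (i, k) = F p $$ (i, k)"
        unfolding ev[OF ik] c[OF ik] by (intro sum.cong refl) (use ik in \<open>simp add: P_def\<close>)
    qed
    show "poly_eval nr nc P (- p) = (- 1) ^ d \<cdot>\<^sub>m poly_eval nr nc P p" for p
    proof (rule eq_matI)
      fix i k assume "i < dim_row ((- 1) ^ d \<cdot>\<^sub>m poly_eval nr nc P p)" "k < dim_col ((- 1) ^ d \<cdot>\<^sub>m poly_eval nr nc P p)"
      then have ik: "i < nr" "k < nc" using dim[of p] by auto
      then show "poly_eval nr nc P (- p) $$ (i, k) = ((- 1) ^ d \<cdot>\<^sub>m poly_eval nr nc P p) $$ (i, k)"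
        using dim[of p] by (simp add: ev monomial_eval_minus sum_distrib_left mult.assoc)
    qed (use dim[of p] dim[of "- p"] in auto)
    show "monomial_degree \<alpha> = d" if "\<alpha> \<in> support nr nc P" for \<alpha> using sub that by blast
  qed
qed

text \<open>With integers k = A + B - j and l = C + D - j, the sum 2 A + 2 B + 2 C + 2 D equals 2 (k
  + l + 2 j), and 2 j is an integer.\<close>

lemma admissible_parity:
  assumes "half_int j" "admissible j A B" "admissible j C D"
  shows "even (twice A + twice B + twice C + twice D)"
proof -
  obtain k l :: int where "A + B - j = of_int k" "C + D - j = of_int l"
    using assms unfolding admissible_def by (auto elim!: Ints_cases)
  then have "real (twice A + twice B + twice C + twice D) = of_int (2 * (k + l + int (twice j)))"
    using assms by (simp add: twice admissible_def)
  then have "int (twice A + twice B + twice C + twice D) = 2 * (k + l + int (twice j))"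
    by (metis of_int_eq_iff of_int_of_nat_eq)
  then show ?thesis by (metis even_of_nat dvd_triv_left)
qed

lemma twisted_poly_exists:
  assumes m: "m > 0" and j: "half_int j" and cs: "coefficient_system j u v"
    and AB: "admissible j A B" and CD: "admissible j C D"
  shows "\<exists>P. is_twisted_poly m u A B C D P"
proof -
  let ?nr = "AB_dim A B" and ?nc = "AB_dim C D"
  let ?Q = "u A B * mat_adjoint (u C D)"
  define X where "X p = complex_of_real (1 / m) \<cdot>\<^sub>m Xmat p" for p
  define X' where "X' p = complex_of_real (1 / m) \<cdot>\<^sub>m Xmat (- fst p, snd p)" for p
  have X: "hom_poly.mat_family 2 2 1 X" and X': "hom_poly.mat_family 2 2 1 X'"
    using hom_poly_smult_mat[OF hom_poly_Xmat] hom_poly_smult_mat[OF hom_poly_Xmat_parity]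
    unfolding X_def X'_def by blast+
  have L2: "boost_mat m p * boost_mat m p = X (on_shell m p)"
    "boost_mat m (- p) * boost_mat m (- p) = X' (on_shell m p)" for p
    by (simp_all add: boost_mat_sq[OF m] X_def X'_def on_shell_def)
  have h: "half_int A" "half_int B" "half_int C" "half_int D"
    using AB CD by (auto simp: admissible_def)
  note t = h[THEN twice]
  have u: "u A B \<in> carrier_mat (AB_dim A B) (twice j + 1)" "u C D \<in> carrier_mat (AB_dim C D) (twice j + 1)"
    using cs AB CD unfolding coefficient_system_def by blast+
  then have Q: "hom_poly.mat_family ?nr ?nc 0 (\<lambda>_. ?Q)"
    by (intro hom_poly.mat_family_const) simp
  have one: "hom_poly.mat_family (Suc n) (Suc n) 0 (\<lambda>_. 1\<^sub>m (Suc n))" for n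
    by (intro hom_poly.mat_family_const) simp
  have spin: "hom_poly.mat_family (Suc (twice s)) (Suc (twice s)) (twice s) (\<lambda>p. spin_rep s (M p))"
    if "hom_poly.mat_family 2 2 1 M" for M s
    using hom_poly.mat_family_spin_rep[OF that, of s] by simp
  have dim: "AB_dim A B = Suc (twice A) * Suc (twice B)" for A B by (simp add: AB_dim_def)
  \<comment> \<open>Eliminating j from A - B \<le> j \<le> C + D and its variants bounds |A - C| by
    B + D and |B - D| by A + C. Hence the lower bound on d / 2 never exceeds the upper one, and a
    polynomial homogeneous of the largest permitted degree meets both.\<close>
  have ineq: "A - C \<le> B + D" "C - A \<le> B + D" "B - D \<le> A + C" "D - B \<le> A + C"
      "0 \<le> A" "0 \<le> B" "0 \<le> C" "0 \<le> D"
    using AB CD t by (auto simp: admissible_def)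
  have finish: "\<exists>P. is_twisted_poly m u A B C D P"
    if F: "hom_poly.mat_family ?nr ?nc d F"
      and shell: "\<And>p. twisted_spin_sum m u A B C D (on_shell m p) = F (on_shell m p)"
      and d: "even d = even (twice A + twice C)" "real d / 2 = min (A + C) (B + D)" for d F
  proof -
    obtain P where P: "is_mat_poly ?nr ?nc P" "\<And>p. poly_eval ?nr ?nc P p = F p"
      "\<And>p. poly_eval ?nr ?nc P (- p) = (- 1) ^ d \<cdot>\<^sub>m poly_eval ?nr ?nc P p"
      "\<And>\<alpha>. \<alpha> \<in> support ?nr ?nc P \<Longrightarrow> monomial_degree \<alpha> = d"
      using hom_poly_mat_poly[OF F] by metis
    have "(- 1 :: complex) ^ d = (- 1) ^ (twice A + twice C)"
      using d(1) by (metis neg_one_even_power neg_one_odd_power)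
    then have "is_twisted_poly m u A B C D P"
      unfolding is_twisted_poly_def Let_def using P shell d(2) ineq by (auto simp: min_def)
    then show ?thesis by blast
  qed
  show ?thesis
  proof (cases "A + C \<le> B + D")
    case True
    let ?F = "\<lambda>p. kron (spin_rep A (X p)) (1\<^sub>m (Suc (twice B))) * ?Q *
        kron (spin_rep C (X' p)) (1\<^sub>m (Suc (twice D)))"
    show ?thesis
    proof (rule finish)
      show "hom_poly.mat_family ?nr ?nc (twice A + twice C) ?F"
        using hom_poly.mat_family_mult[OF hom_poly.mat_family_mult[OF
            hom_poly.mat_family_kron[OF spin[OF X, of A] one[of "twice B"], folded dim] Q]
            hom_poly.mat_family_kron[OF spin[OF X', of C] one[of "twice D"], folded dim]] by simp
      show "twisted_spin_sum m u A B C D (on_shell m p) = ?F (on_shell m p)" for p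
        unfolding twisted_spin_sum_eq(1)[OF m cs AB CD] L2[of p] ..
    qed (use True t in auto)
  next
    case False
    let ?F = "\<lambda>p. kron (1\<^sub>m (Suc (twice A))) (spin_rep B (X' p)) * ?Q *
        kron (1\<^sub>m (Suc (twice C))) (spin_rep D (X p))"
    show ?thesis
    proof (rule finish)
      show "hom_poly.mat_family ?nr ?nc (twice B + twice D) ?F"
        using hom_poly.mat_family_mult[OF hom_poly.mat_family_mult[OF
            hom_poly.mat_family_kron[OF one[of "twice A"] spin[OF X', of B], folded dim] Q]
            hom_poly.mat_family_kron[OF one[of "twice C"] spin[OF X, of D], folded dim]] by simp
      show "twisted_spin_sum m u A B C D (on_shell m p) = ?F (on_shell m p)" for p
        unfolding twisted_spin_sum_eq(2)[OF m cs AB CD] L2[of p] ..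
      \<comment> \<open>The required parity is stated through A and C, while this polynomial has
        degree 2 B + 2 D; the two exponents agree modulo 2.\<close>
      show "even (twice B + twice D) = even (twice A + twice C)"
        using admissible_parity[OF j AB CD] by auto
    qed (use False t in auto)
  qed
qed

section \<open>Rapidly decreasing functions\<close>

text \<open>Two powers per dimension suffice: (1 + |p|)^2 dominates 1 + p_b^2 for each coordinate,
  so the function is bounded by a product of one-variable functions 1 / (1 + x^2), each integrable.
  The extra \<open>N\<close> powers accommodate stronger weights.\<close>

lemma integrable_inverse_power_norm:
  "integrable lborel (\<lambda>p::'a::euclidean_space. inverse ((1 + norm p) ^ (2 * DIM('a) + N)))"
proof (rule integrableI_bounded)
  let ?f = "\<lambda>x::real. ennreal (inverse (1 + x\<^sup>2))"
  have "integrable lborel (\<lambda>x::real. inverse (1 + x\<^sup>2))"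
    using integrable_inverse_1_plus_square by (simp add: set_integrable_def einterval_def)
  then have fin: "(\<integral>\<^sup>+x. ?f x \<partial>lborel) < \<infinity>"
    by (simp add: integrable_iff_bounded)
  have "(\<integral>\<^sup>+p. ennreal (norm (inverse ((1 + norm (p::'a)) ^ (2 * DIM('a) + N)))) \<partial>lborel)
      \<le> (\<integral>\<^sup>+p. (\<Prod>b\<in>(Basis::'a set). ?f (p \<bullet> b)) \<partial>lborel)"
  proof (rule nn_integral_mono)
    fix p :: 'a
    have pos: "0 < 1 + norm p" by (simp add: add_pos_nonneg)
    have "inverse ((1 + norm p) ^ (2 * DIM('a) + N)) \<le> inverse ((1 + norm p) ^ (2 * DIM('a)))"
      by (intro le_imp_inverse_le power_increasing) (use pos in auto)
    also have "\<dots> = (\<Prod>b\<in>(Basis::'a set). inverse ((1 + norm p)\<^sup>2))"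
      by (simp add: power_mult power_inverse)
    also have "\<dots> \<le> (\<Prod>b\<in>Basis. inverse (1 + (p \<bullet> b)\<^sup>2))"
    proof (rule prod_mono, intro conjI le_imp_inverse_le)
      fix b :: 'a assume "b \<in> Basis"
      then have "\<bar>p \<bullet> b\<bar>\<^sup>2 \<le> (norm p)\<^sup>2" by (intro power_mono Basis_le_norm) auto
      then show "1 + (p \<bullet> b)\<^sup>2 \<le> (1 + norm p)\<^sup>2" by (simp add: power2_sum add_increasing2)
    qed (auto intro: add_pos_nonneg)
    finally have "inverse ((1 + norm p) ^ (2 * DIM('a) + N)) \<le> (\<Prod>b\<in>Basis. inverse (1 + (p \<bullet> b)\<^sup>2))" .
    then show "ennreal (norm (inverse ((1 + norm p) ^ (2 * DIM('a) + N)))) \<le> (\<Prod>b\<in>Basis. ?f (p \<bullet> b))"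
      by (subst prod_ennreal) (auto intro!: ennreal_leI)
  qed
  also have "\<dots> = (\<Prod>b\<in>(Basis::'a set). \<integral>\<^sup>+x. ?f x \<partial>lborel)"
    by (rule nn_integral_lborel_prod) auto
  also have "\<dots> < \<infinity>"
    using fin by (simp add: power_less_top_ennreal)
  finally show "(\<integral>\<^sup>+p. ennreal (norm (inverse ((1 + norm (p::'a)) ^ (2 * DIM('a) + N)))) \<partial>lborel) < \<infinity>" .
qed simp

definition moderate :: "(real^3 \<Rightarrow> complex) set" where
  "moderate = {f. f \<in> borel_measurable borel \<and> (\<exists>K N. \<forall>p. norm (f p) \<le> K * (1 + norm p) ^ N)}"

text \<open>Decay is imposed on the values alone, because derivatives are taken in the spacetime
  point and only multiply the amplitude by polynomials in momentum and energy.\<close>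

definition rapid :: "(real^3 \<Rightarrow> complex) set" where
  "rapid = {f. f \<in> borel_measurable borel \<and> (\<forall>N. \<exists>K. \<forall>p. (1 + norm p) ^ N * norm (f p) \<le> K)}"

lemma moderateI:
  "f \<in> borel_measurable borel \<Longrightarrow> (\<And>p. norm (f p) \<le> K * (1 + norm p) ^ N) \<Longrightarrow> f \<in> moderate"
  unfolding moderate_def by blast

lemma moderateE:
  assumes "f \<in> moderate"
  obtains K N where "f \<in> borel_measurable borel" "K \<ge> 0" "\<And>p. norm (f p) \<le> K * (1 + norm p) ^ N"
proof -
  obtain K N where *: "f \<in> borel_measurable borel" "\<And>p. norm (f p) \<le> K * (1 + norm p) ^ N"
    using assms unfolding moderate_def by blast
  have "K \<ge> 0" using *(2)[of 0] by (simp add: order_trans[OF norm_ge_zero])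
  then show ?thesis using * that by blast
qed

interpretation moderate: graded_functions "\<lambda>_. moderate"
proof
  show "(\<lambda>_. c) \<in> moderate" for c
    by (rule moderateI[of _ "norm c" 0]) auto
  then show "(\<lambda>_. 0) \<in> moderate" .
  fix f g assume "f \<in> moderate" "g \<in> moderate"
  obtain K N where f: "f \<in> borel_measurable borel" "K \<ge> 0" "\<And>p. norm (f p) \<le> K * (1 + norm p) ^ N"
    using moderateE[OF \<open>f \<in> moderate\<close>] by metis
  obtain K' N' where g: "g \<in> borel_measurable borel" "K' \<ge> 0" "\<And>p. norm (g p) \<le> K' * (1 + norm p) ^ N'"
    using moderateE[OF \<open>g \<in> moderate\<close>] by metis
  show "(\<lambda>p. f p + g p) \<in> moderate"
  proof (rule moderateI[of _ "K + K'" "N + N'"])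
    fix p :: "real^3"
    have "norm (f p + g p) \<le> K * (1 + norm p) ^ N + K' * (1 + norm p) ^ N'"
      using f(3)[of p] g(3)[of p] norm_triangle_ineq[of "f p" "g p"] by linarith
    also have "\<dots> \<le> K * (1 + norm p) ^ (N + N') + K' * (1 + norm p) ^ (N + N')"
      using f(2) g(2) by (intro add_mono mult_left_mono power_increasing) auto
    finally show "norm (f p + g p) \<le> (K + K') * (1 + norm p) ^ (N + N')"
      by (simp add: distrib_right)
  qed (use f g in auto)
  show "(\<lambda>p. f p * g p) \<in> moderate"
  proof (rule moderateI[of _ "K * K'" "N + N'"])
    fix p :: "real^3"
    have "norm (f p * g p) \<le> (K * (1 + norm p) ^ N) * (K' * (1 + norm p) ^ N')"
      unfolding norm_mult using f g by (intro mult_mono) auto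
    then show "norm (f p * g p) \<le> K * K' * (1 + norm p) ^ (N + N')"
      by (simp add: power_add mult_ac)
  qed (use f g in auto)
qed

lemma rapidI:
  "f \<in> borel_measurable borel \<Longrightarrow> (\<And>N. \<exists>K. \<forall>p. (1 + norm p) ^ N * norm (f p) \<le> K) \<Longrightarrow> f \<in> rapid"
  unfolding rapid_def by blast

lemma rapid_zero: "(\<lambda>_. 0) \<in> rapid"
  by (auto intro!: rapidI)

lemma rapid_add: assumes "f \<in> rapid" "g \<in> rapid" shows "(\<lambda>p. f p + g p) \<in> rapid"
proof (rule rapidI)
  fix N
  obtain K K' where *: "\<And>p. (1 + norm p) ^ N * norm (f p) \<le> K" "\<And>p. (1 + norm p) ^ N * norm (g p) \<le> K'"
    using assms unfolding rapid_def by blast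
  have "(1 + norm p) ^ N * norm (f p + g p) \<le> K + K'" for p
  proof -
    have "(1 + norm p) ^ N * norm (f p + g p) \<le> (1 + norm p) ^ N * (norm (f p) + norm (g p))"
      by (intro mult_left_mono norm_triangle_ineq) auto
    then show ?thesis using *[of p] by (simp add: distrib_left)
  qed
  then show "\<exists>K. \<forall>p. (1 + norm p) ^ N * norm (f p + g p) \<le> K" by blast
qed (use assms in \<open>auto simp: rapid_def\<close>)

lemma rapid_mult: assumes "f \<in> moderate" "g \<in> rapid" shows "(\<lambda>p. f p * g p) \<in> rapid"
proof (rule rapidI)
  fix N
  obtain K M where f: "K \<ge> 0" "\<And>p. norm (f p) \<le> K * (1 + norm p) ^ M"
    using moderateE[OF assms(1)] by metis
  obtain K' where g: "\<And>p. (1 + norm p) ^ (N + M) * norm (g p) \<le> K'"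
    using assms(2) unfolding rapid_def by blast
  have "(1 + norm p) ^ N * norm (f p * g p) \<le> K * K'" for p
  proof -
    have "(1 + norm p) ^ N * norm (f p * g p) \<le> (1 + norm p) ^ N * ((K * (1 + norm p) ^ M) * norm (g p))"
      unfolding norm_mult by (intro mult_left_mono mult_right_mono f) auto
    also have "\<dots> = K * ((1 + norm p) ^ (N + M) * norm (g p))" by (simp add: power_add mult_ac)
    also have "\<dots> \<le> K * K'" by (intro mult_left_mono f g)
    finally show ?thesis .
  qed
  then show "\<exists>K. \<forall>p. (1 + norm p) ^ N * norm (f p * g p) \<le> K" by blast
qed (use assms in \<open>auto simp: rapid_def moderate_def\<close>)

lemma rapid_cmult: "f \<in> rapid \<Longrightarrow> (\<lambda>p. c * f p) \<in> rapid"
  by (rule rapid_mult[OF moderate.const])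

lemma rapid_sum: "(\<And>i. i \<in> I \<Longrightarrow> f i \<in> rapid) \<Longrightarrow> (\<lambda>p. \<Sum>i\<in>I. f i p) \<in> rapid"
  by (induction I rule: infinite_finite_induct) (auto intro: rapid_zero rapid_add)

lemma rapid_integrable: assumes "f \<in> rapid" shows "integrable lborel f"
proof -
  obtain K where K: "\<And>p. (1 + norm p) ^ (2 * DIM(real^3) + 0) * norm (f p) \<le> K"
    using assms unfolding rapid_def by blast
  show ?thesis
  proof (rule Bochner_Integration.integrable_bound)
    show "integrable lborel (\<lambda>p::real^3. K * inverse ((1 + norm p) ^ (2 * DIM(real^3) + 0)))"
      using integrable_inverse_power_norm[where N = 0 and 'a = "real^3"] by (intro integrable_mult_right) simp
    show "AE p in lborel. norm (f p) \<le> norm (K * inverse ((1 + norm p) ^ (2 * DIM(real^3) + 0)))"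
    proof (rule AE_I2)
      fix p :: "real^3"
      have "(1 + norm p) ^ (2 * DIM(real^3) + 0) > 0" by (intro zero_less_power) (simp add: add_pos_nonneg)
      then have "norm (f p) \<le> K * inverse ((1 + norm p) ^ (2 * DIM(real^3) + 0))"
        using K[of p] by (simp add: field_simps)
      then show "norm (f p) \<le> norm (K * inverse ((1 + norm p) ^ (2 * DIM(real^3) + 0)))"
        unfolding real_norm_def by linarith
    qed
  qed (use assms in \<open>simp add: rapid_def\<close>)
qed

section \<open>Wave packets\<close>

lemma continuous_on_energy [continuous_intros]: "continuous_on UNIV (energy m)"
  unfolding energy_def by (intro continuous_intros)

lemma continuous_on_mdot [continuous_intros]: "continuous_on UNIV (\<lambda>p. mdot (on_shell m p) x)"
  unfolding mdot_def on_shell_def by (simp, intro continuous_intros)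

lemma energy_le: "energy m p \<le> \<bar>m\<bar> + norm p"
  unfolding energy_def by (rule real_le_lsqrt) (simp_all add: power2_sum)

lemma moderate_component: "(\<lambda>p. complex_of_real (vec_nth p i)) \<in> moderate"
proof (rule moderateI[of _ 1 1])
  show "(\<lambda>p. complex_of_real (vec_nth p i)) \<in> borel_measurable borel"
    by (intro borel_measurable_continuous_onI continuous_intros)
  show "norm (complex_of_real (vec_nth p i)) \<le> 1 * (1 + norm p) ^ 1" for p :: "real^3"
    using component_le_norm_cart[of p i] by simp
qed

lemma moderate_energy: "(\<lambda>p. complex_of_real (energy m p)) \<in> moderate"
proof (rule moderateI[of _ "\<bar>m\<bar> + 1" 1])
  show "(\<lambda>p. complex_of_real (energy m p)) \<in> borel_measurable borel"
    by (intro borel_measurable_continuous_onI continuous_intros)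
  show "norm (complex_of_real (energy m p)) \<le> (\<bar>m\<bar> + 1) * (1 + norm p) ^ 1" for p :: "real^3"
  proof -
    have "(\<bar>m\<bar> + 1) * (1 + norm p) ^ 1 = \<bar>m\<bar> + norm p + (1 + \<bar>m\<bar> * norm p)"
      by (simp add: algebra_simps)
    moreover have "0 \<le> \<bar>m\<bar> * norm p" by simp
    moreover have "norm (complex_of_real (energy m p)) = energy m p"
      using energy_ge(1)[of m p] by simp
    ultimately show ?thesis using energy_le[of m p] by linarith
  qed
qed

lemma moderate_mdot: "(\<lambda>p. complex_of_real (mdot (on_shell m p) x)) \<in> moderate"
proof -
  have "complex_of_real (mdot (on_shell m p) x) =
      (\<Sum>i\<in>UNIV. of_real (vec_nth (fst x) i) * of_real (vec_nth p i)) + of_real (- snd x) * of_real (energy m p)" for p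
    by (simp add: mdot_def on_shell_def inner_vec_def mult.commute)
  then show ?thesis
    by (auto intro!: moderate.add moderate.sum moderate.cmult moderate_component moderate_energy
        simp del: of_real_minus)
qed

lemma moderate_exp: "(\<lambda>p. exp (\<i> * complex_of_real (mdot (on_shell m p) x))) \<in> moderate"
  "(\<lambda>p. exp (- \<i> * complex_of_real (mdot (on_shell m p) x))) \<in> moderate"
  by (rule moderateI[of _ 1 0]; (intro borel_measurable_continuous_onI continuous_intros)?; simp)+

text \<open>The common shape of all matrix elements of fields: positive frequencies with amplitude
  \<open>a\<close>, negative ones with amplitude \<open>b\<close>. For rapidly decreasing amplitudes
  the differential operators act by multiplying them, so no further integrals have to be
  differentiated.\<close>

definition wave :: "real \<Rightarrow> (real^3 \<Rightarrow> complex) \<Rightarrow> (real^3 \<Rightarrow> complex) \<Rightarrow> fourvec \<Rightarrow> complex" where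
  "wave m a b x = (LINT p|lborel. exp (\<i> * complex_of_real (mdot (on_shell m p) x)) * a p
     + exp (- \<i> * complex_of_real (mdot (on_shell m p) x)) * b p)"

lemma wave_integrable:
  assumes "a \<in> rapid" "b \<in> rapid"
  shows "integrable lborel (\<lambda>p. exp (\<i> * complex_of_real (mdot (on_shell m p) x)) * a p
     + exp (- \<i> * complex_of_real (mdot (on_shell m p) x)) * b p)"
  by (intro rapid_integrable rapid_add rapid_mult moderate_exp assms)

lemma wave_add:
  assumes "a \<in> rapid" "b \<in> rapid" "a' \<in> rapid" "b' \<in> rapid"
  shows "wave m a b x + wave m a' b' x = wave m (\<lambda>p. a p + a' p) (\<lambda>p. b p + b' p) x"
  unfolding wave_def
    Bochner_Integration.integral_add[OF wave_integrable[OF assms(1,2)] wave_integrable[OF assms(3,4)], symmetric]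
  by (intro Bochner_Integration.integral_cong) (auto simp: algebra_simps)

lemma wave_cmult: "c * wave m a b x = wave m (\<lambda>p. c * a p) (\<lambda>p. c * b p) x"
  unfolding wave_def integral_mult_right_zero[symmetric]
  by (intro Bochner_Integration.integral_cong) (auto simp: algebra_simps)

lemma wave_sum:
  assumes "\<And>i. i \<in> I \<Longrightarrow> a i \<in> rapid" "\<And>i. i \<in> I \<Longrightarrow> b i \<in> rapid"
  shows "(\<Sum>i\<in>I. wave m (a i) (b i) x) = wave m (\<lambda>p. \<Sum>i\<in>I. a i p) (\<lambda>p. \<Sum>i\<in>I. b i p) x"
  using assms
proof (induction I rule: infinite_finite_induct)
  case (insert i I)
  then show ?case by (simp add: wave_add rapid_sum)
qed (simp_all add: wave_def)

lemma norm_exp_imaginary_approx: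
  "norm (exp (\<i> * complex_of_real y) - 1 - \<i> * complex_of_real y) \<le> y\<^sup>2 / 2"
  using iexp_approx1[of y 1] by (simp add: numeral_2_eq_2 diff_diff_add)

text \<open>Differentiation under the integral by a second-order Taylor bound, integrable against
  rapidly decreasing functions.\<close>

lemma partial_wave:
  assumes a: "a \<in> rapid" and b: "b \<in> rapid"
  shows "partial e (wave m a b) = wave m (\<lambda>p. \<i> * complex_of_real (mdot (on_shell m p) e) * a p)
      (\<lambda>p. - \<i> * complex_of_real (mdot (on_shell m p) e) * b p)"
proof
  fix x
  define \<theta> where "\<theta> p = mdot (on_shell m p) e" for p
  define \<phi> where "\<phi> p = mdot (on_shell m p) x" for p
  define D where "D = wave m (\<lambda>p. \<i> * complex_of_real (\<theta> p) * a p) (\<lambda>p. - \<i> * complex_of_real (\<theta> p) * b p) x"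
  \<comment> \<open>The bound y^2 / 2 on the Taylor remainder of exp (i y), taken at y = t
    \<open>\<theta>\<close>, gives t^2 times this function as a bound for the error of the
    integrand.\<close>
  define g where "g p = (\<theta> p)\<^sup>2 / 2 * (norm (a p) + norm (b p))" for p
  have th: "(\<lambda>p. complex_of_real (\<theta> p)) \<in> moderate" unfolding \<theta>_def by (rule moderate_mdot)
  have a': "(\<lambda>p. \<i> * complex_of_real (\<theta> p) * a p) \<in> rapid"
    by (intro rapid_mult moderate.cmult th a)
  have b': "(\<lambda>p. - \<i> * complex_of_real (\<theta> p) * b p) \<in> rapid"
    by (intro rapid_mult moderate.cmult th b)
  have th2: "(\<lambda>p. of_real (\<theta> p) * of_real (\<theta> p) * f p) \<in> rapid" if "f \<in> rapid" for f
    by (intro rapid_mult moderate.mult th that)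
  have g_eq: "g = (\<lambda>p. (norm (of_real (\<theta> p) * of_real (\<theta> p) * a p) + norm (of_real (\<theta> p) * of_real (\<theta> p) * b p)) / 2)"
    by (simp add: g_def fun_eq_iff norm_mult power2_eq_square algebra_simps abs_mult_self_eq)
  have g: "integrable lborel g"
    unfolding g_eq using th2[OF a] th2[OF b]
    by (intro Bochner_Integration.integrable_divide Bochner_Integration.integrable_add integrable_norm rapid_integrable)
  have shift: "mdot (on_shell m p) (x + t *\<^sub>R e) = \<phi> p + t * \<theta> p" for p t
    by (simp add: mdot_def \<phi>_def \<theta>_def inner_add_right algebra_simps)
  have bound: "norm (wave m a b (x + t *\<^sub>R e) - wave m a b x - t *\<^sub>R D) \<le> integral\<^sup>L lborel g * t\<^sup>2" for t
  proof -
    define R where "R y = exp (\<i> * complex_of_real y) - 1 - \<i> * complex_of_real y" for y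
    have "wave m a b (x + t *\<^sub>R e) - wave m a b x - t *\<^sub>R D =
       wave m a b (x + t *\<^sub>R e) - (wave m a b x + of_real t * D)"
      by (simp add: scaleR_conv_of_real)
    also have "\<dots> = (LINT p|lborel. exp (\<i> * of_real (\<phi> p)) * R (t * \<theta> p) * a p
        + exp (- \<i> * of_real (\<phi> p)) * R (- (t * \<theta> p)) * b p)"
    proof -
      have "wave m a b x + of_real t * D =
          wave m (\<lambda>p. a p + of_real t * (\<i> * of_real (\<theta> p) * a p)) (\<lambda>p. b p + of_real t * (- \<i> * of_real (\<theta> p) * b p)) x"
        unfolding D_def wave_cmult by (intro wave_add a b rapid_cmult a' b')
      then have "wave m a b (x + t *\<^sub>R e) - (wave m a b x + of_real t * D) =
        (LINT p|lborel. (exp (\<i> * of_real (mdot (on_shell m p) (x + t *\<^sub>R e))) * a p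
            + exp (- \<i> * of_real (mdot (on_shell m p) (x + t *\<^sub>R e))) * b p) -
          (exp (\<i> * of_real (mdot (on_shell m p) x)) * (a p + of_real t * (\<i> * of_real (\<theta> p) * a p))
           + exp (- \<i> * of_real (mdot (on_shell m p) x)) * (b p + of_real t * (- \<i> * of_real (\<theta> p) * b p))))"
        unfolding wave_def
        by (simp only:) (intro Bochner_Integration.integral_diff[symmetric] wave_integrable a b rapid_add rapid_cmult a' b')
      also have "\<dots> = (LINT p|lborel. exp (\<i> * of_real (\<phi> p)) * R (t * \<theta> p) * a p
        + exp (- \<i> * of_real (\<phi> p)) * R (- (t * \<theta> p)) * b p)"
      proof (rule Bochner_Integration.integral_cong[OF refl])
        fix p
        have "exp (\<i> * of_real (\<phi> p + t * \<theta> p)) = exp (\<i> * of_real (\<phi> p)) * exp (\<i> * of_real (t * \<theta> p))"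
          "exp (- \<i> * of_real (\<phi> p + t * \<theta> p)) = exp (- \<i> * of_real (\<phi> p)) * exp (\<i> * of_real (- (t * \<theta> p)))"
          by (simp_all add: exp_add[symmetric] algebra_simps)
        then show "(exp (\<i> * of_real (mdot (on_shell m p) (x + t *\<^sub>R e))) * a p
            + exp (- \<i> * of_real (mdot (on_shell m p) (x + t *\<^sub>R e))) * b p) -
          (exp (\<i> * of_real (mdot (on_shell m p) x)) * (a p + of_real t * (\<i> * of_real (\<theta> p) * a p))
           + exp (- \<i> * of_real (mdot (on_shell m p) x)) * (b p + of_real t * (- \<i> * of_real (\<theta> p) * b p))) =
          exp (\<i> * of_real (\<phi> p)) * R (t * \<theta> p) * a p
            + exp (- \<i> * of_real (\<phi> p)) * R (- (t * \<theta> p)) * b p"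
          unfolding shift \<phi>_def[symmetric] by (simp add: R_def algebra_simps)
      qed
      finally show ?thesis .
    qed
    also have "norm \<dots> \<le> (LINT p|lborel. t\<^sup>2 * g p)"
    proof (rule Bochner_Integration.integral_norm_bound_integral)
      have R: "norm (exp (z * of_real (\<phi> p)) * R y * f) \<le> y\<^sup>2 / 2 * norm f"
        if "z = \<i> \<or> z = - \<i>" for z p y f
      proof -
        have n1: "norm (exp (z * complex_of_real (\<phi> p))) = 1" using that by auto
        show ?thesis
          using mult_right_mono[OF norm_exp_imaginary_approx[of y] norm_ge_zero[of f]]
          unfolding norm_mult n1 R_def by (simp only: mult_1_left)
      qed
      show "norm (exp (\<i> * of_real (\<phi> p)) * R (t * \<theta> p) * a p
          + exp (- \<i> * of_real (\<phi> p)) * R (- (t * \<theta> p)) * b p) \<le> t\<^sup>2 * g p" for p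
        using R[of "\<i>" p "t * \<theta> p" "a p"] R[of "- \<i>" p "- (t * \<theta> p)" "b p"]
        by (intro norm_triangle_le) (simp add: g_def power_mult_distrib algebra_simps)
      have Rm: "(\<lambda>p. R (c * \<theta> p)) \<in> moderate" for c
      proof -
        have "R (c * \<theta> p) = exp (\<i> * of_real (mdot (on_shell m p) (c *\<^sub>R e))) + ((-1) + (- \<i> * of_real c) * of_real (\<theta> p))" for p
          by (simp add: R_def \<theta>_def mdot_def algebra_simps)
        then show ?thesis
          by (simp only:) (intro moderate.add moderate.cmult th moderate.const moderate_exp)
      qed
      show "integrable lborel (\<lambda>p. exp (\<i> * of_real (\<phi> p)) * R (t * \<theta> p) * a p
          + exp (- \<i> * of_real (\<phi> p)) * R (- (t * \<theta> p)) * b p)"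
        using Rm[of t] Rm[of "- t"] unfolding \<phi>_def
        by (intro rapid_integrable rapid_add rapid_mult moderate.mult moderate_exp a b) simp_all
    qed (use g in simp)
    also have "\<dots> = integral\<^sup>L lborel g * t\<^sup>2" by simp
    finally show ?thesis .
  qed
  \<comment> \<open>The error is at most a constant times t^2, so the difference quotient differs
    from \<open>D\<close> by at most that constant times |t|.\<close>
  have "((\<lambda>t. wave m a b (x + t *\<^sub>R e)) has_vector_derivative D) (at 0)"
    unfolding has_vector_derivative_def
  proof (rule has_derivativeI_sandwich[of 1 _ _ _ _ "\<lambda>t. integral\<^sup>L lborel g * \<bar>t\<bar>"])
    show "bounded_linear (\<lambda>t. t *\<^sub>R D)" by (rule bounded_linear_scaleR_left)
    show "((\<lambda>t. integral\<^sup>L lborel g * \<bar>t\<bar>) \<longlongrightarrow> 0) (at (0::real))"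
      by (auto intro!: tendsto_eq_intros)
    fix t :: real assume "t \<noteq> 0"
    then show "norm (wave m a b (x + t *\<^sub>R e) - wave m a b (x + 0 *\<^sub>R e) - (t - 0) *\<^sub>R D) / norm (t - 0)
        \<le> integral\<^sup>L lborel g * \<bar>t\<bar>"
      using bound[of t] by (simp add: divide_le_eq power2_eq_square mult.assoc)
  qed simp
  then show "partial e (wave m a b) x = wave m (\<lambda>p. \<i> * complex_of_real (mdot (on_shell m p) e) * a p)
      (\<lambda>p. - \<i> * complex_of_real (mdot (on_shell m p) e) * b p) x"
    unfolding partial_def D_def \<theta>_def by (rule vector_derivative_at)
qed

lemma mdot_axis: "mdot p (axis i 1, 0) = vec_nth (fst p) i" "mdot p (0, 1) = - snd p"
  by (simp_all add: mdot_def inner_axis)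

lemma momentum_op_wave:
  assumes "a \<in> rapid" "b \<in> rapid"
  shows "momentum_op i (wave m a b) = wave m (\<lambda>p. of_real (vec_nth p i) * a p) (\<lambda>p. of_real (- vec_nth p i) * b p)"
  unfolding momentum_op_def partial_wave[OF assms] wave_cmult
  by (simp add: mdot_axis on_shell_def mult.assoc[symmetric])

text \<open>The pairing with the time axis is -E, so the derivative of the positive-frequency
  exponential gives -i E, and the factor i of \<open>energy_op\<close> turns this into E.\<close>

lemma energy_op_wave:
  assumes "a \<in> rapid" "b \<in> rapid"
  shows "energy_op (wave m a b) = wave m (\<lambda>p. of_real (energy m p) * a p) (\<lambda>p. of_real (- energy m p) * b p)"
  unfolding energy_op_def partial_wave[OF assms] wave_cmult
  by (simp add: mdot_axis on_shell_def mult.assoc[symmetric])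

text \<open>Rapid decrease of the new amplitudes is part of the conclusion because \<open>op\<close>
  applies only to such amplitudes; this keeps the induction going and allows chaining over several
  variables.\<close>

lemma funpow_wave:
  assumes op: "\<And>a b. a \<in> rapid \<Longrightarrow> b \<in> rapid \<Longrightarrow>
      D (wave m a b) = wave m (\<lambda>p. of_real (k p) * a p) (\<lambda>p. of_real (- k p) * b p)"
    and k: "(\<lambda>p. complex_of_real (k p)) \<in> moderate" and ab: "a \<in> rapid" "b \<in> rapid"
  shows "(\<lambda>p. of_real (k p ^ n) * a p) \<in> rapid \<and> (\<lambda>p. of_real ((- k p) ^ n) * b p) \<in> rapid \<and>
    (D ^^ n) (wave m a b) = wave m (\<lambda>p. of_real (k p ^ n) * a p) (\<lambda>p. of_real ((- k p) ^ n) * b p)"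
proof (induction n)
  case 0
  then show ?case using ab by simp
next
  case (Suc n)
  have k': "(\<lambda>p. complex_of_real (- k p)) \<in> moderate"
    using moderate.cmult[OF k, of "- 1"] by simp
  from Suc have ih: "(\<lambda>p. of_real (k p ^ n) * a p) \<in> rapid" "(\<lambda>p. of_real ((- k p) ^ n) * b p) \<in> rapid"
    by blast+
  note rapid_mult[OF k ih(1)] rapid_mult[OF k' ih(2)]
  moreover have "(D ^^ Suc n) (wave m a b) = wave m (\<lambda>p. of_real (k p) * (of_real (k p ^ n) * a p))
      (\<lambda>p. of_real (- k p) * (of_real ((- k p) ^ n) * b p))"
    using Suc op[OF ih] by simp
  ultimately show ?case by (simp only: power_Suc of_real_mult mult.assoc)
qed

text \<open>Each operator reverses its sign on the negative frequencies, so there the monomial is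
  evaluated at the negative of the whole 4-vector, energy included.\<close>

lemma monomial_op_wave:
  assumes ab: "a \<in> rapid" "b \<in> rapid"
  shows "(\<lambda>p. of_real (monomial_eval \<alpha> (on_shell m p)) * a p) \<in> rapid \<and>
    (\<lambda>p. of_real (monomial_eval \<alpha> (- on_shell m p)) * b p) \<in> rapid \<and>
    monomial_op \<alpha> (wave m a b) = wave m (\<lambda>p. of_real (monomial_eval \<alpha> (on_shell m p)) * a p)
      (\<lambda>p. of_real (monomial_eval \<alpha> (- on_shell m p)) * b p)"
proof -
  obtain a1 a2 a3 a0 where \<alpha>: "\<alpha> = (a1, a2, a3, a0)" by (cases \<alpha>)
  have P: "(\<lambda>p. of_real (vec_nth p i ^ n) * a p) \<in> rapid \<and> (\<lambda>p. of_real ((- vec_nth p i) ^ n) * b p) \<in> rapid \<and>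
    (momentum_op i ^^ n) (wave m a b) =
      wave m (\<lambda>p. of_real (vec_nth p i ^ n) * a p) (\<lambda>p. of_real ((- vec_nth p i) ^ n) * b p)"
    if "a \<in> rapid" "b \<in> rapid" for i n a b
    using that by (intro funpow_wave momentum_op_wave moderate_component)
  have 0: "(\<lambda>p. of_real (energy m p ^ a0) * a p) \<in> rapid \<and> (\<lambda>p. of_real ((- energy m p) ^ a0) * b p) \<in> rapid \<and>
    (energy_op ^^ a0) (wave m a b) =
      wave m (\<lambda>p. of_real (energy m p ^ a0) * a p) (\<lambda>p. of_real ((- energy m p) ^ a0) * b p)"
    using ab by (intro funpow_wave energy_op_wave moderate_energy)
  note 1 = P[OF conjunct1[OF 0] conjunct1[OF conjunct2[OF 0]], of 3 a3]
  note 2 = P[OF conjunct1[OF 1] conjunct1[OF conjunct2[OF 1]], of 2 a2]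
  note 3 = P[OF conjunct1[OF 2] conjunct1[OF conjunct2[OF 2]], of 1 a1]
  have "monomial_op \<alpha> (wave m a b) = (momentum_op 1 ^^ a1) ((momentum_op 2 ^^ a2) ((momentum_op 3 ^^ a3) ((energy_op ^^ a0) (wave m a b))))"
    by (simp add: \<alpha>)
  also have "\<dots> = wave m
     (\<lambda>p. of_real (vec_nth p 1 ^ a1) * (of_real (vec_nth p 2 ^ a2) * (of_real (vec_nth p 3 ^ a3) * (of_real (energy m p ^ a0) * a p))))
     (\<lambda>p. of_real ((- vec_nth p 1) ^ a1) * (of_real ((- vec_nth p 2) ^ a2) * (of_real ((- vec_nth p 3) ^ a3) * (of_real ((- energy m p) ^ a0) * b p))))"
    unfolding conjunct2[OF conjunct2[OF 0]] conjunct2[OF conjunct2[OF 1]]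
      conjunct2[OF conjunct2[OF 2]] conjunct2[OF conjunct2[OF 3]] ..
  finally show ?thesis
    using conjunct1[OF 3] conjunct1[OF conjunct2[OF 3]] by (simp add: \<alpha> on_shell_def mult.assoc)
qed

section \<open>Matrix elements on Fock space\<close>

text \<open>The configuration with species and spins taken from \<open>ls\<close> and momenta from
  \<open>k\<close>, in the form in which \<open>fock_domain\<close> expresses continuity. Entries of
  \<open>k\<close> beyond the length of \<open>ls\<close> have no influence.\<close>

definition attach :: "('k \<times> nat) list \<Rightarrow> (nat \<Rightarrow> real^3) \<Rightarrow> 'k config list" where
  "attach ls k = map (\<lambda>i. (fst (ls ! i), snd (ls ! i), k i)) [0..<length ls]"

definition weight :: "nat \<Rightarrow> 'k config list \<Rightarrow> real" where
  "weight N qs = (\<Prod>q\<leftarrow>qs. (1 + norm (snd (snd q))) ^ N)"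

lemma length_attach [simp]: "length (attach ls k) = length ls"
  by (simp add: attach_def)

lemma attach_snoc: "attach (ls @ [(s, \<sigma>)]) (k(length ls := p)) = attach ls k @ [(s, \<sigma>, p)]"
  by (simp add: attach_def nth_append)

lemma tl_attach: "tl (attach ls k) = attach (tl ls) (\<lambda>i. k (Suc i))"
proof (rule nth_equalityI)
  fix i assume "i < length (tl (attach ls k))"
  then have "i < length ls - 1" by simp
  then show "tl (attach ls k) ! i = attach (tl ls) (\<lambda>i. k (Suc i)) ! i"
    by (simp add: attach_def nth_tl map_tl[symmetric])
qed simp

lemma weight_append: "weight N (qs @ qs') = weight N qs * weight N qs'"
  by (simp add: weight_def)

lemma weight_0: "weight 0 qs = 1"
  by (induction qs) (simp_all add: weight_def)

lemma weight_ge_1: "1 \<le> weight N qs"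
proof (induction qs)
  case (Cons q qs)
  have "1 \<le> (1 + norm (snd (snd q))) ^ N" by (intro one_le_power) simp
  then have "1 * 1 \<le> (1 + norm (snd (snd q))) ^ N * weight N qs"
    using Cons by (intro mult_mono) auto
  then show ?case by (simp add: weight_def)
qed (simp add: weight_def)

lemma config_integral_cong:
  "(\<And>qs. length qs = n \<Longrightarrow> F qs = G qs) \<Longrightarrow> config_integral j n F = config_integral j n G"
proof (induction n arbitrary: F G)
  case (Suc n)
  have "config_integral j n (\<lambda>qs. F ((s, \<sigma>, p) # qs)) = config_integral j n (\<lambda>qs. G ((s, \<sigma>, p) # qs))" for s \<sigma> p
    by (rule Suc.IH) (simp add: Suc.prems)
  then show ?case by simp
qed simp

lemma config_integral_zero: "config_integral j n (\<lambda>_. 0) = 0"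
  by (induction n) simp_all

text \<open>The momenta of the first \<open>length ls\<close> configurations are parameters; storing them in a sequence
  keeps the parameter space the same type throughout the induction.\<close>

lemma config_integral_measurable:
  fixes F :: "'k::finite config list \<Rightarrow> complex"
  assumes "\<And>ls. length ls = r + n \<Longrightarrow> (\<lambda>k. F (attach ls k)) \<in> borel_measurable borel"
    and "length ls = r"
  shows "(\<lambda>k. config_integral j n (\<lambda>qs. F (attach ls k @ qs))) \<in> borel_measurable borel"
  using assms
proof (induction n arbitrary: r ls)
  case 0
  then show ?case by simp
next
  case (Suc n)
  have meas: "(\<lambda>k. LINT p|lborel. config_integral j n (\<lambda>qs. F (attach ls k @ (s, \<sigma>, p) # qs)))
      \<in> borel_measurable borel" for s \<sigma>
  proof (rule lborel.borel_measurable_lebesgue_integral)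
    have G: "(\<lambda>k. config_integral j n (\<lambda>qs. F (attach (ls @ [(s, \<sigma>)]) k @ qs))) \<in> borel_measurable borel"
      by (rule Suc.IH[of "Suc r"]) (use Suc.prems in auto)
    \<comment> \<open>Writing the integration variable into position \<open>r\<close> of the
      sequence turns the integrand into the case of one more fixed configuration, to which the
      induction hypothesis applies.\<close>
    have upd: "(\<lambda>x. (fst x)(r := snd x)) \<in> borel \<Otimes>\<^sub>M (lborel :: (real^3) measure) \<rightarrow>\<^sub>M borel"
    proof (rule measurable_coordinatewise_then_product)
      fix i :: nat
      have "(\<lambda>k::nat \<Rightarrow> real^3. k i) \<in> borel_measurable borel"
        by (intro borel_measurable_continuous_onI continuous_on_product_coordinates)
      from measurable_compose[OF measurable_fst this]
      show "(\<lambda>x. ((fst x)(r := snd x)) i) \<in> borel_measurable (borel \<Otimes>\<^sub>M (lborel :: (real^3) measure))"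
        by (cases "i = r") (auto simp: measurable_lborel1)
    qed
    show "(\<lambda>(k, p). config_integral j n (\<lambda>qs. F (attach ls k @ (s, \<sigma>, p) # qs)))
        \<in> borel_measurable (borel \<Otimes>\<^sub>M lborel)"
      using measurable_compose[OF upd G]
      by (simp add: attach_snoc[of ls, unfolded Suc.prems(2)] case_prod_beta)
  qed
  show ?case by (simp, intro borel_measurable_sum meas)
qed

text \<open>A function that is not integrable has integral 0 by convention, and \<open>g\<close> is
  nonnegative, so the bound covers that case as well.\<close>

lemma norm_integral_le:
  fixes f :: "'a::euclidean_space \<Rightarrow> 'b::{banach, second_countable_topology}"
  assumes "integrable M g" "\<And>x. norm (f x) \<le> g x"
  shows "norm (integral\<^sup>L M f) \<le> integral\<^sup>L M g"
proof (cases "integrable M f")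
  case True
  then show ?thesis using assms by (intro Bochner_Integration.integral_norm_bound_integral)
next
  case False
  have "0 \<le> integral\<^sup>L M g"
    using assms(2) by (intro Bochner_Integration.integral_nonneg) (meson norm_ge_zero order_trans)
  then show ?thesis by (simp add: not_integrable_integral_eq[OF False])
qed

text \<open>Each integration costs the factor \<open>c\<close>: the number of species, times the
  number of spin values, times the integral of the inverse weight. In \<open>M\<close>, two powers
  per dimension secure integrability and \<open>N\<close> more remain as decay in the fixed
  momenta.\<close>

lemma config_integral_bound:
  fixes F :: "'k::finite config list \<Rightarrow> complex" and N :: nat and j :: real
  defines "M \<equiv> 2 * DIM(real^3) + N"
  defines "c \<equiv> real (CARD('k)) * (real (Suc (twice j)) * (LINT p|lborel. inverse ((1 + norm (p :: real^3)) ^ M)))"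
  assumes "\<And>qs. length qs = r + n \<Longrightarrow> weight M qs * norm (F qs) \<le> K" and "length ps = r"
  shows "weight M ps * norm (config_integral j n (\<lambda>qs. F (ps @ qs))) \<le> c ^ n * K"
  using assms(3,4)
proof (induction n arbitrary: r ps)
  case 0
  then show ?case by simp
next
  case (Suc n)
  define I where "I = (LINT p|lborel. inverse ((1 + norm (p :: real^3)) ^ M))"
  define w where "w = weight M ps"
  have w: "w > 0" using weight_ge_1[of M ps] by (simp add: w_def)
  have int: "integrable lborel (\<lambda>p::real^3. inverse ((1 + norm p) ^ M))"
    unfolding M_def by (rule integrable_inverse_power_norm)
  have b: "norm (LINT p|lborel. config_integral j n (\<lambda>qs. F (ps @ (s, \<sigma>, p) # qs))) \<le> c ^ n * K / w * I" for s \<sigma>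
  proof -
    have "norm (config_integral j n (\<lambda>qs. F (ps @ (s, \<sigma>, p) # qs))) \<le> c ^ n * K / w * inverse ((1 + norm p) ^ M)" for p
    proof -
      have pos: "(1 + norm p) ^ M > 0" by (intro zero_less_power add_pos_nonneg) auto
      have "weight M (ps @ [(s, \<sigma>, p)]) * norm (config_integral j n (\<lambda>qs. F ((ps @ [(s, \<sigma>, p)]) @ qs))) \<le> c ^ n * K"
        by (rule Suc.IH[of "Suc r"]) (use Suc.prems in auto)
      moreover have "weight M (ps @ [(s, \<sigma>, p)]) = w * (1 + norm p) ^ M"
        by (simp add: weight_append w_def) (simp add: weight_def)
      ultimately show ?thesis using pos w by (simp add: field_simps)
    qed
    from norm_integral_le[OF integrable_mult_right[OF int] this]
    show ?thesis by (simp add: I_def)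
  qed
  have "norm (config_integral j (Suc n) (\<lambda>qs. F (ps @ qs))) \<le> (\<Sum>s\<in>(UNIV::'k set). \<Sum>\<sigma>\<le>twice j. c ^ n * K / w * I)"
    unfolding config_integral.simps by (intro sum_norm_le b)
  also have "\<dots> = c ^ Suc n * K / w" by (simp add: c_def I_def)
  finally show ?case using w by (simp add: w_def[symmetric] field_simps)
qed

lemma rapid_config_integral:
  fixes F :: "'k::finite config list \<Rightarrow> complex"
  assumes meas: "\<And>ls. length ls = Suc n \<Longrightarrow> (\<lambda>k. F (attach ls k)) \<in> borel_measurable borel"
    and bound: "\<And>N. \<exists>K. \<forall>qs. length qs = Suc n \<longrightarrow> weight N qs * norm (F qs) \<le> K"
  shows "(\<lambda>p. config_integral j n (\<lambda>qs. F ((s, \<sigma>, p) # qs))) \<in> rapid"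
proof (rule rapidI)
  have "(\<lambda>k. config_integral j n (\<lambda>qs. F (attach [(s, \<sigma>)] k @ qs))) \<in> borel_measurable borel"
    by (rule config_integral_measurable[of 1]) (use meas in auto)
  moreover have "(\<lambda>p (_ :: nat). p) \<in> borel_measurable (borel :: (real^3) measure)"
    by (rule measurable_coordinatewise_then_product) simp
  ultimately have "(\<lambda>p. config_integral j n (\<lambda>qs. F (attach [(s, \<sigma>)] (\<lambda>_. p) @ qs))) \<in> borel_measurable borel"
    by (rule measurable_compose[rotated])
  then show "(\<lambda>p. config_integral j n (\<lambda>qs. F ((s, \<sigma>, p) # qs))) \<in> borel_measurable borel"
    by (simp add: attach_def)
  fix N
  define M where "M = 2 * DIM(real^3) + N"
  obtain K where K: "\<And>qs. length qs = 1 + n \<Longrightarrow> weight M qs * norm (F qs) \<le> K"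
    using bound[of M] by auto
  show "\<exists>K. \<forall>p. (1 + norm p) ^ N * norm (config_integral j n (\<lambda>qs. F ((s, \<sigma>, p) # qs))) \<le> K"
  proof (intro exI allI)
    fix p :: "real^3"
    let ?I = "config_integral j n (\<lambda>qs. F ((s, \<sigma>, p) # qs))"
    have "(1 + norm p) ^ N * norm ?I \<le> weight M [(s, \<sigma>, p)] * norm ?I"
      by (intro mult_right_mono) (auto simp: weight_def M_def intro!: power_increasing)
    also have "\<dots> \<le> (real (CARD('k)) * (real (Suc (twice j)) *
        (LINT p|lborel. inverse ((1 + norm (p :: real^3)) ^ M)))) ^ n * K"
      using config_integral_bound[of 1 n N F K "[(s, \<sigma>, p)]" j] K unfolding M_def by simp
    finally show "(1 + norm p) ^ N * norm ?I \<le> \<dots>" .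
  qed
qed

text \<open>Finite particle number, measurability and decay: the properties from which rapid
  decrease of matrix elements is derived, for bra and ket alike.\<close>

definition regular_state :: "'k state \<Rightarrow> bool" where
  "regular_state \<Phi> \<longleftrightarrow> (\<exists>N. \<forall>qs. length qs > N \<longrightarrow> \<Phi> qs = 0) \<and>
     (\<forall>ls. (\<lambda>k. \<Phi> (attach ls k)) \<in> borel_measurable borel) \<and>
     (\<forall>n N. \<exists>K. \<forall>qs. length qs = n \<longrightarrow> weight N qs * norm (\<Phi> qs) \<le> K)"

lemma fock_domain_regular: "\<Phi> \<in> fock_domain j \<Longrightarrow> regular_state \<Phi>"
  unfolding fock_domain_def regular_state_def attach_def weight_def
  by (auto intro: borel_measurable_continuous_onI)

lemma regular_state_cnj: "regular_state \<Phi> \<Longrightarrow> regular_state (\<lambda>qs. cnj (\<Phi> qs))"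
  unfolding regular_state_def complex_mod_cnj by (auto intro: borel_measurable_continuous_on[OF continuous_on_cnj[OF continuous_on_id]])

text \<open>One statement serves both forms: \<open>f\<close> is the state with the additional
  particle of momentum \<open>p\<close>. For annihilation it is the ket and \<open>g\<close> the
  conjugated bra; for creation the roles are exchanged.\<close>

lemma rapid_contraction:
  fixes f g :: "'k::finite state"
  assumes f: "regular_state f" and g: "regular_state g"
  shows "(\<lambda>p. \<Sum>n. config_integral j n (\<lambda>qs. of_real (sqrt (real (length qs + 1))) * f ((s, \<sigma>, p) # qs) * g qs)) \<in> rapid"
proof -
  obtain N0 where N0: "\<And>qs. length qs > N0 \<Longrightarrow> g qs = 0"
    using g unfolding regular_state_def by blast
  have "(\<lambda>p. config_integral j n (\<lambda>qs. of_real (sqrt (real (length qs + 1))) * f ((s, \<sigma>, p) # qs) * g qs)) \<in> rapid" for n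
  proof -
    \<comment> \<open>\<open>F\<close> is a function of the full list, with \<open>g\<close> reading
      its tail; \<open>length qs\<close> here is the former \<open>length qs + 1\<close> under the
      root.\<close>
    define F where "F qs = complex_of_real (sqrt (real (length qs))) * f qs * g (tl qs)" for qs
    have "(\<lambda>p. config_integral j n (\<lambda>qs. F ((s, \<sigma>, p) # qs))) \<in> rapid"
    proof (rule rapid_config_integral)
      fix ls :: "('k \<times> nat) list"
      have "(\<lambda>k i. k (Suc i)) \<in> borel_measurable (borel :: (nat \<Rightarrow> real^3) measure)"
        by (intro borel_measurable_continuous_onI continuous_on_coordinatewise_then_product) simp
      then have "(\<lambda>k. g (attach (tl ls) (\<lambda>i. k (Suc i)))) \<in> borel_measurable borel"
        by (rule measurable_compose) (use g in \<open>simp add: regular_state_def\<close>)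
      moreover have "(\<lambda>k. f (attach ls k)) \<in> borel_measurable borel"
        using f by (simp add: regular_state_def)
      ultimately show "(\<lambda>k. F (attach ls k)) \<in> borel_measurable borel"
        unfolding F_def tl_attach length_attach by (intro borel_measurable_times) auto
    next
      fix N
      obtain K where K: "\<And>qs. length qs = Suc n \<Longrightarrow> weight N qs * norm (f qs) \<le> K"
        using f unfolding regular_state_def by blast
      obtain K' where K': "\<And>qs. length qs = n \<Longrightarrow> weight 0 qs * norm (g qs) \<le> K'"
        using g unfolding regular_state_def by blast
      have "weight N qs * norm (F qs) \<le> sqrt (real (Suc n)) * (K * K')" if "length qs = Suc n" for qs
      proof -
        have "norm (g (tl qs)) \<le> K'" using K'[of "tl qs"] that by (simp add: weight_0)
        moreover have "0 \<le> weight N qs * norm (f qs)" using weight_ge_1[of N qs] by simp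
        ultimately have "(weight N qs * norm (f qs)) * norm (g (tl qs)) \<le> K * K'"
          using K[OF that] by (intro mult_mono) auto
        then have "sqrt (real (Suc n)) * ((weight N qs * norm (f qs)) * norm (g (tl qs))) \<le> sqrt (real (Suc n)) * (K * K')"
          by (intro mult_left_mono) auto
        then show ?thesis by (simp add: F_def that norm_mult mult_ac)
      qed
      then show "\<exists>K. \<forall>qs. length qs = Suc n \<longrightarrow> weight N qs * norm (F qs) \<le> K" by blast
    qed
    then show ?thesis by (simp add: F_def)
  qed
  then have "(\<lambda>p. \<Sum>n\<le>N0. config_integral j n (\<lambda>qs. of_real (sqrt (real (length qs + 1))) * f ((s, \<sigma>, p) # qs) * g qs)) \<in> rapid"
    by (rule rapid_sum)
  moreover have "(\<Sum>n. config_integral j n (\<lambda>qs. of_real (sqrt (real (length qs + 1))) * f ((s, \<sigma>, p) # qs) * g qs)) =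
      (\<Sum>n\<le>N0. config_integral j n (\<lambda>qs. of_real (sqrt (real (length qs + 1))) * f ((s, \<sigma>, p) # qs) * g qs))" for p
  proof (rule suminf_finite)
    fix n assume "n \<notin> {..N0}"
    then have "config_integral j n (\<lambda>qs. of_real (sqrt (real (length qs + 1))) * f ((s, \<sigma>, p) # qs) * g qs) =
        config_integral j n (\<lambda>_ :: 'k config list. 0)"
      by (intro config_integral_cong) (simp add: N0)
    then show "config_integral j n (\<lambda>qs. of_real (sqrt (real (length qs + 1))) * f ((s, \<sigma>, p) # qs) * g qs) = 0"
      by (simp only: config_integral_zero)
  qed simp
  ultimately show ?thesis by simp
qed

lemma rapid_annihilation_form:
  assumes "\<Phi> \<in> fock_domain j" "\<Psi> \<in> fock_domain j"
  shows "(\<lambda>p. annihilation_form j s \<sigma> p \<Phi> \<Psi>) \<in> rapid"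
  using rapid_contraction[OF fock_domain_regular[OF assms(2)] regular_state_cnj[OF fock_domain_regular[OF assms(1)]], of j s \<sigma>]
  by (simp add: annihilation_form_def fock_inner_def annihilate_def mult_ac)

lemma rapid_creation_form:
  assumes "\<Phi> \<in> fock_domain j" "\<Psi> \<in> fock_domain j"
  shows "(\<lambda>p. creation_form j s \<sigma> p \<Phi> \<Psi>) \<in> rapid"
  using rapid_contraction[OF regular_state_cnj[OF fock_domain_regular[OF assms(1)]] fock_domain_regular[OF assms(2)], of j s \<sigma>]
  by (simp add: creation_form_def fock_inner_def annihilate_def mult_ac)

section \<open>The field identity\<close>

lemma moderate_inverse_boost_norm:
  assumes m: "m > 0"
  shows "(\<lambda>p. complex_of_real (1 / boost_norm m p)) \<in> moderate"
proof (rule moderateI[of _ "1 / (2 * m)" 0])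
  have "continuous_on UNIV (boost_norm m)"
    unfolding boost_norm_def by (intro continuous_intros)
  then show "(\<lambda>p. complex_of_real (1 / boost_norm m p)) \<in> borel_measurable borel"
    by (intro borel_measurable_continuous_onI continuous_intros) (use boost_norm_pos[OF m] in \<open>auto simp: less_imp_neq[symmetric]\<close>)
  fix p
  have "2 * m \<le> boost_norm m p"
    unfolding boost_norm_def using energy_ge(1)[of m p] m
    by (intro real_le_rsqrt) (simp add: power2_eq_square)
  then have "1 / boost_norm m p \<le> 1 / (2 * m)" using m by (intro divide_left_mono) auto
  then show "norm (complex_of_real (1 / boost_norm m p)) \<le> 1 / (2 * m) * (1 + norm p) ^ 0"
    using boost_norm_pos[OF m, of p] by (simp add: norm_divide)
qed

lemma moderate_boost_mat:
  assumes m: "m > 0"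
  shows "moderate.mat_family 2 2 0 (boost_mat m)" "moderate.mat_family 2 2 0 (\<lambda>p. boost_mat m (- p))"
proof -
  have lin: "(\<lambda>p. complex_of_real (1 / boost_norm m p) * (c0 * of_real (energy m p) + (c * of_real m +
      (c1 * of_real (vec_nth p 1) + (c2 * of_real (vec_nth p 2) + c3 * of_real (vec_nth p 3)))))) \<in> moderate"
    for c0 c c1 c2 c3
    by (intro moderate.mult moderate.add moderate.cmult moderate.const moderate_inverse_boost_norm m
      moderate_energy moderate_component)
  have fam: "moderate.mat_family 2 2 0 (\<lambda>p. boost_mat m (\<epsilon> *\<^sub>R p))" if "\<bar>\<epsilon>\<bar> = 1" for \<epsilon>
  proof -
    have e: "energy m (\<epsilon> *\<^sub>R p) = energy m p" for p using that by (simp add: energy_def)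
    have n: "boost_norm m (\<epsilon> *\<^sub>R p) = boost_norm m p" for p by (simp add: boost_norm_def e)
    show ?thesis
      unfolding boost_mat_22 e n
    proof (rule moderate.mat_family_22, goal_cases)
      case 1 then show ?case using lin[of 1 1 0 0 "- of_real \<epsilon>"] by (simp add: algebra_simps add_divide_distrib diff_divide_distrib)
    next
      case 2 then show ?case using lin[of 0 0 "- of_real \<epsilon>" "\<i> * of_real \<epsilon>" 0]
        by (simp add: Complex_eq algebra_simps diff_divide_distrib)
    next
      case 3 then show ?case using lin[of 0 0 "- of_real \<epsilon>" "- \<i> * of_real \<epsilon>" 0]
        by (simp add: Complex_eq algebra_simps diff_divide_distrib)
    next
      case 4 then show ?case using lin[of 1 1 0 0 "of_real \<epsilon>"]
        by (simp add: algebra_simps add_divide_distrib)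
    qed
  qed
  from fam[of 1] fam[of "- 1"]
  show "moderate.mat_family 2 2 0 (boost_mat m)" "moderate.mat_family 2 2 0 (\<lambda>p. boost_mat m (- p))"
    by simp_all
qed

lemma coeff_fun_carrier:
  "u A B \<in> carrier_mat (AB_dim A B) n \<Longrightarrow> coeff_fun m A B u p \<in> carrier_mat (AB_dim A B) n"
  unfolding coeff_fun_def by (intro smult_carrier_mat mult_carrier_mat[OF AB_rep_carrier])

text \<open>The entries of a boost grow at most polynomially and the representation is polynomial in
  them, so multiplying by coefficient functions preserves rapid decrease.\<close>

lemma moderate_coeff_fun:
  assumes m: "m > 0" and u: "u A B \<in> carrier_mat (AB_dim A B) n"
    and i: "i < AB_dim A B" and k: "k < n"
  shows "(\<lambda>p. coeff_fun m A B u p $$ (i, k)) \<in> moderate"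
proof -
  have "moderate.mat_family (AB_dim A B) (AB_dim A B) 0 (\<lambda>p. AB_rep A B (boost_mat m p))"
    using moderate.mat_family_kron[OF moderate.mat_family_spin_rep[OF moderate_boost_mat(1)[OF m], of A]
        moderate.mat_family_spin_rep[OF moderate_boost_mat(2)[OF m], of B]]
    by (simp add: AB_rep_boost[OF m] AB_dim_def)
  from moderate.mat_family_mult[OF this moderate.mat_family_const[OF u]]
  have fam: "moderate.mat_family (AB_dim A B) n 0 (\<lambda>p. AB_rep A B (boost_mat m p) * u A B)" by simp
  have sq: "(\<lambda>p. complex_of_real (sqrt (m / energy m p))) \<in> moderate"
  proof (rule moderateI[of _ 1 0])
    have pos: "energy m p > 0" for p using energy_ge(1)[of m p] m by linarith
    show "(\<lambda>p. complex_of_real (sqrt (m / energy m p))) \<in> borel_measurable borel"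
      by (intro borel_measurable_continuous_onI continuous_intros) (use pos in \<open>auto simp: less_imp_neq[symmetric]\<close>)
    show "norm (complex_of_real (sqrt (m / energy m p))) \<le> 1 * (1 + norm p) ^ 0" for p
      using energy_ge(1)[of m p] m pos[of p] by simp
  qed
  have "coeff_fun m A B u p $$ (i, k) =
      complex_of_real (sqrt (m / energy m p)) * (AB_rep A B (boost_mat m p) * u A B) $$ (i, k)" for p
    unfolding coeff_fun_def boost_on_shell[OF m]
    by (rule index_smult_mat(1)) (use carrier_matD[OF moderate.mat_family_carrier[OF fam, of p]] i k in simp_all)
  then show ?thesis
    using moderate.mult[OF sq, of "\<lambda>p. (AB_rep A B (boost_mat m p) * u A B) $$ (i, k)"] fam i k
    by (simp add: moderate.mat_family_def)
qed

text \<open>The boost of type (C, D) cancels its inverse, and orthonormality of the columns removes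
  the rest. The phase convention rewrites the spin sum through \<open>v\<close>, so the same
  computation covers antiparticles.\<close>

lemma twisted_spin_sum_coeff_fun:
  assumes m: "m > 0" and cs: "coefficient_system j u v"
    and AB: "admissible j A B" and CD: "admissible j C D"
  shows "twisted_spin_sum m u A B C D (on_shell m p) * coeff_fun m C D u p = coeff_fun m A B u p"
    and "twisted_spin_sum m u A B C D (on_shell m p) * coeff_fun m C D v p = coeff_fun m A B v p"
proof -
  let ?J = "twice j + 1" and ?L = "boost_mat m p"
  let ?inv = "AB_rep C D (boost_mat m (- p))"
  have uv: "u A B \<in> carrier_mat (AB_dim A B) ?J" "u C D \<in> carrier_mat (AB_dim C D) ?J"
      "v A B \<in> carrier_mat (AB_dim A B) ?J" "v C D \<in> carrier_mat (AB_dim C D) ?J"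
      "mat_adjoint (u C D) * u C D = 1\<^sub>m ?J" "mat_adjoint (v C D) * v C D = 1\<^sub>m ?J"
      "u A B * mat_adjoint (u C D) = v A B * mat_adjoint (v C D)"
    using cs AB CD unfolding coefficient_system_def by blast+
  have inv: "?inv * AB_rep C D ?L = 1\<^sub>m (AB_dim C D)"
    using AB_rep_boost_inverse[OF m, of C D "- p"] by simp
  have T: "twisted_spin_sum m u A B C D (on_shell m p) = AB_rep A B ?L * (u A B * mat_adjoint (u C D)) * ?inv"
    using assoc_mult_mat[OF AB_rep_carrier uv(1), of "mat_adjoint (u C D)" "AB_dim C D" ?L] uv(2)
    by (simp add: twisted_spin_sum_def boost_on_shell[OF m] inv_AB_rep_boost[OF m])
  have key: "AB_rep A B ?L * (w * mat_adjoint w') * ?inv * (AB_rep C D ?L * w') = AB_rep A B ?L * w"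
    if w: "w \<in> carrier_mat (AB_dim A B) ?J" and w': "w' \<in> carrier_mat (AB_dim C D) ?J"
      and one: "mat_adjoint w' * w' = 1\<^sub>m ?J" for w w'
  proof -
    have w'a: "mat_adjoint w' \<in> carrier_mat ?J (AB_dim C D)" using w' by simp
    have Q: "w * mat_adjoint w' \<in> carrier_mat (AB_dim A B) (AB_dim C D)"
      by (rule mult_carrier_mat[OF w w'a])
    have KQ: "AB_rep A B ?L * (w * mat_adjoint w') \<in> carrier_mat (AB_dim A B) (AB_dim C D)"
      by (rule mult_carrier_mat[OF AB_rep_carrier Q])
    have "?inv * (AB_rep C D ?L * w') = w'"
      unfolding assoc_mult_mat[OF AB_rep_carrier AB_rep_carrier w', symmetric] inv
      by (rule left_mult_one_mat[OF w'])
    moreover have "w * mat_adjoint w' * w' = w"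
      unfolding assoc_mult_mat[OF w w'a w'] one by (rule right_mult_one_mat[OF w])
    ultimately show ?thesis
      using assoc_mult_mat[OF KQ AB_rep_carrier mult_carrier_mat[OF AB_rep_carrier w'], of "boost_mat m (- p)" ?L]
        assoc_mult_mat[OF AB_rep_carrier Q w', of ?L] by simp
  qed
  have TC: "twisted_spin_sum m u A B C D (on_shell m p) \<in> carrier_mat (AB_dim A B) (AB_dim C D)"
    unfolding T using uv(1,2) by (intro mult_carrier_mat[OF _ AB_rep_carrier] mult_carrier_mat[OF AB_rep_carrier]) simp
  show "twisted_spin_sum m u A B C D (on_shell m p) * coeff_fun m C D u p = coeff_fun m A B u p"
    unfolding coeff_fun_def boost_on_shell[OF m]
      mult_smult_distrib[OF TC mult_carrier_mat[OF AB_rep_carrier uv(2)]]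
    unfolding T key[OF uv(1,2,5)] ..
  show "twisted_spin_sum m u A B C D (on_shell m p) * coeff_fun m C D v p = coeff_fun m A B v p"
    unfolding coeff_fun_def boost_on_shell[OF m]
      mult_smult_distrib[OF TC mult_carrier_mat[OF AB_rep_carrier uv(4)]]
    unfolding T uv(7) key[OF uv(3,4,6)] ..
qed

section \<open>Fields as superpositions of plane waves\<close>

definition particle_amplitude ::
  "real \<Rightarrow> real \<Rightarrow> (real \<Rightarrow> real \<Rightarrow> complex mat) \<Rightarrow> 'k::finite \<Rightarrow> 'k state \<Rightarrow> 'k state \<Rightarrow>
     real \<Rightarrow> real \<Rightarrow> nat \<Rightarrow> real^3 \<Rightarrow> complex" where
  "particle_amplitude m j u s \<Phi> \<Psi> A B i p = complex_of_real ((2 * pi) powr (- 3 / 2)) *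
     (\<Sum>\<sigma>\<le>twice j. coeff_fun m A B u p $$ (i, \<sigma>) * annihilation_form j s \<sigma> p \<Phi> \<Psi>)"

definition antiparticle_amplitude ::
  "real \<Rightarrow> real \<Rightarrow> (real \<Rightarrow> real \<Rightarrow> complex mat) \<Rightarrow> 'k::finite \<Rightarrow> 'k state \<Rightarrow> 'k state \<Rightarrow>
     real \<Rightarrow> real \<Rightarrow> nat \<Rightarrow> real^3 \<Rightarrow> complex" where
  "antiparticle_amplitude m j v s \<Phi> \<Psi> A B i p = complex_of_real ((2 * pi) powr (- 3 / 2)) *
     (\<Sum>\<sigma>\<le>twice j. (- 1) ^ twice B * coeff_fun m A B v p $$ (i, \<sigma>) * creation_form j s \<sigma> p \<Phi> \<Psi>)"

lemma free_field_wave: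
  assumes m: "m > 0" and cs: "coefficient_system j u v" and AB: "admissible j A B"
    and \<Phi>: "\<Phi> \<in> fock_domain j" and \<Psi>: "\<Psi> \<in> fock_domain j" and i: "i < AB_dim A B"
  shows "particle_amplitude m j u s \<Phi> \<Psi> A B i \<in> rapid"
    and "antiparticle_amplitude m j v s' \<Phi> \<Psi> A B i \<in> rapid"
    and "free_field m j u v s s' \<Phi> \<Psi> A B i = wave m (particle_amplitude m j u s \<Phi> \<Psi> A B i)
      (antiparticle_amplitude m j v s' \<Phi> \<Psi> A B i)"
proof -
  have uv: "u A B \<in> carrier_mat (AB_dim A B) (Suc (twice j))" "v A B \<in> carrier_mat (AB_dim A B) (Suc (twice j))"
    using cs AB unfolding coefficient_system_def by auto
  have a: "(\<lambda>p. coeff_fun m A B u p $$ (i, \<sigma>) * annihilation_form j s \<sigma> p \<Phi> \<Psi>) \<in> rapid"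
    and b: "(\<lambda>p. (- 1) ^ twice B * coeff_fun m A B v p $$ (i, \<sigma>) * creation_form j s' \<sigma> p \<Phi> \<Psi>) \<in> rapid"
    if "\<sigma> \<in> {..twice j}" for \<sigma>
    using that by (auto intro!: rapid_mult moderate.cmult moderate_coeff_fun m uv i
      rapid_annihilation_form rapid_creation_form \<Phi> \<Psi>)
  show "particle_amplitude m j u s \<Phi> \<Psi> A B i \<in> rapid" "antiparticle_amplitude m j v s' \<Phi> \<Psi> A B i \<in> rapid"
    unfolding particle_amplitude_def[abs_def] antiparticle_amplitude_def[abs_def]
    by (intro rapid_cmult rapid_sum a b; assumption)+
  show "free_field m j u v s s' \<Phi> \<Psi> A B i = wave m (particle_amplitude m j u s \<Phi> \<Psi> A B i)
      (antiparticle_amplitude m j v s' \<Phi> \<Psi> A B i)"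
  proof
    fix x
    have "free_field m j u v s s' \<Phi> \<Psi> A B i x = complex_of_real ((2 * pi) powr (- 3 / 2)) *
       (\<Sum>\<sigma>\<le>twice j. wave m (\<lambda>p. coeff_fun m A B u p $$ (i, \<sigma>) * annihilation_form j s \<sigma> p \<Phi> \<Psi>)
         (\<lambda>p. (- 1) ^ twice B * coeff_fun m A B v p $$ (i, \<sigma>) * creation_form j s' \<sigma> p \<Phi> \<Psi>) x)"
      unfolding free_field_def wave_def by (simp only: mult.assoc)
    then show "free_field m j u v s s' \<Phi> \<Psi> A B i x = wave m (particle_amplitude m j u s \<Phi> \<Psi> A B i)
        (antiparticle_amplitude m j v s' \<Phi> \<Psi> A B i) x"
      unfolding particle_amplitude_def[abs_def] antiparticle_amplitude_def[abs_def]
      by (simp only: wave_sum[OF a b] wave_cmult)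
  qed
qed

text \<open>The operator multiplies the positive-frequency amplitudes by the value of
  \<open>P\<close> on the mass shell and the negative-frequency ones by its value on the sheet of
  negative energy.\<close>

lemma diff_op_wave:
  assumes P: "is_mat_poly nr nc P" and i: "i < nr"
    and ab: "\<And>k. k < nc \<Longrightarrow> a k \<in> rapid" "\<And>k. k < nc \<Longrightarrow> b k \<in> rapid"
    and f: "\<And>k. k < nc \<Longrightarrow> f k = wave m (a k) (b k)"
  shows "diff_op nr nc P f i x = wave m (\<lambda>p. \<Sum>k<nc. poly_eval nr nc P (on_shell m p) $$ (i, k) * a k p)
      (\<lambda>p. \<Sum>k<nc. poly_eval nr nc P (- on_shell m p) $$ (i, k) * b k p) x"
proof -
  let ?S = "support nr nc P"
  let ?a = "\<lambda>k \<alpha> p. P \<alpha> $$ (i, k) * (of_real (monomial_eval \<alpha> (on_shell m p)) * a k p)"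
  let ?b = "\<lambda>k \<alpha> p. P \<alpha> $$ (i, k) * (of_real (monomial_eval \<alpha> (- on_shell m p)) * b k p)"
  have r: "?a k \<alpha> \<in> rapid" "?b k \<alpha> \<in> rapid" if "k < nc" for k \<alpha>
    using monomial_op_wave[OF ab[OF that], of \<alpha> m] by (auto intro: rapid_cmult)
  have "diff_op nr nc P f i x = (\<Sum>k<nc. \<Sum>\<alpha>\<in>?S. wave m (?a k \<alpha>) (?b k \<alpha>) x)"
    unfolding diff_op_def
  proof (intro sum.cong refl)
    fix k \<alpha> assume "k \<in> {..<nc}"
    then have k: "k < nc" by simp
    show "P \<alpha> $$ (i, k) * monomial_op \<alpha> (f k) x = wave m (?a k \<alpha>) (?b k \<alpha>) x"
      using monomial_op_wave[OF ab[OF k], of \<alpha> m] f[OF k] by (simp add: wave_cmult)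
  qed
  also have "\<dots> = (\<Sum>k<nc. wave m (\<lambda>p. \<Sum>\<alpha>\<in>?S. ?a k \<alpha> p) (\<lambda>p. \<Sum>\<alpha>\<in>?S. ?b k \<alpha> p) x)"
    by (intro sum.cong refl wave_sum r) auto
  also have "\<dots> = wave m (\<lambda>p. \<Sum>k<nc. \<Sum>\<alpha>\<in>?S. ?a k \<alpha> p) (\<lambda>p. \<Sum>k<nc. \<Sum>\<alpha>\<in>?S. ?b k \<alpha> p) x"
    by (intro wave_sum rapid_sum r) auto
  also have "(\<lambda>p. \<Sum>k<nc. \<Sum>\<alpha>\<in>?S. ?a k \<alpha> p) = (\<lambda>p. \<Sum>k<nc. poly_eval nr nc P (on_shell m p) $$ (i, k) * a k p)"
    using i by (intro ext sum.cong refl) (simp add: poly_eval_def sum_distrib_left mult_ac)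
  also have "(\<lambda>p. \<Sum>k<nc. \<Sum>\<alpha>\<in>?S. ?b k \<alpha> p) = (\<lambda>p. \<Sum>k<nc. poly_eval nr nc P (- on_shell m p) $$ (i, k) * b k p)"
    using i by (intro ext sum.cong refl) (simp add: poly_eval_def sum_distrib_left mult_ac)
  finally show ?thesis .
qed

text \<open>Exchanging the sums over components and spins produces a matrix product.
  \<open>c\<close> stands for the power of 2 pi and \<open>e\<close> for the sign in the creation
  part.\<close>

lemma sum_mat_mult_amplitude:
  fixes T W :: "complex mat"
  assumes "T \<in> carrier_mat nr nc" "W \<in> carrier_mat nc (Suc n)" "i < nr"
  shows "(\<Sum>k<nc. T $$ (i, k) * (c * (\<Sum>\<sigma>\<le>n. (e * W $$ (k, \<sigma>)) * g \<sigma>))) =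
    c * (\<Sum>\<sigma>\<le>n. (e * (T * W) $$ (i, \<sigma>)) * g \<sigma>)"
proof -
  have "(\<Sum>k<nc. T $$ (i, k) * (c * (\<Sum>\<sigma>\<le>n. (e * W $$ (k, \<sigma>)) * g \<sigma>))) =
      (\<Sum>\<sigma>\<le>n. \<Sum>k<nc. c * (e * (T $$ (i, k) * W $$ (k, \<sigma>)) * g \<sigma>))"
    by (simp add: sum_distrib_left mult_ac sum.swap[of _ "{..<nc}"])
  also have "\<dots> = c * (\<Sum>\<sigma>\<le>n. (e * (\<Sum>k<nc. T $$ (i, k) * W $$ (k, \<sigma>))) * g \<sigma>)"
    by (simp add: sum_distrib_left sum_distrib_right)
  also have "\<dots> = c * (\<Sum>\<sigma>\<le>n. (e * (T * W) $$ (i, \<sigma>)) * g \<sigma>)"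
    using assms by (intro arg_cong2[of _ _ _ _ "(*)"] sum.cong refl)
      (auto simp: scalar_prod_def atLeast0LessThan)
  finally show ?thesis .
qed

theorem theorem4p2:
  fixes m j A B C D :: real
    and u v :: "real \<Rightarrow> real \<Rightarrow> complex mat"
    and s s' :: "'k::finite"
  assumes "m > 0" and "half_int j"
    and "admissible j A B" and "admissible j C D"
    and "coefficient_system j u v"
  shows "(\<exists>P. is_twisted_poly m u A B C D P) \<and>
    (\<forall>P. is_twisted_poly m u A B C D P \<longrightarrow>
      (\<forall>\<Phi> \<in> fock_domain j. \<forall>\<Psi> \<in> fock_domain j. \<forall>i < AB_dim A B. \<forall>x.
         free_field m j u v s s' \<Phi> \<Psi> A B i x =
         diff_op (AB_dim A B) (AB_dim C D) P (free_field m j u v s s' \<Phi> \<Psi> C D) i x))"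
proof (intro conjI allI impI ballI)
  show "\<exists>P. is_twisted_poly m u A B C D P"
    by (rule twisted_poly_exists[OF assms(1,2,5,3,4)])
next
  fix P i x and \<Phi> \<Psi> :: "'k state"
  assume P: "is_twisted_poly m u A B C D P" and \<Phi>: "\<Phi> \<in> fock_domain j" and \<Psi>: "\<Psi> \<in> fock_domain j"
    and i: "i < AB_dim A B"
  let ?nr = "AB_dim A B" and ?nc = "AB_dim C D"
  let ?T = "\<lambda>p. twisted_spin_sum m u A B C D (on_shell m p)"
  have poly: "is_mat_poly ?nr ?nc P" and shell: "\<And>p. poly_eval ?nr ?nc P (on_shell m p) = ?T p"
    and parity: "\<And>p. poly_eval ?nr ?nc P (- p) = (- 1) ^ (twice A + twice C) \<cdot>\<^sub>m poly_eval ?nr ?nc P p"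
    using P unfolding is_twisted_poly_def Let_def by auto
  have T: "?T p \<in> carrier_mat ?nr ?nc" for p
    unfolding shell[symmetric] by (simp add: poly_eval_def)
  have W: "coeff_fun m C D u p \<in> carrier_mat ?nc (Suc (twice j))" "coeff_fun m C D v p \<in> carrier_mat ?nc (Suc (twice j))" for p
    using assms(4,5) unfolding coefficient_system_def by (auto intro: coeff_fun_carrier)
  note field = free_field_wave[OF assms(1,5)]
  note spin_sum = twisted_spin_sum_coeff_fun[OF assms(1,5,3,4)]
  have "diff_op ?nr ?nc P (free_field m j u v s s' \<Phi> \<Psi> C D) i x =
      wave m (\<lambda>p. \<Sum>k<?nc. ?T p $$ (i, k) * particle_amplitude m j u s \<Phi> \<Psi> C D k p)
        (\<lambda>p. \<Sum>k<?nc. poly_eval ?nr ?nc P (- on_shell m p) $$ (i, k) * antiparticle_amplitude m j v s' \<Phi> \<Psi> C D k p) x"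
    unfolding shell[symmetric]
    by (rule diff_op_wave[OF poly i]) (use field[OF assms(4) \<Phi> \<Psi>] in auto)
  also have "(\<lambda>p. \<Sum>k<?nc. ?T p $$ (i, k) * particle_amplitude m j u s \<Phi> \<Psi> C D k p) =
      particle_amplitude m j u s \<Phi> \<Psi> A B i"
    unfolding particle_amplitude_def
    using sum_mat_mult_amplitude[OF T W(1) i, where e = 1] by (simp add: spin_sum)
  also have "(\<lambda>p. \<Sum>k<?nc. poly_eval ?nr ?nc P (- on_shell m p) $$ (i, k) * antiparticle_amplitude m j v s' \<Phi> \<Psi> C D k p) =
      antiparticle_amplitude m j v s' \<Phi> \<Psi> A B i"
  proof
    fix p
    \<comment> \<open>Parity of \<open>P\<close> contributes the exponent 2 A + 2 C and the field of
      type (C, D) contributes 2 D; modulo 2 their sum is 2 B, the exponent in the field of type (A,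
      B).\<close>
    have sign: "(- 1 :: complex) ^ (twice A + twice C) * (- 1) ^ twice D = (- 1) ^ twice B"
      using admissible_parity[OF assms(2,3,4)] by (auto simp: power_add[symmetric] minus_one_power_iff)
    have "poly_eval ?nr ?nc P (- on_shell m p) $$ (i, k) = (- 1) ^ (twice A + twice C) * ?T p $$ (i, k)" if "k < ?nc" for k
      using T[of p] i that by (simp add: parity shell)
    then have "(\<Sum>k<?nc. poly_eval ?nr ?nc P (- on_shell m p) $$ (i, k) * antiparticle_amplitude m j v s' \<Phi> \<Psi> C D k p) =
        (- 1) ^ (twice A + twice C) * (\<Sum>k<?nc. ?T p $$ (i, k) * antiparticle_amplitude m j v s' \<Phi> \<Psi> C D k p)"
      by (simp add: sum_distrib_left mult.assoc)
    also have "\<dots> = (- 1) ^ (twice A + twice C) * (complex_of_real ((2 * pi) powr (- 3 / 2)) *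
       (\<Sum>\<sigma>\<le>twice j. (- 1) ^ twice D * coeff_fun m A B v p $$ (i, \<sigma>) * creation_form j s' \<sigma> p \<Phi> \<Psi>))"
      unfolding antiparticle_amplitude_def sum_mat_mult_amplitude[OF T W(2) i] spin_sum ..
    also have "\<dots> = antiparticle_amplitude m j v s' \<Phi> \<Psi> A B i p"
      unfolding antiparticle_amplitude_def sign[symmetric] by (simp add: sum_distrib_left mult_ac)
    finally show "(\<Sum>k<?nc. poly_eval ?nr ?nc P (- on_shell m p) $$ (i, k) * antiparticle_amplitude m j v s' \<Phi> \<Psi> C D k p) =
      antiparticle_amplitude m j v s' \<Phi> \<Psi> A B i p" .
  qed
  finally show "free_field m j u v s s' \<Phi> \<Psi> A B i x =
      diff_op ?nr ?nc P (free_field m j u v s s' \<Phi> \<Psi> C D) i x"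
    using field(3)[OF assms(3) \<Phi> \<Psi> i] by simp
qed

end
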